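(* Let $\mathbb{T}$ be a monad on $\mathsf{Set}$. Then $\mathrm{Alg}(\mathbb{T})$ is cocomplete, and for any cocomplete category $\mathcal{C}$ we have an equivalence of categories $$\mathrm{Hom}_{\mathrm{c}}(\mathrm{Alg}(\mathbb{T}),\mathcal{C}) \simeq \mathrm{CoAlg}_{\mathcal{C}}(\mathbb{T}).$$
   Context: Conventions: categories are locally small unless otherwise stated; colimits are small. $\mathrm{Hom}_{\mathrm{c}}$ denotes the category of cocontinuous functors (preserving small colimits) and natural transformations. $\mathrm{Alg}(\mathbb{T})$ is the category of $\mathbb{T}$-algebras in $\mathsf{Set}$. For a category $\mathcal{C}$ with (small) coproducts, $\mathrm{CoAlg}_{\mathcal{C}}(\mathbb{T}):=\mathrm{Alg}_{\mathcal{C}^{\mathrm{op}}}(\mathbb{T})^{\mathrm{op}}$ is the category of internal $\mathbb{T}$-coalgebras in $\mathcal{C}$, where, for a category $\mathcal{D}$ with products, $\mathrm{Alg}_{\mathcal{D}}(\mathbb{T})$ is the category of product-preserving functors $\mathcal{K}^{\mathrm{op}}\to\mathcal{D}$ and natural transformations, $\mathcal{K}$ being the Kleisli category of $\mathbb{T}$ (the category of free $\mathbb{T}$-algebras). Equivalently, a $\mathbb{T}$-coalgebra in $\mathcal{C}$ is an object $X\in\mathcal{C}$ with a morphism of monads $\alpha:\mathbb{T}\to\mathrm{Hom}(X,(-)\otimes X)$ on $\mathsf{Set}$, where $I\otimes X=\coprod_{i\in I}X$ and the monad $I\mapsto\mathrm{Hom}(X,I\otimes X)$ has unit $i\mapsto$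 ($i$-th coproduct inclusion) and Kleisli extension given by extending $(X\to J\otimes X)_{i\in I}$ to $I\otimes X\to J\otimes X$ and composing; a morphism $(X,\alpha)\to(Z,\beta)$ is a morphism $f:X\to Z$ with $(I\otimes f)\circ\alpha_I(t)=\beta_I(t)\circ f$ for all sets $I$ and $t\in T(I)$, where $T$ is the underlying functor of $\mathbb{T}$. *)

theory Defs
  imports "HOL-Library.FuncSet" "HOL-Library.Equipollence"
begin

section \<open>Size\<close>

text \<open>
  A type of class \<open>universe\<close> plays the role of a Grothendieck universe \<open>U\<close>. The elements of
  \<open>U\<close> are exactly the subsets of \<open>U\<close> of cardinality strictly less than that of \<open>U\<close>; so the
  small sets are the subsets of the type whose cardinality is less than that of the type, and
  the axioms say that this cardinality is an infinite regular strong limit cardinal. As in SGA 4,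
  the universe of hereditarily finite sets is not excluded; it
  is the case of the instance \<open>nat\<close>, where small means finite.
\<close>

class universe =
  assumes universe_infinite: "infinite (UNIV :: 'a set)"
    and universe_Pow: "(A :: 'a set) \<prec> (UNIV :: 'a set) \<Longrightarrow> Pow A \<prec> (UNIV :: 'a set)"
    and universe_UN: "(A :: 'a set) \<prec> (UNIV :: 'a set) \<Longrightarrow>
      (\<And>x. x \<in> A \<Longrightarrow> (B :: 'a \<Rightarrow> 'a set) x \<prec> (UNIV :: 'a set)) \<Longrightarrow> (\<Union>x\<in>A. B x) \<prec> (UNIV :: 'a set)"

lemma lesspoll_UNIV_nat_iff: "A \<prec> (UNIV :: nat set) \<longleftrightarrow> finite A"
  by (meson finite_lesspoll_infinite infinite_UNIV_nat infinite_le_lepoll lepoll_antisym lesspoll_def)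

instance nat :: universe
  by standard (auto simp: lesspoll_UNIV_nat_iff)

definition small :: "'u itself \<Rightarrow> 'a set \<Rightarrow> bool" where
  "small U A \<longleftrightarrow> A \<prec> (UNIV :: 'u set)"


section \<open>Categories, functors, natural transformations\<close>

record ('o, 'a) cat =
  Obj :: "'o set"
  Arr :: "'a set"
  Dom :: "'a \<Rightarrow> 'o"
  Cod :: "'a \<Rightarrow> 'o"
  Ident :: "'o \<Rightarrow> 'a"
  Comp :: "'a \<Rightarrow> 'a \<Rightarrow> 'a" (infixl "\<cdot>\<index>" 70)

definition hom :: "('o, 'a) cat \<Rightarrow> 'o \<Rightarrow> 'o \<Rightarrow> 'a set" where
  "hom C X Y = {f \<in> Arr C. Dom C f = X \<and> Cod C f = Y}"

locale category =
  fixes C :: "('o, 'a) cat" (structure)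
  assumes Dom_Obj: "f \<in> Arr C \<Longrightarrow> Dom C f \<in> Obj C"
    and Cod_Obj: "f \<in> Arr C \<Longrightarrow> Cod C f \<in> Obj C"
    and Ident_hom: "X \<in> Obj C \<Longrightarrow> Ident C X \<in> hom C X X"
    and Comp_hom: "f \<in> hom C X Y \<Longrightarrow> g \<in> hom C Y Z \<Longrightarrow> g \<cdot> f \<in> hom C X Z"
    and Comp_Ident_left: "f \<in> hom C X Y \<Longrightarrow> Ident C Y \<cdot> f = f"
    and Comp_Ident_right: "f \<in> hom C X Y \<Longrightarrow> f \<cdot> Ident C X = f"
    and Comp_assoc: "f \<in> hom C W X \<Longrightarrow> g \<in> hom C X Y \<Longrightarrow> h \<in> hom C Y Z \<Longrightarrow>
      (h \<cdot> g) \<cdot> f = h \<cdot> (g \<cdot> f)"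

definition locally_small :: "'u itself \<Rightarrow> ('o, 'a) cat \<Rightarrow> bool" where
  "locally_small U C \<longleftrightarrow> (\<forall>X\<in>Obj C. \<forall>Y\<in>Obj C. small U (hom C X Y))"

definition op_cat :: "('o, 'a) cat \<Rightarrow> ('o, 'a) cat" where
  "op_cat C = \<lparr>Obj = Obj C, Arr = Arr C, Dom = Cod C, Cod = Dom C, Ident = Ident C,
     Comp = (\<lambda>g f. f \<cdot>\<^bsub>C\<^esub> g)\<rparr>"

definition full_subcat :: "('o, 'a) cat \<Rightarrow> ('o \<Rightarrow> bool) \<Rightarrow> ('o, 'a) cat" where
  "full_subcat C P = \<lparr>Obj = {X \<in> Obj C. P X}, Arr = {f \<in> Arr C. P (Dom C f) \<and> P (Cod C f)},
     Dom = Dom C, Cod = Cod C, Ident = Ident C, Comp = Comp C\<rparr>"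

definition is_iso :: "('o, 'a) cat \<Rightarrow> 'a \<Rightarrow> bool" where
  "is_iso C f \<longleftrightarrow> f \<in> Arr C \<and> (\<exists>g \<in> hom C (Cod C f) (Dom C f).
     g \<cdot>\<^bsub>C\<^esub> f = Ident C (Dom C f) \<and> f \<cdot>\<^bsub>C\<^esub> g = Ident C (Cod C f))"

record ('o, 'a, 'p, 'b) func =
  omap :: "'o \<Rightarrow> 'p"
  amap :: "'a \<Rightarrow> 'b"

locale is_functor = A: category A + B: category B
  for A :: "('o, 'a) cat" and B :: "('p, 'b) cat" and F :: "('o, 'a, 'p, 'b) func" +
  assumes omap_Obj: "X \<in> Obj A \<Longrightarrow> omap F X \<in> Obj B"
    and amap_hom: "f \<in> hom A X Y \<Longrightarrow> amap F f \<in> hom B (omap F X) (omap F Y)"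
    and amap_Ident: "X \<in> Obj A \<Longrightarrow> amap F (Ident A X) = Ident B (omap F X)"
    and amap_Comp: "f \<in> hom A X Y \<Longrightarrow> g \<in> hom A Y Z \<Longrightarrow>
      amap F (g \<cdot>\<^bsub>A\<^esub> f) = amap F g \<cdot>\<^bsub>B\<^esub> amap F f"

definition id_func :: "('o, 'a, 'o, 'a) func" where
  "id_func = \<lparr>omap = id, amap = id\<rparr>"

definition comp_func ::
  "('p, 'b, 'q, 'c) func \<Rightarrow> ('o, 'a, 'p, 'b) func \<Rightarrow> ('o, 'a, 'q, 'c) func" where
  "comp_func G F = \<lparr>omap = omap G \<circ> omap F, amap = amap G \<circ> amap F\<rparr>"

locale nat_trans = F: is_functor A B F + G: is_functor A B G
  for A :: "('o, 'a) cat" and B :: "('p, 'b) cat"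
    and F G :: "('o, 'a, 'p, 'b) func" and \<tau> :: "'o \<Rightarrow> 'b" +
  assumes component_hom: "X \<in> Obj A \<Longrightarrow> \<tau> X \<in> hom B (omap F X) (omap G X)"
    and naturality: "f \<in> hom A X Y \<Longrightarrow> \<tau> Y \<cdot>\<^bsub>B\<^esub> amap F f = amap G f \<cdot>\<^bsub>B\<^esub> \<tau> X"

definition nat_iso :: "('o, 'a) cat \<Rightarrow> ('p, 'b) cat \<Rightarrow> ('o, 'a, 'p, 'b) func \<Rightarrow>
    ('o, 'a, 'p, 'b) func \<Rightarrow> ('o \<Rightarrow> 'b) \<Rightarrow> bool" where
  "nat_iso A B F G \<tau> \<longleftrightarrow> nat_trans A B F G \<tau> \<and> (\<forall>X\<in>Obj A. is_iso B (\<tau> X))"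

definition equivalent_cats :: "('o, 'a) cat \<Rightarrow> ('p, 'b) cat \<Rightarrow> bool" where
  "equivalent_cats A B \<longleftrightarrow> (\<exists>F G \<eta> \<epsilon>. is_functor A B F \<and> is_functor B A G \<and>
     nat_iso A A id_func (comp_func G F) \<eta> \<and> nat_iso B B (comp_func F G) id_func \<epsilon>)"

datatype ('o, 'f) arrow = Arrow (source: 'o) (mapping: 'f) (target: 'o)

text \<open>
  Functors and natural transformations are functions on whole types, of which only the values on
  the objects and arrows of the domain category matter. The extensionality conditions make
  functors and transformations that agree there equal.
\<close>

definition functor_cat :: "('o, 'a) cat \<Rightarrow> ('p, 'b) cat \<Rightarrow>
    (('o, 'a, 'p, 'b) func, (('o, 'a, 'p, 'b) func, 'o \<Rightarrow> 'b) arrow) cat" where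
  "functor_cat A B =
    (let Fs = {F. is_functor A B F \<and> omap F \<in> extensional (Obj A) \<and> amap F \<in> extensional (Arr A)}
     in \<lparr>Obj = Fs,
         Arr = {Arrow F \<tau> G | F \<tau> G. F \<in> Fs \<and> G \<in> Fs \<and> nat_trans A B F G \<tau> \<and>
                  \<tau> \<in> extensional (Obj A)},
         Dom = source, Cod = target,
         Ident = (\<lambda>F. Arrow F (\<lambda>X\<in>Obj A. Ident B (omap F X)) F),
         Comp = (\<lambda>\<tau> \<sigma>. Arrow (source \<sigma>) (\<lambda>X\<in>Obj A. mapping \<tau> X \<cdot>\<^bsub>B\<^esub> mapping \<sigma> X) (target \<tau>))\<rparr>)"


section \<open>Colimits and products\<close>

definition small_category :: "'u itself \<Rightarrow> ('o, 'a) cat \<Rightarrow> bool" where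
  "small_category U J \<longleftrightarrow> category J \<and> small U (Obj J) \<and> small U (Arr J)"

definition is_cocone :: "('i, 'k) cat \<Rightarrow> ('o, 'a) cat \<Rightarrow> ('i, 'k, 'o, 'a) func \<Rightarrow>
    'o \<Rightarrow> ('i \<Rightarrow> 'a) \<Rightarrow> bool" where
  "is_cocone J C D X \<iota> \<longleftrightarrow> is_functor J C D \<and> X \<in> Obj C \<and>
     (\<forall>i\<in>Obj J. \<iota> i \<in> hom C (omap D i) X) \<and>
     (\<forall>u\<in>Arr J. \<iota> (Cod J u) \<cdot>\<^bsub>C\<^esub> amap D u = \<iota> (Dom J u))"

definition is_colimit :: "('i, 'k) cat \<Rightarrow> ('o, 'a) cat \<Rightarrow> ('i, 'k, 'o, 'a) func \<Rightarrow>
    'o \<Rightarrow> ('i \<Rightarrow> 'a) \<Rightarrow> bool" where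
  "is_colimit J C D X \<iota> \<longleftrightarrow> is_cocone J C D X \<iota> \<and>
     (\<forall>Y \<kappa>. is_cocone J C D Y \<kappa> \<longrightarrow>
        (\<exists>!h. h \<in> hom C X Y \<and> (\<forall>i\<in>Obj J. h \<cdot>\<^bsub>C\<^esub> \<iota> i = \<kappa> i)))"

text \<open>
  Every small category is isomorphic to one whose objects and arrows are elements of the
  universe, so it suffices to consider diagrams of such shapes.
\<close>

definition cocomplete :: "'u itself \<Rightarrow> ('o, 'a) cat \<Rightarrow> bool" where
  "cocomplete U C \<longleftrightarrow> category C \<and>
     (\<forall>(J :: ('u, 'u) cat) D. small_category U J \<and> is_functor J C D \<longrightarrow>
        (\<exists>X \<iota>. is_colimit J C D X \<iota>))"

definition cocontinuous ::
  "'u itself \<Rightarrow> ('o, 'a) cat \<Rightarrow> ('p, 'b) cat \<Rightarrow> ('o, 'a, 'p, 'b) func \<Rightarrow> bool" where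
  "cocontinuous U A B F \<longleftrightarrow> is_functor A B F \<and>
     (\<forall>(J :: ('u, 'u) cat) D X \<iota>. small_category U J \<and> is_colimit J A D X \<iota> \<longrightarrow>
        is_colimit J B (comp_func F D) (omap F X) (\<lambda>i. amap F (\<iota> i)))"

definition is_product :: "('o, 'a) cat \<Rightarrow> 'i set \<Rightarrow> ('i \<Rightarrow> 'o) \<Rightarrow> 'o \<Rightarrow> ('i \<Rightarrow> 'a) \<Rightarrow> bool" where
  "is_product C I X P \<pi> \<longleftrightarrow> (\<forall>i\<in>I. X i \<in> Obj C) \<and> P \<in> Obj C \<and> (\<forall>i\<in>I. \<pi> i \<in> hom C P (X i)) \<and>
     (\<forall>Q q. Q \<in> Obj C \<and> (\<forall>i\<in>I. q i \<in> hom C Q (X i)) \<longrightarrow>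
        (\<exists>!h. h \<in> hom C Q P \<and> (\<forall>i\<in>I. \<pi> i \<cdot>\<^bsub>C\<^esub> h = q i)))"

definition preserves_products ::
  "'u itself \<Rightarrow> ('o, 'a) cat \<Rightarrow> ('p, 'b) cat \<Rightarrow> ('o, 'a, 'p, 'b) func \<Rightarrow> bool" where
  "preserves_products U A B F \<longleftrightarrow> is_functor A B F \<and>
     (\<forall>(I :: 'u set) X P \<pi>. small U I \<and> is_product A I X P \<pi> \<longrightarrow>
        is_product B I (\<lambda>i. omap F (X i)) (omap F P) (\<lambda>i. amap F (\<pi> i)))"

definition Hom_c :: "'u itself \<Rightarrow> ('o, 'a) cat \<Rightarrow> ('p, 'b) cat \<Rightarrow>
    (('o, 'a, 'p, 'b) func, (('o, 'a, 'p, 'b) func, 'o \<Rightarrow> 'b) arrow) cat" where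
  "Hom_c U A B = full_subcat (functor_cat A B) (cocontinuous U A B)"


section \<open>Monads and their algebras\<close>

record ('o, 'a) monad_data =
  Endo :: "('o, 'a, 'o, 'a) func"
  Unit :: "'o \<Rightarrow> 'a"
  Mult :: "'o \<Rightarrow> 'a"

locale monad = category C
  for C :: "('o, 'a) cat" (structure) and T :: "('o, 'a) monad_data" +
  assumes Endo_functor: "is_functor C C (Endo T)"
    and Unit_nat_trans: "nat_trans C C id_func (Endo T) (Unit T)"
    and Mult_nat_trans: "nat_trans C C (comp_func (Endo T) (Endo T)) (Endo T) (Mult T)"
    and Mult_assoc: "X \<in> Obj C \<Longrightarrow>
      Mult T X \<cdot> amap (Endo T) (Mult T X) = Mult T X \<cdot> Mult T (omap (Endo T) X)"
    and Mult_Unit_left: "X \<in> Obj C \<Longrightarrow>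
      Mult T X \<cdot> Unit T (omap (Endo T) X) = Ident C (omap (Endo T) X)"
    and Mult_Unit_right: "X \<in> Obj C \<Longrightarrow>
      Mult T X \<cdot> amap (Endo T) (Unit T X) = Ident C (omap (Endo T) X)"

definition is_algebra :: "('o, 'a) cat \<Rightarrow> ('o, 'a) monad_data \<Rightarrow> 'o \<times> 'a \<Rightarrow> bool" where
  "is_algebra C T = (\<lambda>(A, a). A \<in> Obj C \<and> a \<in> hom C (omap (Endo T) A) A \<and>
     a \<cdot>\<^bsub>C\<^esub> Unit T A = Ident C A \<and> a \<cdot>\<^bsub>C\<^esub> amap (Endo T) a = a \<cdot>\<^bsub>C\<^esub> Mult T A)"

definition algebra_cat :: "('o, 'a) cat \<Rightarrow> ('o, 'a) monad_data \<Rightarrow>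
    ('o \<times> 'a, ('o \<times> 'a, 'a) arrow) cat" where
  "algebra_cat C T = \<lparr>
     Obj = {A. is_algebra C T A},
     Arr = {Arrow (A, a) f (B, b) | A a f B b. is_algebra C T (A, a) \<and> is_algebra C T (B, b) \<and>
              f \<in> hom C A B \<and> f \<cdot>\<^bsub>C\<^esub> a = b \<cdot>\<^bsub>C\<^esub> amap (Endo T) f},
     Dom = source, Cod = target,
     Ident = (\<lambda>(A, a). Arrow (A, a) (Ident C A) (A, a)),
     Comp = (\<lambda>g f. Arrow (source f) (mapping g \<cdot>\<^bsub>C\<^esub> mapping f) (target g))\<rparr>"

definition kleisli_cat :: "('o, 'a) cat \<Rightarrow> ('o, 'a) monad_data \<Rightarrow> ('o, ('o, 'a) arrow) cat" where
  "kleisli_cat C T = \<lparr>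
     Obj = Obj C,
     Arr = {Arrow X f Y | X f Y. X \<in> Obj C \<and> Y \<in> Obj C \<and> f \<in> hom C X (omap (Endo T) Y)},
     Dom = source, Cod = target,
     Ident = (\<lambda>X. Arrow X (Unit T X) X),
     Comp = (\<lambda>g f. Arrow (source f)
       (Mult T (target g) \<cdot>\<^bsub>C\<^esub> amap (Endo T) (mapping g) \<cdot>\<^bsub>C\<^esub> mapping f) (target g))\<rparr>"


section \<open>The category of sets; algebras and coalgebras for a monad on it\<close>

type_synonym 'u set_arrow = "('u set, 'u \<Rightarrow> 'u) arrow"

type_synonym 'u set_monad = "('u set, 'u set_arrow) monad_data"

definition set_cat :: "('u set, 'u set_arrow) cat" where
  "set_cat = \<lparr>
     Obj = {A. small TYPE('u) A},
     Arr = {Arrow A f B | A f B. small TYPE('u) A \<and> small TYPE('u) B \<and> f \<in> A \<rightarrow>\<^sub>E B},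
     Dom = source, Cod = target,
     Ident = (\<lambda>A. Arrow A (\<lambda>x\<in>A. x) A),
     Comp = (\<lambda>g f. Arrow (source f) (compose (source f) (mapping g) (mapping f)) (target g))\<rparr>"

definition Alg :: "'u set_monad \<Rightarrow>
    ('u set \<times> 'u set_arrow, ('u set \<times> 'u set_arrow, 'u set_arrow) arrow) cat" where
  "Alg T = algebra_cat set_cat T"

type_synonym ('u, 'o, 'a) alg_in = "('u set, ('u set, 'u set_arrow) arrow, 'o, 'a) func"

definition Alg_in :: "('o, 'a) cat \<Rightarrow> 'u set_monad \<Rightarrow>
    (('u, 'o, 'a) alg_in, (('u, 'o, 'a) alg_in, 'u set \<Rightarrow> 'a) arrow) cat" where
  "Alg_in D T = full_subcat (functor_cat (op_cat (kleisli_cat set_cat T)) D)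
     (preserves_products TYPE('u) (op_cat (kleisli_cat set_cat T)) D)"

definition CoAlg :: "('o, 'a) cat \<Rightarrow> 'u set_monad \<Rightarrow>
    (('u, 'o, 'a) alg_in, (('u, 'o, 'a) alg_in, 'u set \<Rightarrow> 'a) arrow) cat" where
  "CoAlg C T = op_cat (Alg_in (op_cat C) T)"

end

theory Submission
  imports Defs
begin

text \<open>
  Write \<open>K\<close> for the Kleisli category of \<open>T\<close> and \<open>F : K \<rightarrow> Alg T\<close> for the free algebra functor. The
  equivalence is restriction along \<open>F\<close>: a cocontinuous functor \<open>G\<close> is sent to \<open>G \<circ> F\<close>, which
  preserves coproducts because \<open>F\<close> does, and a coproduct preserving functor \<open>K \<rightarrow> C\<close> is the same as
  a coalgebra in \<open>C\<close>.

  Restriction loses no information because every algebra \<open>A\<close> is, canonically and naturally, the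
  coequalizer of two maps \<open>F (T A) \<rightarrow> F A\<close> between free algebras (\<open>coequalizer_presentation\<close>). A
  cocontinuous functor preserves this coequalizer. Hence a natural transformation between
  cocontinuous functors is determined by its components at free algebras (\<open>Restr_faithful\<close>), and
  every transformation given on free algebras descends to all algebras (\<open>Restr_full\<close>).

  Conversely, let \<open>W : K \<rightarrow> C\<close> preserve coproducts and let \<open>V A\<close> be the coequalizer of the two maps
  \<open>W (T A) \<rightarrow> W A\<close>. For a free algebra the presentation is split already in \<open>K\<close>, so \<open>V (F X)\<close>
  is isomorphic to \<open>W X\<close> (\<open>VF_free_iso\<close>). That \<open>V\<close> is cocontinuous holds because it is a
  left adjoint (\<open>cocontinuous_VF\<close>): for an object \<open>Z\<close> of \<open>C\<close> the set \<open>H Z\<close> of arrows \<open>W 1 \<rightarrow> Z\<close> is small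
  and carries an algebra structure. Since \<open>X\<close> is in \<open>K\<close> the coproduct of \<open>X\<close> many points, arrows
  \<open>W X \<rightarrow> Z\<close> are functions \<open>X \<rightarrow> H Z\<close>; an arrow \<open>W A \<rightarrow> Z\<close> has equal composites with the two maps
  \<open>W (T A) \<rightarrow> W A\<close> exactly when the corresponding function \<open>A \<rightarrow> H Z\<close> is a homomorphism (\<open>balanced_iff_alghom\<close>).

  The colimit of a small diagram of algebras is a quotient of the free algebra on the disjoint union
  of the carriers: two terms are identified when every homomorphism that comes from a cocone
  identifies them (\<open>cocomplete_Alg\<close>). The quotient is realized by representatives inside the free
  algebra, and is therefore small.
\<close>

section \<open>Categories\<close>

lemma homI: "f \<in> Arr C \<Longrightarrow> Dom C f = X \<Longrightarrow> Cod C f = Y \<Longrightarrow> f \<in> hom C X Y"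
  by (simp add: hom_def)

lemma homD:
  assumes "f \<in> hom C X Y"
  shows "f \<in> Arr C" "Dom C f = X" "Cod C f = Y"
  using assms by (auto simp: hom_def)

lemma (in category) hom_ObjD:
  assumes "f \<in> hom C X Y"
  shows "X \<in> Obj C" "Y \<in> Obj C"
  using assms Dom_Obj Cod_Obj by (auto simp: hom_def)

lemma op_cat_simps [simp]:
  "Obj (op_cat C) = Obj C" "Arr (op_cat C) = Arr C" "Dom (op_cat C) = Cod C"
  "Cod (op_cat C) = Dom C" "Ident (op_cat C) = Ident C" "g \<cdot>\<^bsub>op_cat C\<^esub> f = f \<cdot>\<^bsub>C\<^esub> g"
  by (simp_all add: op_cat_def)

lemma hom_op_cat [simp]: "hom (op_cat C) X Y = hom C Y X"
  by (auto simp: hom_def)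

lemma op_cat_op_cat [simp]: "op_cat (op_cat C) = C"
  by (simp add: op_cat_def)

lemma category_op_cat:
  assumes "category C"
  shows "category (op_cat C)"
proof -
  interpret category C by fact
  show ?thesis
    by unfold_locales
      (auto simp: Dom_Obj Cod_Obj Ident_hom Comp_hom Comp_Ident_left Comp_Ident_right Comp_assoc)
qed

lemma category_op_cat_iff [simp]: "category (op_cat C) \<longleftrightarrow> category C"
  using category_op_cat[of C] category_op_cat[of "op_cat C"] by auto

lemma is_functor_op_cat:
  assumes "is_functor A B F"
  shows "is_functor (op_cat A) (op_cat B) F"
proof -
  interpret is_functor A B F by fact
  show ?thesis
    by (intro is_functor.intro is_functor_axioms.intro)
      (auto simp: A.category_axioms B.category_axioms omap_Obj amap_Ident intro: amap_hom amap_Comp)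
qed

lemma is_functor_op_cat_iff [simp]: "is_functor (op_cat A) (op_cat B) F \<longleftrightarrow> is_functor A B F"
  using is_functor_op_cat[of A B] is_functor_op_cat[of "op_cat A" "op_cat B"] by auto

lemma nat_trans_op_cat:
  assumes "nat_trans A B F G \<tau>"
  shows "nat_trans (op_cat A) (op_cat B) G F \<tau>"
proof -
  interpret nat_trans A B F G \<tau> by fact
  show ?thesis
    by (intro nat_trans.intro nat_trans_axioms.intro)
      (auto simp: F.is_functor_axioms G.is_functor_axioms component_hom naturality)
qed

lemma nat_trans_op_cat_iff [simp]:
  "nat_trans (op_cat A) (op_cat B) G F \<tau> \<longleftrightarrow> nat_trans A B F G \<tau>"
  using nat_trans_op_cat[of A B] nat_trans_op_cat[of "op_cat A" "op_cat B"] by auto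

lemma full_subcat_simps [simp]:
  "Obj (full_subcat C P) = {X \<in> Obj C. P X}"
  "Arr (full_subcat C P) = {f \<in> Arr C. P (Dom C f) \<and> P (Cod C f)}"
  "Dom (full_subcat C P) = Dom C" "Cod (full_subcat C P) = Cod C"
  "Ident (full_subcat C P) = Ident C" "Comp (full_subcat C P) = Comp C"
  by (simp_all add: full_subcat_def)

lemma hom_full_subcat: "hom (full_subcat C P) X Y = (if P X \<and> P Y then hom C X Y else {})"
  by (auto simp: hom_def)

lemma category_full_subcat:
  assumes "category C"
  shows "category (full_subcat C P)"
proof -
  interpret category C by fact
  show ?thesis
    by unfold_locales
      (auto simp: hom_full_subcat Dom_Obj Cod_Obj Ident_hom Comp_hom Comp_Ident_left
        Comp_Ident_right Comp_assoc split: if_splits)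
qed

lemma functor_cat_simps:
  "Obj (functor_cat A B) =
    {F. is_functor A B F \<and> omap F \<in> extensional (Obj A) \<and> amap F \<in> extensional (Arr A)}"
  "Ident (functor_cat A B) F = Arrow F (\<lambda>X\<in>Obj A. Ident B (omap F X)) F"
  "\<tau> \<cdot>\<^bsub>functor_cat A B\<^esub> \<sigma> =
    Arrow (source \<sigma>) (\<lambda>X\<in>Obj A. mapping \<tau> X \<cdot>\<^bsub>B\<^esub> mapping \<sigma> X) (target \<tau>)"
  by (simp_all add: functor_cat_def)

lemma hom_functor_cat:
  "hom (functor_cat A B) F G = {Arrow F \<tau> G | \<tau>. F \<in> Obj (functor_cat A B) \<and>
     G \<in> Obj (functor_cat A B) \<and> nat_trans A B F G \<tau> \<and> \<tau> \<in> extensional (Obj A)}"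
  by (auto simp: hom_def functor_cat_def Let_def)

lemma nat_trans_Ident:
  assumes "is_functor A B F"
  shows "nat_trans A B F F (\<lambda>X\<in>Obj A. Ident B (omap F X))"
proof -
  interpret is_functor A B F by fact
  have "Ident B (omap F Y) \<cdot>\<^bsub>B\<^esub> amap F f = amap F f \<cdot>\<^bsub>B\<^esub> Ident B (omap F X)"
    if "f \<in> hom A X Y" for f X Y
    using amap_hom[OF that] by (simp add: B.Comp_Ident_left B.Comp_Ident_right)
  then show ?thesis
    by (intro nat_trans.intro nat_trans_axioms.intro)
      (auto simp: is_functor_axioms B.Ident_hom omap_Obj dest: A.hom_ObjD)
qed

lemma nat_trans_Comp:
  assumes "nat_trans A B F G \<sigma>" "nat_trans A B G H \<tau>"
  shows "nat_trans A B F H (\<lambda>X\<in>Obj A. \<tau> X \<cdot>\<^bsub>B\<^esub> \<sigma> X)"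
proof -
  interpret S: nat_trans A B F G \<sigma> by fact
  interpret T: nat_trans A B G H \<tau> by fact
  have "(\<tau> Y \<cdot>\<^bsub>B\<^esub> \<sigma> Y) \<cdot>\<^bsub>B\<^esub> amap F f = amap H f \<cdot>\<^bsub>B\<^esub> (\<tau> X \<cdot>\<^bsub>B\<^esub> \<sigma> X)"
    if f: "f \<in> hom A X Y" for f X Y
  proof -
    note XY = S.F.A.hom_ObjD[OF f]
    note \<sigma> = S.component_hom[OF XY(1)] S.component_hom[OF XY(2)]
    note \<tau> = T.component_hom[OF XY(1)] T.component_hom[OF XY(2)]
    have "(\<tau> Y \<cdot>\<^bsub>B\<^esub> \<sigma> Y) \<cdot>\<^bsub>B\<^esub> amap F f = \<tau> Y \<cdot>\<^bsub>B\<^esub> (\<sigma> Y \<cdot>\<^bsub>B\<^esub> amap F f)"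
      by (rule S.F.B.Comp_assoc[OF S.F.amap_hom[OF f] \<sigma>(2) \<tau>(2)])
    also have "\<dots> = \<tau> Y \<cdot>\<^bsub>B\<^esub> (amap G f \<cdot>\<^bsub>B\<^esub> \<sigma> X)"
      by (simp add: S.naturality[OF f])
    also have "\<dots> = (\<tau> Y \<cdot>\<^bsub>B\<^esub> amap G f) \<cdot>\<^bsub>B\<^esub> \<sigma> X"
      by (rule S.F.B.Comp_assoc[OF \<sigma>(1) S.G.amap_hom[OF f] \<tau>(2), symmetric])
    also have "\<dots> = (amap H f \<cdot>\<^bsub>B\<^esub> \<tau> X) \<cdot>\<^bsub>B\<^esub> \<sigma> X"
      by (simp add: T.naturality[OF f])
    also have "\<dots> = amap H f \<cdot>\<^bsub>B\<^esub> (\<tau> X \<cdot>\<^bsub>B\<^esub> \<sigma> X)"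
      by (rule S.F.B.Comp_assoc[OF \<sigma>(1) \<tau>(1) T.G.amap_hom[OF f]])
    finally show ?thesis .
  qed
  then show ?thesis
    by (intro nat_trans.intro nat_trans_axioms.intro)
      (auto simp: S.F.is_functor_axioms T.G.is_functor_axioms dest: S.F.A.hom_ObjD
        intro: S.F.B.Comp_hom[OF S.component_hom T.component_hom])
qed

lemma category_functor_cat:
  assumes A: "category A" and B: "category B"
  shows "category (functor_cat A B)"
proof -
  interpret A: category A by fact
  interpret B: category B by fact
  let ?E = "functor_cat A B"
  show ?thesis
  proof
    fix \<tau> assume "\<tau> \<in> Arr ?E"
    then show "Dom ?E \<tau> \<in> Obj ?E" "Cod ?E \<tau> \<in> Obj ?E"
      by (auto simp: functor_cat_def Let_def)
  next
    fix F assume "F \<in> Obj ?E"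
    then show "Ident ?E F \<in> hom ?E F F"
      by (auto simp: hom_functor_cat functor_cat_simps intro: nat_trans_Ident)
  next
    fix \<sigma> \<tau> F G H assume "\<sigma> \<in> hom ?E F G" "\<tau> \<in> hom ?E G H"
    then show "\<tau> \<cdot>\<^bsub>?E\<^esub> \<sigma> \<in> hom ?E F H"
      by (auto simp: hom_functor_cat functor_cat_simps intro: nat_trans_Comp)
  next
    fix \<sigma> F G assume \<sigma>: "\<sigma> \<in> hom ?E F G"
    then obtain s where s: "\<sigma> = Arrow F s G" "nat_trans A B F G s" "s \<in> extensional (Obj A)"
      by (auto simp: hom_functor_cat)
    interpret nat_trans A B F G s by (fact s)
    show "Ident ?E G \<cdot>\<^bsub>?E\<^esub> \<sigma> = \<sigma>"
      using s(3) by (auto simp: s(1) functor_cat_simps extensional_def restrict_def fun_eq_iff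
        B.Comp_Ident_left[OF component_hom])
    show "\<sigma> \<cdot>\<^bsub>?E\<^esub> Ident ?E F = \<sigma>"
      using s(3) by (auto simp: s(1) functor_cat_simps extensional_def restrict_def fun_eq_iff
        B.Comp_Ident_right[OF component_hom])
  next
    fix \<rho> \<sigma> \<tau> F G H K assume "\<rho> \<in> hom ?E F G" "\<sigma> \<in> hom ?E G H" "\<tau> \<in> hom ?E H K"
    then show "(\<tau> \<cdot>\<^bsub>?E\<^esub> \<sigma>) \<cdot>\<^bsub>?E\<^esub> \<rho> = \<tau> \<cdot>\<^bsub>?E\<^esub> (\<sigma> \<cdot>\<^bsub>?E\<^esub> \<rho>)"
      by (auto simp: hom_functor_cat functor_cat_simps restrict_def fun_eq_iff
          intro!: B.Comp_assoc dest: nat_trans.component_hom)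
  qed
qed

lemma is_isoE:
  assumes "is_iso C f" "f \<in> hom C X Y"
  obtains g where "g \<in> hom C Y X" "g \<cdot>\<^bsub>C\<^esub> f = Ident C X" "f \<cdot>\<^bsub>C\<^esub> g = Ident C Y"
  using assms by (auto simp: is_iso_def hom_def)

lemma is_isoI:
  assumes "f \<in> hom C X Y" "g \<in> hom C Y X" "g \<cdot>\<^bsub>C\<^esub> f = Ident C X" "f \<cdot>\<^bsub>C\<^esub> g = Ident C Y"
  shows "is_iso C f"
  using assms by (auto simp: is_iso_def hom_def)

lemma is_functor_comp_func:
  assumes "is_functor A B F" "is_functor B C G"
  shows "is_functor A C (comp_func G F)"
proof -
  interpret F: is_functor A B F by fact
  interpret G: is_functor B C G by fact
  show ?thesis
  proof (intro is_functor.intro is_functor_axioms.intro)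
    show "amap (comp_func G F) (g \<cdot>\<^bsub>A\<^esub> f) = amap (comp_func G F) g \<cdot>\<^bsub>C\<^esub> amap (comp_func G F) f"
      if "f \<in> hom A X Y" "g \<in> hom A Y Z" for f g X Y Z
      using G.amap_Comp[OF F.amap_hom[OF that(1)] F.amap_hom[OF that(2)]] F.amap_Comp[OF that]
      by (simp add: comp_func_def)
  qed (simp_all add: comp_func_def F.A.category_axioms G.B.category_axioms F.omap_Obj G.omap_Obj
      F.amap_Ident G.amap_Ident F.amap_hom G.amap_hom)
qed

lemma is_functor_id_func: "category A \<Longrightarrow> is_functor A A id_func"
  by (intro is_functor.intro is_functor_axioms.intro) (auto simp: id_func_def)

text \<open>
  Conjugating a naturality square with the inverse components turns it into the square of the
  inverse.
\<close>

lemma nat_trans_inverse: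
  assumes "nat_trans A B F G \<tau>"
    and \<sigma>: "\<And>X. X \<in> Obj A \<Longrightarrow> \<sigma> X \<in> hom B (omap G X) (omap F X)"
    and \<sigma>\<tau>: "\<And>X. X \<in> Obj A \<Longrightarrow> \<sigma> X \<cdot>\<^bsub>B\<^esub> \<tau> X = Ident B (omap F X)"
    and \<tau>\<sigma>: "\<And>X. X \<in> Obj A \<Longrightarrow> \<tau> X \<cdot>\<^bsub>B\<^esub> \<sigma> X = Ident B (omap G X)"
  shows "nat_trans A B G F \<sigma>"
proof -
  interpret nat_trans A B F G \<tau> by fact
  have "\<sigma> Y \<cdot>\<^bsub>B\<^esub> amap G f = amap F f \<cdot>\<^bsub>B\<^esub> \<sigma> X" if f: "f \<in> hom A X Y" for f X Y
  proof -
    note XY = F.A.hom_ObjD[OF f]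
    note Ff = F.amap_hom[OF f] and Gf = G.amap_hom[OF f]
    note \<sigma>X = \<sigma>[OF XY(1)] and \<sigma>Y = \<sigma>[OF XY(2)]
    note \<tau>X = component_hom[OF XY(1)] and \<tau>Y = component_hom[OF XY(2)]
    have "\<sigma> Y \<cdot>\<^bsub>B\<^esub> amap G f = \<sigma> Y \<cdot>\<^bsub>B\<^esub> (amap G f \<cdot>\<^bsub>B\<^esub> (\<tau> X \<cdot>\<^bsub>B\<^esub> \<sigma> X))"
      by (simp add: \<tau>\<sigma>[OF XY(1)] F.B.Comp_Ident_right[OF Gf])
    also have "amap G f \<cdot>\<^bsub>B\<^esub> (\<tau> X \<cdot>\<^bsub>B\<^esub> \<sigma> X) = (\<tau> Y \<cdot>\<^bsub>B\<^esub> amap F f) \<cdot>\<^bsub>B\<^esub> \<sigma> X"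
      by (simp add: naturality[OF f] F.B.Comp_assoc[OF \<sigma>X \<tau>X Gf])
    also have "\<dots> = \<tau> Y \<cdot>\<^bsub>B\<^esub> (amap F f \<cdot>\<^bsub>B\<^esub> \<sigma> X)"
      by (rule F.B.Comp_assoc[OF \<sigma>X Ff \<tau>Y])
    also have "\<sigma> Y \<cdot>\<^bsub>B\<^esub> \<dots> = amap F f \<cdot>\<^bsub>B\<^esub> \<sigma> X"
      by (simp add: F.B.Comp_assoc[OF F.B.Comp_hom[OF \<sigma>X Ff] \<tau>Y \<sigma>Y, symmetric] \<sigma>\<tau>[OF XY(2)]
          F.B.Comp_Ident_left[OF F.B.Comp_hom[OF \<sigma>X Ff]])
    finally show ?thesis .
  qed
  then show ?thesis
    by (intro nat_trans.intro nat_trans_axioms.intro)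
      (auto simp: F.is_functor_axioms G.is_functor_axioms \<sigma>)
qed

text \<open>
  The quasi-inverse sends an object to a chosen preimage up to isomorphism. Fullness provides its
  action on arrows and the unit; faithfulness allows every equation to be checked after applying \<open>F\<close>.
\<close>

lemma equivalent_catsI:
  assumes "is_functor A B F"
    and faithful: "\<And>X Y f g. f \<in> hom A X Y \<Longrightarrow> g \<in> hom A X Y \<Longrightarrow> amap F f = amap F g \<Longrightarrow> f = g"
    and full: "\<And>X Y k. X \<in> Obj A \<Longrightarrow> Y \<in> Obj A \<Longrightarrow> k \<in> hom B (omap F X) (omap F Y) \<Longrightarrow>
      \<exists>f \<in> hom A X Y. amap F f = k"
    and surj: "\<And>Y. Y \<in> Obj B \<Longrightarrow> \<exists>X\<in>Obj A. \<exists>e\<in>hom B (omap F X) Y. is_iso B e"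
  shows "equivalent_cats A B"
proof -
  interpret F: is_functor A B F by fact
  have "\<forall>Y\<in>Obj B. \<exists>X e e'. X \<in> Obj A \<and> e \<in> hom B (omap F X) Y \<and> e' \<in> hom B Y (omap F X) \<and>
      e' \<cdot>\<^bsub>B\<^esub> e = Ident B (omap F X) \<and> e \<cdot>\<^bsub>B\<^esub> e' = Ident B Y"
    using surj by (metis is_isoE)
  then obtain G0 e e' where
    G0: "\<And>Y. Y \<in> Obj B \<Longrightarrow> G0 Y \<in> Obj A" and
    e: "\<And>Y. Y \<in> Obj B \<Longrightarrow> e Y \<in> hom B (omap F (G0 Y)) Y" and
    e': "\<And>Y. Y \<in> Obj B \<Longrightarrow> e' Y \<in> hom B Y (omap F (G0 Y))" and
    e'e: "\<And>Y. Y \<in> Obj B \<Longrightarrow> e' Y \<cdot>\<^bsub>B\<^esub> e Y = Ident B (omap F (G0 Y))" and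
    ee': "\<And>Y. Y \<in> Obj B \<Longrightarrow> e Y \<cdot>\<^bsub>B\<^esub> e' Y = Ident B Y"
    by metis
  have e_mono: "a = b" if "a \<in> hom B X (omap F (G0 Y))" "b \<in> hom B X (omap F (G0 Y))"
    "e Y \<cdot>\<^bsub>B\<^esub> a = e Y \<cdot>\<^bsub>B\<^esub> b" "Y \<in> Obj B" for a b X Y
    using F.B.Comp_assoc[OF that(1) e[OF that(4)] e'[OF that(4)]]
      F.B.Comp_assoc[OF that(2) e[OF that(4)] e'[OF that(4)]] that
    by (simp add: e'e F.B.Comp_Ident_left)
  \<comment> \<open>The image of \<open>f\<close> is the arrow that makes the square with the chosen isomorphisms commute.\<close>
  define G1 where "G1 f = (SOME g. g \<in> hom A (G0 (Dom B f)) (G0 (Cod B f)) \<and>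
    e (Cod B f) \<cdot>\<^bsub>B\<^esub> amap F g = f \<cdot>\<^bsub>B\<^esub> e (Dom B f))" for f
  have G1: "G1 f \<in> hom A (G0 X) (G0 Y)" "e Y \<cdot>\<^bsub>B\<^esub> amap F (G1 f) = f \<cdot>\<^bsub>B\<^esub> e X"
    if f: "f \<in> hom B X Y" for f X Y
  proof -
    note XY = F.B.hom_ObjD[OF f]
    have fe: "f \<cdot>\<^bsub>B\<^esub> e X \<in> hom B (omap F (G0 X)) Y"
      using F.B.Comp_hom[OF e[OF XY(1)] f] .
    obtain g where g: "g \<in> hom A (G0 X) (G0 Y)" "amap F g = e' Y \<cdot>\<^bsub>B\<^esub> (f \<cdot>\<^bsub>B\<^esub> e X)"
      using full[OF G0 G0] XY F.B.Comp_hom[OF fe e'[OF XY(2)]] by metis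
    have "e Y \<cdot>\<^bsub>B\<^esub> amap F g = f \<cdot>\<^bsub>B\<^esub> e X"
      using F.B.Comp_assoc[OF fe e'[OF XY(2)] e[OF XY(2)]] F.B.Comp_Ident_left[OF fe]
      by (simp add: g(2) ee'[OF XY(2)])
    then have "\<exists>g. g \<in> hom A (G0 (Dom B f)) (G0 (Cod B f)) \<and>
      e (Cod B f) \<cdot>\<^bsub>B\<^esub> amap F g = f \<cdot>\<^bsub>B\<^esub> e (Dom B f)"
      using g(1) by (auto simp: homD[OF f])
    from someI_ex[OF this] show "G1 f \<in> hom A (G0 X) (G0 Y)" "e Y \<cdot>\<^bsub>B\<^esub> amap F (G1 f) = f \<cdot>\<^bsub>B\<^esub> e X"
      by (auto simp: homD[OF f] G1_def)
  qed
  have G1_eq: "G1 f = g" if "f \<in> hom B X Y" "g \<in> hom A (G0 X) (G0 Y)"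
    "e Y \<cdot>\<^bsub>B\<^esub> amap F g = f \<cdot>\<^bsub>B\<^esub> e X" for f g X Y
  proof (rule faithful[OF G1(1)[OF that(1)] that(2)])
    show "amap F (G1 f) = amap F g"
      using G1(2)[OF that(1)] that(3) F.B.hom_ObjD(2)[OF that(1)]
      by (intro e_mono[OF F.amap_hom[OF G1(1)[OF that(1)]] F.amap_hom[OF that(2)]]) simp_all
  qed
  define G where "G = \<lparr>omap = G0, amap = G1\<rparr>"
  have G: "is_functor B A G"
  proof (intro is_functor.intro is_functor_axioms.intro)
    show "category B" "category A" by (fact F.B.category_axioms F.A.category_axioms)+
    show "omap G X \<in> Obj A" if "X \<in> Obj B" for X using G0[OF that] by (simp add: G_def)
    show "amap G f \<in> hom A (omap G X) (omap G Y)" if "f \<in> hom B X Y" for f X Y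
      using G1[OF that] by (simp add: G_def)
    show "amap G (Ident B X) = Ident A (omap G X)" if X: "X \<in> Obj B" for X
      using F.B.Comp_Ident_left[OF e[OF X]] F.B.Comp_Ident_right[OF e[OF X]]
        G1_eq[OF F.B.Ident_hom[OF X] F.A.Ident_hom[OF G0[OF X]]]
      by (simp add: G_def F.amap_Ident[OF G0[OF X]])
    show "amap G (g \<cdot>\<^bsub>B\<^esub> f) = amap G g \<cdot>\<^bsub>A\<^esub> amap G f"
      if f: "f \<in> hom B X Y" and g: "g \<in> hom B Y Z" for f g X Y Z
    proof -
      note XY = F.B.hom_ObjD[OF f] and Z = F.B.hom_ObjD(2)[OF g]
      note Ff = F.amap_hom[OF G1(1)[OF f]] and Fg = F.amap_hom[OF G1(1)[OF g]]
      have "e Z \<cdot>\<^bsub>B\<^esub> (amap F (G1 g) \<cdot>\<^bsub>B\<^esub> amap F (G1 f)) = (e Z \<cdot>\<^bsub>B\<^esub> amap F (G1 g)) \<cdot>\<^bsub>B\<^esub> amap F (G1 f)"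
        by (rule F.B.Comp_assoc[OF Ff Fg e[OF Z], symmetric])
      also have "\<dots> = g \<cdot>\<^bsub>B\<^esub> (e Y \<cdot>\<^bsub>B\<^esub> amap F (G1 f))"
        by (simp add: G1(2)[OF g] F.B.Comp_assoc[OF Ff e[OF XY(2)] g])
      also have "\<dots> = (g \<cdot>\<^bsub>B\<^esub> f) \<cdot>\<^bsub>B\<^esub> e X"
        by (simp add: G1(2)[OF f] F.B.Comp_assoc[OF e[OF XY(1)] f g])
      finally show ?thesis
        using G1_eq[OF F.B.Comp_hom[OF f g] F.A.Comp_hom[OF G1(1)[OF f] G1(1)[OF g]]]
        by (simp add: G_def F.amap_Comp[OF G1(1)[OF f] G1(1)[OF g]])
    qed
  qed
  interpret G: is_functor B A G by (fact G)
  have FG: "is_functor B B (comp_func F G)" and GF: "is_functor A A (comp_func G F)"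
    using is_functor_comp_func F.is_functor_axioms G.is_functor_axioms by blast+
  have "nat_iso B B (comp_func F G) id_func e"
    unfolding nat_iso_def
  proof (intro conjI ballI nat_trans.intro nat_trans_axioms.intro FG is_functor_id_func)
    show "category B" by (fact F.B.category_axioms)
    show "is_iso B (e Y)" if "Y \<in> Obj B" for Y
      using is_isoI[OF e e' e'e ee'] that by blast
  qed (auto simp: comp_func_def id_func_def G_def e G1(2))
  moreover
  have "\<forall>X\<in>Obj A. \<exists>n. n \<in> hom A X (G0 (omap F X)) \<and> amap F n = e' (omap F X)"
    using full[OF _ G0 e'] F.omap_Obj by blast
  then obtain \<eta> where
    \<eta>: "\<And>X. X \<in> Obj A \<Longrightarrow> \<eta> X \<in> hom A X (G0 (omap F X))" and
    F\<eta>: "\<And>X. X \<in> Obj A \<Longrightarrow> amap F (\<eta> X) = e' (omap F X)"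
    by metis
  have "nat_iso A A id_func (comp_func G F) \<eta>"
    unfolding nat_iso_def
  proof (intro conjI ballI nat_trans.intro nat_trans_axioms.intro GF is_functor_id_func)
    show "category A" by (fact F.A.category_axioms)
    show "is_iso A (\<eta> X)" if X: "X \<in> Obj A" for X
    proof -
      note FX = F.omap_Obj[OF X]
      obtain m where m: "m \<in> hom A (G0 (omap F X)) X" "amap F m = e (omap F X)"
        using full[OF G0[OF FX] X e[OF FX]] by blast
      have "m \<cdot>\<^bsub>A\<^esub> \<eta> X = Ident A X"
        using F.amap_Comp[OF \<eta>[OF X] m(1)] X FX
        by (intro faithful[OF F.A.Comp_hom[OF \<eta>[OF X] m(1)] F.A.Ident_hom[OF X]])
          (simp add: m(2) F\<eta> ee' F.amap_Ident)
      moreover have "\<eta> X \<cdot>\<^bsub>A\<^esub> m = Ident A (G0 (omap F X))"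
        using F.amap_Comp[OF m(1) \<eta>[OF X]] X FX G0[OF FX]
        by (intro faithful[OF F.A.Comp_hom[OF m(1) \<eta>[OF X]] F.A.Ident_hom])
          (simp_all add: m(2) F\<eta> e'e F.amap_Ident)
      ultimately show ?thesis using is_isoI \<eta>[OF X] m(1) by metis
    qed
    show "\<eta> X \<in> hom A (omap id_func X) (omap (comp_func G F) X)" if "X \<in> Obj A" for X
      using \<eta>[OF that] by (simp add: id_func_def comp_func_def G_def)
    show "\<eta> Y \<cdot>\<^bsub>A\<^esub> amap id_func f = amap (comp_func G F) f \<cdot>\<^bsub>A\<^esub> \<eta> X" if f: "f \<in> hom A X Y" for f X Y
    proof -
      note XY = F.A.hom_ObjD[OF f]
      note Ff = F.amap_hom[OF f]
      note FX = F.omap_Obj[OF XY(1)] and FY = F.omap_Obj[OF XY(2)]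
      note g = G1(1)[OF Ff]
      note l = F.B.Comp_hom[OF Ff e'[OF FY]] and r = F.B.Comp_hom[OF e'[OF FX] F.amap_hom[OF g]]
      have "e (omap F Y) \<cdot>\<^bsub>B\<^esub> (e' (omap F Y) \<cdot>\<^bsub>B\<^esub> amap F f) = amap F f"
        using F.B.Comp_assoc[OF Ff e'[OF FY] e[OF FY]]
        by (simp add: ee'[OF FY] F.B.Comp_Ident_left[OF Ff])
      moreover have "e (omap F Y) \<cdot>\<^bsub>B\<^esub> (amap F (G1 (amap F f)) \<cdot>\<^bsub>B\<^esub> e' (omap F X)) = amap F f"
        using F.B.Comp_assoc[OF e'[OF FX] F.amap_hom[OF g] e[OF FY]] F.B.Comp_assoc[OF e'[OF FX] e[OF FX] Ff]
        by (simp add: G1(2)[OF Ff] ee'[OF FX] F.B.Comp_Ident_right[OF Ff])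
      ultimately have "e' (omap F Y) \<cdot>\<^bsub>B\<^esub> amap F f = amap F (G1 (amap F f)) \<cdot>\<^bsub>B\<^esub> e' (omap F X)"
        using e_mono[OF l r _ FY] by simp
      then have "\<eta> Y \<cdot>\<^bsub>A\<^esub> f = G1 (amap F f) \<cdot>\<^bsub>A\<^esub> \<eta> X"
        using faithful[OF F.A.Comp_hom[OF f \<eta>[OF XY(2)]] F.A.Comp_hom[OF \<eta>[OF XY(1)] g]]
        by (simp add: F.amap_Comp[OF f \<eta>[OF XY(2)]] F.amap_Comp[OF \<eta>[OF XY(1)] g] F\<eta> XY)
      then show ?thesis by (simp add: id_func_def comp_func_def G_def)
    qed
  qed
  ultimately show ?thesis
    unfolding equivalent_cats_def using F.is_functor_axioms G by blast
qed

section \<open>Coequalizers, coproducts and cocontinuous functors\<close>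

lemma is_cocone_comp_func:
  assumes "is_cocone J A D X \<iota>" "is_functor A B F"
  shows "is_cocone J B (comp_func F D) (omap F X) (\<lambda>i. amap F (\<iota> i))"
proof -
  interpret F: is_functor A B F by fact
  interpret D: is_functor J A D using assms(1) by (simp add: is_cocone_def)
  have \<iota>: "\<iota> i \<in> hom A (omap D i) X" if "i \<in> Obj J" for i
    using assms(1) that by (auto simp: is_cocone_def)
  have "amap F (\<iota> (Cod J u)) \<cdot>\<^bsub>B\<^esub> amap F (amap D u) = amap F (\<iota> (Dom J u))" if "u \<in> Arr J" for u
  proof -
    have u: "u \<in> hom J (Dom J u) (Cod J u)" using that by (simp add: hom_def)
    show ?thesis
      using F.amap_Comp[OF D.amap_hom[OF u] \<iota>[OF D.A.Cod_Obj[OF that]]] assms(1) that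
      by (simp add: is_cocone_def)
  qed
  moreover have "amap F (\<iota> i) \<in> hom B (omap F (omap D i)) (omap F X)" if "i \<in> Obj J" for i
    using F.amap_hom[OF \<iota>[OF that]] .
  ultimately show ?thesis
    using assms(1) is_functor_comp_func[OF D.is_functor_axioms F.is_functor_axioms] F.omap_Obj
    by (simp add: is_cocone_def comp_func_def)
qed

text \<open>
  For fixed \<open>Z\<close>, the bijection turns cocones on \<open>L \<circ> D\<close> with vertex \<open>Z\<close> into cocones on \<open>D\<close> with vertex
  \<open>N\<close>. Stating adjointness for one \<open>Z\<close> at a time avoids constructing the right adjoint as a functor.
\<close>

lemma left_adjoint_cocontinuous:
  assumes "is_functor A C L"
    and adj: "\<And>Z. Z \<in> Obj C \<Longrightarrow> \<exists>N\<in>Obj A. \<exists>\<psi>.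
      (\<forall>X\<in>Obj A. bij_betw (\<psi> X) (hom C (omap L X) Z) (hom A X N)) \<and>
      (\<forall>X Y f g. f \<in> hom A X Y \<longrightarrow> g \<in> hom C (omap L Y) Z \<longrightarrow>
        \<psi> X (g \<cdot>\<^bsub>C\<^esub> amap L f) = \<psi> Y g \<cdot>\<^bsub>A\<^esub> f)"
  shows "cocontinuous TYPE('u) A C L"
proof -
  interpret L: is_functor A C L by fact
  have *: "\<exists>!h. h \<in> hom C (omap L X) Z \<and> (\<forall>i\<in>Obj J. h \<cdot>\<^bsub>C\<^esub> amap L (\<iota> i) = \<kappa> i)"
    if col: "is_colimit J A D X \<iota>" and cc: "is_cocone J C (comp_func L D) Z \<kappa>"
    for J :: "('u, 'u) cat" and D X \<iota> Z \<kappa>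
  proof -
    interpret D: is_functor J A D using col by (simp add: is_colimit_def is_cocone_def)
    have X: "X \<in> Obj A" and \<iota>: "\<And>i. i \<in> Obj J \<Longrightarrow> \<iota> i \<in> hom A (omap D i) X"
      using col by (auto simp: is_colimit_def is_cocone_def)
    have Z: "Z \<in> Obj C" and \<kappa>: "\<And>i. i \<in> Obj J \<Longrightarrow> \<kappa> i \<in> hom C (omap L (omap D i)) Z"
      and \<kappa>D: "\<And>u. u \<in> Arr J \<Longrightarrow> \<kappa> (Cod J u) \<cdot>\<^bsub>C\<^esub> amap L (amap D u) = \<kappa> (Dom J u)"
      using cc by (auto simp: is_cocone_def comp_func_def)
    from adj[OF Z] obtain N \<psi> where N: "N \<in> Obj A"
      and bij: "\<And>X. X \<in> Obj A \<Longrightarrow> bij_betw (\<psi> X) (hom C (omap L X) Z) (hom A X N)"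
      and nat: "\<And>X Y f g. f \<in> hom A X Y \<Longrightarrow> g \<in> hom C (omap L Y) Z \<Longrightarrow>
        \<psi> X (g \<cdot>\<^bsub>C\<^esub> amap L f) = \<psi> Y g \<cdot>\<^bsub>A\<^esub> f"
      by metis
    have \<psi>: "\<psi> Y g \<in> hom A Y N" if "Y \<in> Obj A" "g \<in> hom C (omap L Y) Z" for Y g
      using bij_betwE[OF bij[OF that(1)]] that(2) by blast
    have \<psi>_inj: "g = g'" if "Y \<in> Obj A" "g \<in> hom C (omap L Y) Z" "g' \<in> hom C (omap L Y) Z"
      "\<psi> Y g = \<psi> Y g'" for Y g g'
      using bij_betw_imp_inj_on[OF bij[OF that(1)]] that by (auto dest: inj_onD)
    let ?\<phi> = "\<lambda>i. \<psi> (omap D i) (\<kappa> i)"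
    have "is_cocone J A D N ?\<phi>"
      unfolding is_cocone_def
    proof (intro conjI ballI)
      fix u assume u: "u \<in> Arr J"
      then have "amap D u \<in> hom A (omap D (Dom J u)) (omap D (Cod J u))"
        by (intro D.amap_hom homI) auto
      from nat[OF this \<kappa>[OF D.A.Cod_Obj[OF u]]]
      show "?\<phi> (Cod J u) \<cdot>\<^bsub>A\<^esub> amap D u = ?\<phi> (Dom J u)"
        by (simp add: \<kappa>D[OF u])
    qed (simp_all add: D.is_functor_axioms N \<psi> D.omap_Obj \<kappa>)
    then have ex1: "\<exists>!h. h \<in> hom A X N \<and> (\<forall>i\<in>Obj J. h \<cdot>\<^bsub>A\<^esub> \<iota> i = ?\<phi> i)"
      using col by (simp add: is_colimit_def)
    \<comment> \<open>The bijection \<open>\<psi> X\<close> identifies factorizations through the image cocone with those in \<open>A\<close>.\<close>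
    have iff: "(\<forall>i\<in>Obj J. g \<cdot>\<^bsub>C\<^esub> amap L (\<iota> i) = \<kappa> i) \<longleftrightarrow> (\<forall>i\<in>Obj J. \<psi> X g \<cdot>\<^bsub>A\<^esub> \<iota> i = ?\<phi> i)"
      if g: "g \<in> hom C (omap L X) Z" for g
    proof (intro ball_cong refl)
      fix i assume i: "i \<in> Obj J"
      have "g \<cdot>\<^bsub>C\<^esub> amap L (\<iota> i) = \<kappa> i \<longleftrightarrow> \<psi> (omap D i) (g \<cdot>\<^bsub>C\<^esub> amap L (\<iota> i)) = ?\<phi> i"
        using \<psi>_inj[OF D.omap_Obj[OF i] L.B.Comp_hom[OF L.amap_hom[OF \<iota>[OF i]] g] \<kappa>[OF i]] by auto
      then show "g \<cdot>\<^bsub>C\<^esub> amap L (\<iota> i) = \<kappa> i \<longleftrightarrow> \<psi> X g \<cdot>\<^bsub>A\<^esub> \<iota> i = ?\<phi> i"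
        by (simp add: nat[OF \<iota>[OF i] g])
    qed
    obtain g where g: "g \<in> hom C (omap L X) Z" "\<forall>i\<in>Obj J. \<psi> X g \<cdot>\<^bsub>A\<^esub> \<iota> i = ?\<phi> i"
      using ex1 bij_betw_imp_surj_on[OF bij[OF X]] by (metis (no_types, lifting) imageE)
    show ?thesis
    proof (rule ex1I[of _ g])
      show "g \<in> hom C (omap L X) Z \<and> (\<forall>i\<in>Obj J. g \<cdot>\<^bsub>C\<^esub> amap L (\<iota> i) = \<kappa> i)"
        using g iff by blast
      fix h assume h: "h \<in> hom C (omap L X) Z \<and> (\<forall>i\<in>Obj J. h \<cdot>\<^bsub>C\<^esub> amap L (\<iota> i) = \<kappa> i)"
      obtain m where m: "\<And>k. k \<in> hom A X N \<Longrightarrow> \<forall>i\<in>Obj J. k \<cdot>\<^bsub>A\<^esub> \<iota> i = ?\<phi> i \<Longrightarrow> k = m"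
        using ex1 by (elim ex1E) blast
      have "\<psi> X h = m"
        using h iff[of h] by (intro m[OF \<psi>[OF X]]) (erule conjunct1, blast)
      moreover have "\<psi> X g = m"
        using g by (intro m[OF \<psi>[OF X]])
      ultimately show "h = g" using \<psi>_inj[OF X] h g by simp
    qed
  qed
  have "is_colimit J C (comp_func L D) (omap L X) (\<lambda>i. amap L (\<iota> i))"
    if "is_colimit J A D X \<iota>" for J :: "('u, 'u) cat" and D X \<iota>
    using is_cocone_comp_func[OF _ L.is_functor_axioms, of J D X \<iota>] *[OF that] that
    by (simp add: is_colimit_def)
  then show ?thesis
    unfolding cocontinuous_def using L.is_functor_axioms by blast
qed

definition is_coequalizer ::
  "('o, 'a) cat \<Rightarrow> 'o \<Rightarrow> 'o \<Rightarrow> 'a \<Rightarrow> 'a \<Rightarrow> 'o \<Rightarrow> 'a \<Rightarrow> bool" where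
  "is_coequalizer C X Y f g Q q \<longleftrightarrow> f \<in> hom C X Y \<and> g \<in> hom C X Y \<and> q \<in> hom C Y Q \<and>
     q \<cdot>\<^bsub>C\<^esub> f = q \<cdot>\<^bsub>C\<^esub> g \<and>
     (\<forall>Z k. k \<in> hom C Y Z \<and> k \<cdot>\<^bsub>C\<^esub> f = k \<cdot>\<^bsub>C\<^esub> g \<longrightarrow> (\<exists>!h. h \<in> hom C Q Z \<and> h \<cdot>\<^bsub>C\<^esub> q = k))"

lemma is_coequalizerD:
  assumes "is_coequalizer C X Y f g Q q"
  shows "f \<in> hom C X Y" "g \<in> hom C X Y" "q \<in> hom C Y Q" "q \<cdot>\<^bsub>C\<^esub> f = q \<cdot>\<^bsub>C\<^esub> g"
    "\<And>Z k. k \<in> hom C Y Z \<Longrightarrow> k \<cdot>\<^bsub>C\<^esub> f = k \<cdot>\<^bsub>C\<^esub> g \<Longrightarrow> \<exists>h. h \<in> hom C Q Z \<and> h \<cdot>\<^bsub>C\<^esub> q = k"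
  using assms unfolding is_coequalizer_def by blast+

lemma (in category) coequalizer_epi:
  assumes q: "is_coequalizer C X Y f g Q q"
    and h: "h \<in> hom C Q Z" "h' \<in> hom C Q Z" "h \<cdot> q = h' \<cdot> q"
  shows "h = h'"
proof -
  note D = is_coequalizerD[OF q]
  have "(h \<cdot> q) \<cdot> f = (h \<cdot> q) \<cdot> g"
    using Comp_assoc[OF D(1) D(3) h(1)] Comp_assoc[OF D(2) D(3) h(1)] D(4) by simp
  then have "\<exists>!k. k \<in> hom C Q Z \<and> k \<cdot> q = h \<cdot> q"
    using q Comp_hom[OF D(3) h(1)] by (simp add: is_coequalizer_def)
  then show ?thesis using h by auto
qed

text \<open>
  A map \<open>k\<close> with \<open>k f = k g\<close> factors through \<open>e\<close> as \<open>k s\<close>, because \<open>k s e = k g t = k f t = k\<close>. These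
  equations are preserved by every functor.
\<close>

lemma (in category) split_coequalizer:
  assumes f: "f \<in> hom C X Y" and g: "g \<in> hom C X Y" and e: "e \<in> hom C Y Z" and s: "s \<in> hom C Z Y"
    and t: "t \<in> hom C Y X" and ef: "e \<cdot> f = e \<cdot> g" and es: "e \<cdot> s = Ident C Z"
    and ft: "f \<cdot> t = Ident C Y" and gt: "g \<cdot> t = s \<cdot> e"
  shows "is_coequalizer C X Y f g Z e"
  unfolding is_coequalizer_def
proof (intro conjI allI impI f g e ef)
  fix V k assume "k \<in> hom C Y V \<and> k \<cdot> f = k \<cdot> g"
  then have k: "k \<in> hom C Y V" and kf: "k \<cdot> f = k \<cdot> g" by auto
  show "\<exists>!h. h \<in> hom C Z V \<and> h \<cdot> e = k"
  proof (rule ex1I[of _ "k \<cdot> s"])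
    have "(k \<cdot> s) \<cdot> e = k"
      using Comp_assoc[OF e s k] Comp_assoc[OF t g k] Comp_assoc[OF t f k] Comp_Ident_right[OF k]
      by (simp add: gt[symmetric] ft kf)
    then show "k \<cdot> s \<in> hom C Z V \<and> (k \<cdot> s) \<cdot> e = k" using Comp_hom[OF s k] by simp
    fix h assume h: "h \<in> hom C Z V \<and> h \<cdot> e = k"
    then show "h = k \<cdot> s"
      using Comp_assoc[OF s e, of h V] Comp_Ident_right[of h Z V] by (simp add: es)
  qed
qed

lemma (in category) coequalizer_iso:
  assumes q: "is_coequalizer C X Y f g Q q" and q': "is_coequalizer C X Y f g Q' q'"
  obtains h h' where "h \<in> hom C Q Q'" "h \<cdot> q = q'" "h' \<in> hom C Q' Q" "h' \<cdot> h = Ident C Q" "h \<cdot> h' = Ident C Q'"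
proof -
  note D = is_coequalizerD[OF q] and D' = is_coequalizerD[OF q']
  obtain h where h: "h \<in> hom C Q Q'" "h \<cdot> q = q'" using D(5)[OF D'(3,4)] by blast
  obtain h' where h': "h' \<in> hom C Q' Q" "h' \<cdot> q' = q" using D'(5)[OF D(3,4)] by blast
  have Q: "Q \<in> Obj C" "Q' \<in> Obj C" using hom_ObjD[OF h(1)] by auto
  have "h' \<cdot> h = Ident C Q"
    using Comp_assoc[OF D(3) h(1) h'(1)] Comp_Ident_left[OF D(3)]
    by (intro coequalizer_epi[OF q Comp_hom[OF h(1) h'(1)] Ident_hom[OF Q(1)]]) (simp add: h h')
  moreover have "h \<cdot> h' = Ident C Q'"
    using Comp_assoc[OF D'(3) h'(1) h(1)] Comp_Ident_left[OF D'(3)]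
    by (intro coequalizer_epi[OF q' Comp_hom[OF h'(1) h(1)] Ident_hom[OF Q(2)]]) (simp add: h h')
  ultimately show ?thesis using that h h' by blast
qed

text \<open>
  The shape of a parallel pair needs four distinct elements of the universe.
\<close>

definition tok :: "nat \<Rightarrow> 'u::universe" where
  "tok = (SOME e. inj e)"

lemma tok_eq_iff [simp]: "tok i = (tok j :: 'u::universe) \<longleftrightarrow> i = j"
proof -
  have "\<exists>e :: nat \<Rightarrow> 'u. inj e"
    using universe_infinite[where 'a = 'u] by (auto simp: infinite_iff_countable_subset)
  then have "inj (tok :: nat \<Rightarrow> 'u)" unfolding tok_def by (rule someI_ex)
  then show ?thesis by (simp add: inj_eq)
qed

text \<open>
  Arrows are elements of the universe. The objects \<open>tok 0\<close> and \<open>tok 1\<close> serve as their own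
  identities; \<open>tok 2\<close> and \<open>tok 3\<close> are the two parallel arrows from \<open>tok 0\<close> to \<open>tok 1\<close>.
\<close>

definition parallel_pair :: "('u::universe, 'u) cat" where
  "parallel_pair = \<lparr>Obj = {tok 0, tok 1}, Arr = {tok 0, tok 1, tok 2, tok 3},
     Dom = (\<lambda>u. if u = tok 1 then tok 1 else tok 0), Cod = (\<lambda>u. if u = tok 0 then tok 0 else tok 1),
     Ident = (\<lambda>x. x), Comp = (\<lambda>g f. if g = tok 0 \<or> g = tok 1 then f else g)\<rparr>"

lemma parallel_pair_simps:
  "Obj parallel_pair = {tok 0, tok 1}" "Ident parallel_pair x = x"
  "g \<cdot>\<^bsub>parallel_pair\<^esub> f = (if g = tok 0 \<or> g = tok 1 then f else g)"
  "u \<in> hom parallel_pair X Y \<longleftrightarrow> u = tok 0 \<and> X = tok 0 \<and> Y = tok 0 \<or>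
     u = tok 1 \<and> X = tok 1 \<and> Y = tok 1 \<or> (u = tok 2 \<or> u = tok 3) \<and> X = tok 0 \<and> Y = tok 1"
  by (auto simp: parallel_pair_def hom_def)

lemma small_finite: "finite A \<Longrightarrow> small TYPE('u::universe) A"
  by (simp add: small_def finite_lesspoll_infinite universe_infinite)

lemma small_category_parallel_pair:
  "small_category TYPE('u::universe) (parallel_pair :: ('u, 'u) cat)"
  unfolding small_category_def
proof (intro conjI)
  show "category (parallel_pair :: ('u, 'u) cat)"
    by unfold_locales (auto simp: parallel_pair_def hom_def split: if_splits)
qed (simp_all add: parallel_pair_def small_finite)

definition pair_diagram :: "('o, 'a) cat \<Rightarrow> 'o \<Rightarrow> 'o \<Rightarrow> 'a \<Rightarrow> 'a \<Rightarrow> ('u::universe, 'u, 'o, 'a) func" where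
  "pair_diagram C X Y f g = \<lparr>omap = (\<lambda>i. if i = tok 0 then X else Y),
     amap = (\<lambda>u. if u = tok 0 then Ident C X else if u = tok 1 then Ident C Y
                 else if u = tok 2 then f else g)\<rparr>"

lemma (in category) is_functor_pair_diagram:
  assumes f: "f \<in> hom C X Y" and g: "g \<in> hom C X Y"
  shows "is_functor (parallel_pair :: ('u::universe, 'u) cat) C (pair_diagram C X Y f g)"
proof -
  interpret P: category "parallel_pair :: ('u, 'u) cat"
    using small_category_parallel_pair by (auto simp: small_category_def)
  have XY: "X \<in> Obj C" "Y \<in> Obj C" using hom_ObjD[OF f] by auto
  note I = Comp_Ident_left[OF f] Comp_Ident_left[OF g] Comp_Ident_right[OF f] Comp_Ident_right[OF g]
    Comp_Ident_left[OF Ident_hom[OF XY(1)]] Comp_Ident_left[OF Ident_hom[OF XY(2)]]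
  show ?thesis
  proof (intro is_functor.intro is_functor_axioms.intro P.category_axioms category_axioms)
    fix u v i j k assume u: "u \<in> hom (parallel_pair :: ('u, 'u) cat) i j"
    show "amap (pair_diagram C X Y f g) u \<in>
        hom C (omap (pair_diagram C X Y f g) i) (omap (pair_diagram C X Y f g) j)"
      using u f g Ident_hom[OF XY(1)] Ident_hom[OF XY(2)]
      unfolding parallel_pair_simps by (elim disjE conjE) (simp_all add: pair_diagram_def)
    assume v: "v \<in> hom (parallel_pair :: ('u, 'u) cat) j k"
    show "amap (pair_diagram C X Y f g) (v \<cdot>\<^bsub>parallel_pair\<^esub> u) =
        amap (pair_diagram C X Y f g) v \<cdot> amap (pair_diagram C X Y f g) u"
      using u v unfolding parallel_pair_simps
      by (elim disjE conjE) (simp_all add: pair_diagram_def I)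
  qed (auto simp: pair_diagram_def parallel_pair_simps XY)
qed

text \<open>
  A cocone on a parallel pair is determined by its component at the target, which has to
  coequalize the pair.
\<close>

lemma is_cocone_parallel_pair_iff:
  assumes "is_functor (parallel_pair :: ('u::universe, 'u) cat) C D"
  shows "is_cocone parallel_pair C D Z \<kappa> \<longleftrightarrow>
    \<kappa> (tok 1) \<in> hom C (omap D (tok 1)) Z \<and>
    \<kappa> (tok 0) = \<kappa> (tok 1) \<cdot>\<^bsub>C\<^esub> amap D (tok 2) \<and>
    \<kappa> (tok 1) \<cdot>\<^bsub>C\<^esub> amap D (tok 2) = \<kappa> (tok 1) \<cdot>\<^bsub>C\<^esub> amap D (tok 3)"
    (is "?L \<longleftrightarrow> ?R")
proof
  assume ?L
  then show ?R by (auto simp: is_cocone_def parallel_pair_def)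
next
  interpret D: is_functor "parallel_pair :: ('u, 'u) cat" C D by fact
  assume R: ?R
  have D2: "amap D (tok 2) \<in> hom C (omap D (tok 0)) (omap D (tok 1))"
    by (rule D.amap_hom) (simp add: hom_def parallel_pair_def)
  have I: "amap D (tok 0) = Ident C (omap D (tok 0))" "amap D (tok 1) = Ident C (omap D (tok 1))"
    using D.amap_Ident[of "tok 0"] D.amap_Ident[of "tok 1"] by (simp_all add: parallel_pair_def)
  have \<kappa>: "\<kappa> (tok 0) \<in> hom C (omap D (tok 0)) Z" "\<kappa> (tok 1) \<in> hom C (omap D (tok 1)) Z"
    using R D.B.Comp_hom[OF D2, of "\<kappa> (tok 1)" Z] by simp_all
  have "\<kappa> (tok 0) \<cdot>\<^bsub>C\<^esub> amap D (tok 0) = \<kappa> (tok 0)" "\<kappa> (tok 1) \<cdot>\<^bsub>C\<^esub> amap D (tok 1) = \<kappa> (tok 1)"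
    using D.B.Comp_Ident_right[OF \<kappa>(1)] D.B.Comp_Ident_right[OF \<kappa>(2)] I by (simp_all del: One_nat_def)
  then show ?L
    using R \<kappa> D.B.hom_ObjD(2)[OF \<kappa>(1)] assms
    by (auto simp: is_cocone_def parallel_pair_def)
qed

lemma coequalizer_of_colimit:
  assumes col: "is_colimit (parallel_pair :: ('u::universe, 'u) cat) C D Q \<iota>"
  shows "is_coequalizer C (omap D (tok 0)) (omap D (tok 1)) (amap D (tok 2)) (amap D (tok 3)) Q (\<iota> (tok 1))"
proof -
  interpret D: is_functor "parallel_pair :: ('u, 'u) cat" C D
    using col by (simp add: is_colimit_def is_cocone_def)
  note cocone_iff = is_cocone_parallel_pair_iff[OF D.is_functor_axioms]
  have D2: "amap D (tok 2) \<in> hom C (omap D (tok 0)) (omap D (tok 1))"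
    and D3: "amap D (tok 3) \<in> hom C (omap D (tok 0)) (omap D (tok 1))"
    by (rule D.amap_hom, simp add: hom_def parallel_pair_def)+
  have \<iota>: "\<iota> (tok 1) \<in> hom C (omap D (tok 1)) Q"
    "\<iota> (tok 0) = \<iota> (tok 1) \<cdot>\<^bsub>C\<^esub> amap D (tok 2)"
    "\<iota> (tok 1) \<cdot>\<^bsub>C\<^esub> amap D (tok 2) = \<iota> (tok 1) \<cdot>\<^bsub>C\<^esub> amap D (tok 3)"
    using col by (auto simp: is_colimit_def cocone_iff)
  have "\<exists>!h. h \<in> hom C Q Z \<and> h \<cdot>\<^bsub>C\<^esub> \<iota> (tok 1) = k"
    if k: "k \<in> hom C (omap D (tok 1)) Z"
      and eq: "k \<cdot>\<^bsub>C\<^esub> amap D (tok 2) = k \<cdot>\<^bsub>C\<^esub> amap D (tok 3)" for Z k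
  proof -
    let ?\<kappa> = "\<lambda>i :: 'u. if i = tok 0 then k \<cdot>\<^bsub>C\<^esub> amap D (tok 2) else k"
    have "is_cocone parallel_pair C D Z ?\<kappa>"
      using k eq by (simp add: cocone_iff)
    then have "\<exists>!h. h \<in> hom C Q Z \<and> (\<forall>i\<in>Obj (parallel_pair :: ('u, 'u) cat). h \<cdot>\<^bsub>C\<^esub> \<iota> i = ?\<kappa> i)"
      using col by (simp add: is_colimit_def)
    moreover have "(\<forall>i\<in>Obj (parallel_pair :: ('u, 'u) cat). h \<cdot>\<^bsub>C\<^esub> \<iota> i = ?\<kappa> i) \<longleftrightarrow> h \<cdot>\<^bsub>C\<^esub> \<iota> (tok 1) = k"
      if "h \<in> hom C Q Z" for h
      using D.B.Comp_assoc[OF D2 \<iota>(1) that] by (auto simp: parallel_pair_def \<iota>(2))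
    ultimately show ?thesis by (auto cong: conj_cong)
  qed
  then show ?thesis
    using D2 D3 \<iota> by (auto simp: is_coequalizer_def)
qed

lemma colimit_of_coequalizer:
  assumes "is_functor (parallel_pair :: ('u::universe, 'u) cat) C D"
    and q: "is_coequalizer C (omap D (tok 0)) (omap D (tok 1)) (amap D (tok 2)) (amap D (tok 3)) Q q"
  shows "is_colimit parallel_pair C D Q (\<lambda>i. if i = tok 0 then q \<cdot>\<^bsub>C\<^esub> amap D (tok 2) else q)"
proof -
  interpret D: is_functor "parallel_pair :: ('u, 'u) cat" C D by fact
  note cocone_iff = is_cocone_parallel_pair_iff[OF D.is_functor_axioms]
  note qD = is_coequalizerD[OF q]
  let ?\<iota> = "\<lambda>i :: 'u. if i = tok 0 then q \<cdot>\<^bsub>C\<^esub> amap D (tok 2) else q"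
  have "\<exists>!h. h \<in> hom C Q Z \<and> (\<forall>i\<in>Obj (parallel_pair :: ('u, 'u) cat). h \<cdot>\<^bsub>C\<^esub> ?\<iota> i = \<kappa> i)"
    if "is_cocone parallel_pair C D Z \<kappa>" for Z \<kappa>
  proof -
    have k: "\<kappa> (tok 1) \<in> hom C (omap D (tok 1)) Z"
      "\<kappa> (tok 0) = \<kappa> (tok 1) \<cdot>\<^bsub>C\<^esub> amap D (tok 2)"
      "\<kappa> (tok 1) \<cdot>\<^bsub>C\<^esub> amap D (tok 2) = \<kappa> (tok 1) \<cdot>\<^bsub>C\<^esub> amap D (tok 3)"
      using that by (auto simp: cocone_iff)
    have "\<exists>!h. h \<in> hom C Q Z \<and> h \<cdot>\<^bsub>C\<^esub> q = \<kappa> (tok 1)"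
      using q k by (simp add: is_coequalizer_def)
    moreover have "(\<forall>i\<in>Obj (parallel_pair :: ('u, 'u) cat). h \<cdot>\<^bsub>C\<^esub> ?\<iota> i = \<kappa> i) \<longleftrightarrow> h \<cdot>\<^bsub>C\<^esub> q = \<kappa> (tok 1)"
      if "h \<in> hom C Q Z" for h
      using D.B.Comp_assoc[OF qD(1) qD(3) that] by (auto simp: parallel_pair_def k(2))
    ultimately show ?thesis by (auto cong: conj_cong)
  qed
  then show ?thesis
    using qD by (auto simp: is_colimit_def cocone_iff)
qed

lemma cocomplete_coequalizer:
  assumes C: "cocomplete TYPE('u::universe) C" and "f \<in> hom C X Y" "g \<in> hom C X Y"
  shows "\<exists>Q q. is_coequalizer C X Y f g Q q"
proof -
  have "category C" using C by (simp add: cocomplete_def)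
  then have "is_functor (parallel_pair :: ('u, 'u) cat) C (pair_diagram C X Y f g)"
    using assms(2,3) by (rule category.is_functor_pair_diagram)
  then obtain Q \<iota> where
    "is_colimit (parallel_pair :: ('u, 'u) cat) C (pair_diagram C X Y f g) Q \<iota>"
    using C small_category_parallel_pair unfolding cocomplete_def by blast
  from coequalizer_of_colimit[OF this] show ?thesis
    by (auto simp: pair_diagram_def)
qed

lemma cocontinuous_coequalizer:
  assumes F: "cocontinuous TYPE('u::universe) A B F" and q: "is_coequalizer A X Y f g Q q"
  shows "is_coequalizer B (omap F X) (omap F Y) (amap F f) (amap F g) (omap F Q) (amap F q)"
proof -
  interpret F: is_functor A B F using F by (simp add: cocontinuous_def)
  let ?D = "pair_diagram A X Y f g :: ('u, 'u, _, _) func"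
  have D: "is_functor parallel_pair A ?D"
    using is_coequalizerD[OF q] by (intro F.A.is_functor_pair_diagram)
  have "is_colimit parallel_pair A ?D Q (\<lambda>i. if i = tok 0 then q \<cdot>\<^bsub>A\<^esub> f else q)"
    using colimit_of_coequalizer[OF D, of Q q] q by (simp add: pair_diagram_def cong: if_cong)
  then have "is_colimit parallel_pair B (comp_func F ?D) (omap F Q)
      (\<lambda>i. amap F (if i = tok 0 then q \<cdot>\<^bsub>A\<^esub> f else q))"
    using F small_category_parallel_pair unfolding cocontinuous_def by blast
  from coequalizer_of_colimit[OF this] show ?thesis
    by (simp add: comp_func_def pair_diagram_def)
qed

lemma is_product_op_cat:
  "is_product (op_cat C) I X P \<iota> \<longleftrightarrow> (\<forall>i\<in>I. X i \<in> Obj C) \<and> P \<in> Obj C \<and>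
     (\<forall>i\<in>I. \<iota> i \<in> hom C (X i) P) \<and>
     (\<forall>Q q. Q \<in> Obj C \<and> (\<forall>i\<in>I. q i \<in> hom C (X i) Q) \<longrightarrow>
        (\<exists>!h. h \<in> hom C P Q \<and> (\<forall>i\<in>I. h \<cdot>\<^bsub>C\<^esub> \<iota> i = q i)))"
  by (simp add: is_product_def)

definition discrete_cat :: "'i set \<Rightarrow> ('i, 'i) cat" where
  "discrete_cat I = \<lparr>Obj = I, Arr = I, Dom = (\<lambda>i. i), Cod = (\<lambda>i. i), Ident = (\<lambda>i. i), Comp = (\<lambda>g f. f)\<rparr>"

lemma discrete_cat_simps:
  "Obj (discrete_cat I) = I" "Ident (discrete_cat I) i = i" "g \<cdot>\<^bsub>discrete_cat I\<^esub> f = f"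
  "i \<in> hom (discrete_cat I) X Y \<longleftrightarrow> i \<in> I \<and> X = i \<and> Y = i"
  by (auto simp: discrete_cat_def hom_def)

lemma category_discrete_cat: "category (discrete_cat I)"
  by unfold_locales (auto simp: discrete_cat_def hom_def)

lemma is_cocone_discrete_cat_iff:
  assumes "is_functor (discrete_cat I) C D"
  shows "is_cocone (discrete_cat I) C D Z \<kappa> \<longleftrightarrow> Z \<in> Obj C \<and> (\<forall>i\<in>I. \<kappa> i \<in> hom C (omap D i) Z)"
proof -
  interpret D: is_functor "discrete_cat I" C D by fact
  have "amap D i = Ident C (omap D i)" if "i \<in> I" for i
    using D.amap_Ident[of i] that by (simp add: discrete_cat_def)
  then show ?thesis
    using assms D.B.Comp_Ident_right[of "\<kappa> i" "omap D i" Z for i] by (auto simp: is_cocone_def discrete_cat_def)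
qed

lemma is_colimit_discrete_cat_iff:
  assumes "is_functor (discrete_cat I) C D"
  shows "is_colimit (discrete_cat I) C D P \<iota> \<longleftrightarrow> is_product (op_cat C) I (omap D) P \<iota>"
proof -
  interpret D: is_functor "discrete_cat I" C D by fact
  have "omap D i \<in> Obj C" if "i \<in> I" for i
    using D.omap_Obj[of i] that by (simp add: discrete_cat_def)
  moreover have "Obj (discrete_cat I) = I" by (simp add: discrete_cat_def)
  ultimately show ?thesis
    by (auto simp: is_colimit_def is_product_op_cat is_cocone_discrete_cat_iff[OF assms])
qed

lemma cocontinuous_preserves_coproducts:
  assumes F: "cocontinuous TYPE('u) A B F"
  shows "preserves_products TYPE('u) (op_cat A) (op_cat B) F"
proof -
  interpret F: is_functor A B F using F by (simp add: cocontinuous_def)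
  have "is_product (op_cat B) I (\<lambda>i. omap F (X i)) (omap F P) (\<lambda>i. amap F (\<iota> i))"
    if I: "small TYPE('u) I" and P: "is_product (op_cat A) I X P \<iota>" for I :: "'u set" and X P \<iota>
  proof -
    let ?D = "\<lparr>omap = X, amap = (\<lambda>i. Ident A (X i))\<rparr>"
    have D: "is_functor (discrete_cat I) A ?D"
    proof (intro is_functor.intro is_functor_axioms.intro category_discrete_cat)
      show "category A" by (fact F.A.category_axioms)
    qed (use P in \<open>auto simp: is_product_op_cat discrete_cat_simps F.A.Ident_hom
        F.A.Comp_Ident_left[OF F.A.Ident_hom]\<close>)
    have "small_category TYPE('u) (discrete_cat I)"
      using I category_discrete_cat[of I] by (simp add: small_category_def discrete_cat_def)
    moreover have "is_colimit (discrete_cat I) A ?D P \<iota>"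
      using P by (simp add: is_colimit_discrete_cat_iff[OF D])
    ultimately have "is_colimit (discrete_cat I) B (comp_func F ?D) (omap F P) (\<lambda>i. amap F (\<iota> i))"
      using F unfolding cocontinuous_def by blast
    then show ?thesis
      by (simp add: is_colimit_discrete_cat_iff[OF is_functor_comp_func[OF D F.is_functor_axioms]])
        (simp add: comp_func_def o_def)
  qed
  then show ?thesis
    by (simp add: preserves_products_def F.is_functor_axioms)
qed

text \<open>
  The representative of a functor among those that are undefined outside of the category \<open>A\<close>.
\<close>

definition restrict_func :: "('o, 'a) cat \<Rightarrow> ('o, 'a, 'p, 'b) func \<Rightarrow> ('o, 'a, 'p, 'b) func" where
  "restrict_func A F = \<lparr>omap = restrict (omap F) (Obj A), amap = restrict (amap F) (Arr A)\<rparr>"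

lemma restrict_func_simps [simp]:
  "X \<in> Obj A \<Longrightarrow> omap (restrict_func A F) X = omap F X"
  "f \<in> Arr A \<Longrightarrow> amap (restrict_func A F) f = amap F f"
  "f \<in> hom A X Y \<Longrightarrow> amap (restrict_func A F) f = amap F f"
  by (simp_all add: restrict_func_def hom_def)

lemma is_functor_restrict_func:
  assumes "is_functor A B F"
  shows "is_functor A B (restrict_func A F)"
proof -
  interpret is_functor A B F by fact
  show ?thesis
  proof (intro is_functor.intro is_functor_axioms.intro A.category_axioms B.category_axioms)
    fix f g X Y Z assume f: "f \<in> hom A X Y"
    then show "amap (restrict_func A F) f \<in> hom B (omap (restrict_func A F) X) (omap (restrict_func A F) Y)"
      using amap_hom[OF f] A.hom_ObjD[OF f] by simp
    assume g: "g \<in> hom A Y Z"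
    show "amap (restrict_func A F) (g \<cdot>\<^bsub>A\<^esub> f) = amap (restrict_func A F) g \<cdot>\<^bsub>B\<^esub> amap (restrict_func A F) f"
      using amap_Comp[OF f g]
      by (simp add: restrict_func_simps(3)[OF f] restrict_func_simps(3)[OF g] restrict_func_simps(3)[OF A.Comp_hom[OF f g]])
  next
    fix X assume X: "X \<in> Obj A"
    then show "omap (restrict_func A F) X \<in> Obj B" by (simp add: omap_Obj)
    show "amap (restrict_func A F) (Ident A X) = Ident B (omap (restrict_func A F) X)"
      using X by (simp add: restrict_func_simps(3)[OF A.Ident_hom[OF X]] amap_Ident)
  qed
qed

lemma is_product_cong:
  assumes "\<And>i. i \<in> I \<Longrightarrow> X i = X' i" "\<And>i. i \<in> I \<Longrightarrow> \<pi> i = \<pi>' i"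
  shows "is_product C I X P \<pi> \<longleftrightarrow> is_product C I X' P \<pi>'"
  using assms by (simp add: is_product_def cong: ball_cong)

lemma preserves_products_restrict_func:
  assumes F: "preserves_products U A B F"
  shows "preserves_products U A B (restrict_func A F)"
  unfolding preserves_products_def
proof (intro conjI allI impI)
  show "is_functor A B (restrict_func A F)"
    using F is_functor_restrict_func by (auto simp: preserves_products_def)
  fix I :: "'a set" and X P \<pi>
  assume P: "small U I \<and> is_product A I X P \<pi>"
  then have X: "\<And>i. i \<in> I \<Longrightarrow> X i \<in> Obj A" "P \<in> Obj A" "\<And>i. i \<in> I \<Longrightarrow> \<pi> i \<in> hom A P (X i)"
    by (auto simp: is_product_def)
  have "is_product B I (\<lambda>i. omap F (X i)) (omap F P) (\<lambda>i. amap F (\<pi> i))"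
    using F P unfolding preserves_products_def by blast
  then show "is_product B I (\<lambda>i. omap (restrict_func A F) (X i)) (omap (restrict_func A F) P)
      (\<lambda>i. amap (restrict_func A F) (\<pi> i))"
    using X(1,2) by (subst is_product_cong[of I _ "\<lambda>i. omap F (X i)" _ "\<lambda>i. amap F (\<pi> i)"])
      (simp_all add: restrict_func_simps(3)[OF X(3)])
qed

lemma preserves_products_comp_func:
  assumes F: "preserves_products U A B F" and G: "preserves_products U B C G"
  shows "preserves_products U A C (comp_func G F)"
  using is_functor_comp_func[of A B F C G] F G unfolding preserves_products_def
  by (simp add: comp_func_def)

lemma restrict_func_op_cat [simp]: "restrict_func (op_cat A) F = restrict_func A F"
  by (simp add: restrict_func_def)

lemma Obj_Hom_c:
  "G \<in> Obj (Hom_c U A B) \<longleftrightarrow> is_functor A B G \<and> omap G \<in> extensional (Obj A) \<and>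
     amap G \<in> extensional (Arr A) \<and> cocontinuous U A B G"
  by (auto simp: Hom_c_def functor_cat_simps)

lemma hom_Hom_c:
  "hom (Hom_c U A B) G H = {Arrow G \<tau> H | \<tau>. G \<in> Obj (Hom_c U A B) \<and> H \<in> Obj (Hom_c U A B) \<and>
     nat_trans A B G H \<tau> \<and> \<tau> \<in> extensional (Obj A)}"
  by (auto simp: Hom_c_def hom_full_subcat hom_functor_cat)

lemma Hom_c_simps:
  "Ident (Hom_c U A B) G = Arrow G (\<lambda>X\<in>Obj A. Ident B (omap G X)) G"
  "\<tau> \<cdot>\<^bsub>Hom_c U A B\<^esub> \<sigma> = Arrow (source \<sigma>) (\<lambda>X\<in>Obj A. mapping \<tau> X \<cdot>\<^bsub>B\<^esub> mapping \<sigma> X) (target \<tau>)"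
  by (simp_all add: Hom_c_def functor_cat_simps)

lemma category_Hom_c: "category A \<Longrightarrow> category B \<Longrightarrow> category (Hom_c U A B)"
  by (simp add: Hom_c_def category_full_subcat category_functor_cat)

section \<open>Small sets\<close>

lemma small_image: "small U A \<Longrightarrow> small U (f ` A)"
  unfolding small_def by (meson lesspoll_trans1 image_lepoll)

text \<open>
  An injective pairing makes it possible to form disjoint unions, and hence coproducts of
  small sets, inside the universe.
\<close>

definition pair_code :: "'u::universe \<times> 'u \<Rightarrow> 'u" where
  "pair_code = (SOME p. inj p)"

lemma pair_code_eq_iff [simp]:
  "pair_code (i, x) = (pair_code (j, y) :: 'u::universe) \<longleftrightarrow> i = j \<and> x = y"
proof -
  have "\<exists>p :: 'u \<times> 'u \<Rightarrow> 'u. inj p"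
    using card_of_Times_same_infinite[OF universe_infinite[where 'a = 'u]]
    unfolding card_of_ordIso[symmetric] UNIV_Times_UNIV by (auto simp: bij_betw_def)
  then have "inj (pair_code :: 'u \<times> 'u \<Rightarrow> 'u)"
    unfolding pair_code_def by (rule someI_ex)
  then show ?thesis by (simp add: inj_eq)
qed

definition disjoint_union :: "'u::universe set \<Rightarrow> ('u \<Rightarrow> 'u set) \<Rightarrow> 'u set" where
  "disjoint_union I X = (\<Union>i\<in>I. (\<lambda>x. pair_code (i, x)) ` X i)"

lemma small_disjoint_union:
  assumes "small TYPE('u::universe) (I :: 'u set)" "\<And>i. i \<in> I \<Longrightarrow> small TYPE('u) (X i)"
  shows "small TYPE('u) (disjoint_union I X)"
  using assms small_image[of "TYPE('u)"] unfolding disjoint_union_def small_def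
  by (intro universe_UN) blast+

lemma disjoint_union_copair:
  assumes f: "\<And>i. i \<in> I \<Longrightarrow> f i \<in> X i \<rightarrow> B"
  obtains g where "g \<in> disjoint_union I X \<rightarrow> B" "\<And>i x. g (pair_code (i, x)) = f i x"
proof
  \<comment> \<open>Outside the range of the code the value does not matter.\<close>
  let ?g = "\<lambda>y. let p = SOME p. y = pair_code p in f (fst p) (snd p)"
  have *: "?g (pair_code (i, x)) = f i x" for i x
  proof -
    have "(SOME p. pair_code (i, x) = pair_code p) = (i, x)"
      by (rule some_equality, rule refl) (metis pair_code_eq_iff prod.collapse)
    then show ?thesis by simp
  qed
  show "?g (pair_code (i, x)) = f i x" for i x by (rule *)
  show "?g \<in> disjoint_union I X \<rightarrow> B"
    using f by (auto simp: disjoint_union_def * Pi_iff simp del: Let_def)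
qed

text \<open>
  Functions are handled as plain functions on the whole universe; they are cut down to their domain
  only when they are packed into an arrow.
\<close>

definition fn :: "'u set \<Rightarrow> ('u \<Rightarrow> 'u) \<Rightarrow> 'u set \<Rightarrow> 'u set_arrow" where
  "fn X f Y = Arrow X (restrict f X) Y"

lemma fn_simps [simp]: "source (fn X f Y) = X" "target (fn X f Y) = Y" "x \<in> X \<Longrightarrow> mapping (fn X f Y) x = f x"
  by (simp_all add: fn_def)

lemma fn_eq_iff: "fn X f Y = fn X g Y \<longleftrightarrow> (\<forall>x\<in>X. f x = g x)"
  by (auto simp: fn_def restrict_def fun_eq_iff)

lemma fn_cong: "(\<And>x. x \<in> X \<Longrightarrow> f x = g x) \<Longrightarrow> fn X f Y = fn X g Y"
  by (simp add: fn_eq_iff)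

lemma set_cat_simps:
  "Obj (set_cat :: ('u set, 'u set_arrow) cat) = {A. small TYPE('u) A}"
  "Dom (set_cat :: ('u set, 'u set_arrow) cat) = source"
  "Cod (set_cat :: ('u set, 'u set_arrow) cat) = target"
  "Ident (set_cat :: ('u set, 'u set_arrow) cat) X = fn X (\<lambda>x. x) X"
  by (simp_all add: set_cat_def fn_def)

lemma fn_in_hom_iff:
  "fn X f Y \<in> hom (set_cat :: ('u set, 'u set_arrow) cat) X Y \<longleftrightarrow>
     small TYPE('u) X \<and> small TYPE('u) Y \<and> f \<in> X \<rightarrow> Y"
  by (auto simp: hom_def set_cat_def fn_def)

lemma hom_set_catE:
  assumes "u \<in> hom (set_cat :: ('u set, 'u set_arrow) cat) X Y"
  shows "u = fn X (mapping u) Y" "mapping u \<in> X \<rightarrow> Y" "small TYPE('u) X" "small TYPE('u) Y"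
  using assms by (auto simp: hom_def set_cat_def fn_def extensional_restrict PiE_def)

lemma fn_comp:
  assumes "f \<in> X \<rightarrow> Y"
  shows "fn Y g Z \<cdot>\<^bsub>set_cat\<^esub> fn X f Y = fn X (\<lambda>x. g (f x)) Z"
  using assms by (auto simp: set_cat_def fn_def compose_def restrict_def fun_eq_iff)

section \<open>Monads on sets as Kleisli triples\<close>

locale monad_on_sets = monad set_cat T for T :: "'u::universe set_monad"
begin

abbreviation sm :: "'u set \<Rightarrow> bool" where "sm \<equiv> small TYPE('u)"

definition TT :: "'u set \<Rightarrow> 'u set" where "TT X = omap (Endo T) X"
definition eta :: "'u set \<Rightarrow> 'u \<Rightarrow> 'u" where "eta X = mapping (Unit T X)"
definition mu :: "'u set \<Rightarrow> 'u \<Rightarrow> 'u" where "mu X = mapping (Mult T X)"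
definition tmap :: "'u set \<Rightarrow> ('u \<Rightarrow> 'u) \<Rightarrow> 'u set \<Rightarrow> 'u \<Rightarrow> 'u" where
  "tmap X f Y = mapping (amap (Endo T) (fn X f Y))"

sublocale E: is_functor set_cat set_cat "Endo T" by (rule Endo_functor)
sublocale U: nat_trans set_cat set_cat id_func "Endo T" "Unit T" by (rule Unit_nat_trans)
sublocale M: nat_trans set_cat set_cat "comp_func (Endo T) (Endo T)" "Endo T" "Mult T" by (rule Mult_nat_trans)

lemma small_TT [simp]: "sm X \<Longrightarrow> sm (TT X)"
  using E.omap_Obj[of X] by (simp add: set_cat_simps TT_def)

lemma eta_fn:
  assumes "sm X"
  shows "Unit T X = fn X (eta X) (TT X)" "eta X \<in> X \<rightarrow> TT X"
  using hom_set_catE[OF U.component_hom, of X] assms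
  by (simp_all add: set_cat_simps id_func_def eta_def TT_def)

lemma mu_fn:
  assumes "sm X"
  shows "Mult T X = fn (TT (TT X)) (mu X) (TT X)" "mu X \<in> TT (TT X) \<rightarrow> TT X"
  using hom_set_catE[OF M.component_hom, of X] assms
  by (simp_all add: set_cat_simps comp_func_def mu_def TT_def)

lemma tmap_fn:
  assumes "sm X" "sm Y" "f \<in> X \<rightarrow> Y"
  shows "amap (Endo T) (fn X f Y) = fn (TT X) (tmap X f Y) (TT Y)" "tmap X f Y \<in> TT X \<rightarrow> TT Y"
  using hom_set_catE[OF E.amap_hom, of "fn X f Y" X Y] assms
  by (simp_all add: fn_in_hom_iff tmap_def TT_def)

lemma eta_in [simp]: "sm X \<Longrightarrow> x \<in> X \<Longrightarrow> eta X x \<in> TT X"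
  using eta_fn(2) by blast

lemma mu_in [simp]: "sm X \<Longrightarrow> t \<in> TT (TT X) \<Longrightarrow> mu X t \<in> TT X"
  using mu_fn(2) by blast

lemma tmap_in: "sm X \<Longrightarrow> sm Y \<Longrightarrow> f \<in> X \<rightarrow> Y \<Longrightarrow> t \<in> TT X \<Longrightarrow> tmap X f Y t \<in> TT Y"
  using tmap_fn(2) by blast

lemma tmap_cong: "(\<And>x. x \<in> X \<Longrightarrow> f x = g x) \<Longrightarrow> tmap X f Y = tmap X g Y"
  using fn_cong[of X f g Y] by (simp add: tmap_def)

lemma tmap_tmap:
  assumes "sm X" "sm Y" "sm Z" "f \<in> X \<rightarrow> Y" "g \<in> Y \<rightarrow> Z" "t \<in> TT X"
  shows "tmap Y g Z (tmap X f Y t) = tmap X (\<lambda>x. g (f x)) Z t"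
proof -
  have "(\<lambda>x. g (f x)) \<in> X \<rightarrow> Z" using assms by auto
  then show ?thesis
    using E.amap_Comp[of "fn X f Y" X Y "fn Y g Z" Z] assms tmap_fn[of X Y f] tmap_fn[of Y Z g] tmap_fn[of X Z "\<lambda>x. g (f x)"]
    by (simp add: fn_in_hom_iff fn_comp fn_eq_iff)
qed

lemma tmap_eta:
  assumes "sm X" "sm Y" "f \<in> X \<rightarrow> Y" "x \<in> X"
  shows "tmap X f Y (eta X x) = eta Y (f x)"
  using U.naturality[of "fn X f Y" X Y] assms tmap_fn[of X Y f] eta_fn[of X] eta_fn[of Y]
  by (simp add: fn_in_hom_iff id_func_def fn_comp fn_eq_iff)

lemma tmap_mu:
  assumes "sm X" "sm Y" "f \<in> X \<rightarrow> Y" "t \<in> TT (TT X)"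
  shows "tmap X f Y (mu X t) = mu Y (tmap (TT X) (tmap X f Y) (TT Y) t)"
  using M.naturality[of "fn X f Y" X Y] assms tmap_fn[of X Y f] mu_fn[of X] mu_fn[of Y]
    tmap_fn[of "TT X" "TT Y" "tmap X f Y"]
  by (simp add: fn_in_hom_iff comp_func_def fn_comp fn_eq_iff)

lemma mu_eta: "sm X \<Longrightarrow> t \<in> TT X \<Longrightarrow> mu X (eta (TT X) t) = t"
  using Mult_Unit_left[of X] mu_fn[of X] eta_fn[of "TT X"]
  by (simp add: set_cat_simps TT_def[symmetric] fn_comp fn_eq_iff)

lemma mu_tmap_eta: "sm X \<Longrightarrow> t \<in> TT X \<Longrightarrow> mu X (tmap X (eta X) (TT X) t) = t"
  using Mult_Unit_right[of X] mu_fn[of X] eta_fn[of X] tmap_fn[of X "TT X" "eta X"]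
  by (simp add: set_cat_simps TT_def[symmetric] fn_comp fn_eq_iff)

lemma mu_tmap_mu: "sm X \<Longrightarrow> t \<in> TT (TT (TT X)) \<Longrightarrow> mu X (tmap (TT (TT X)) (mu X) (TT X) t) = mu X (mu (TT X) t)"
  using Mult_assoc[of X] mu_fn[of X] mu_fn[of "TT X"] tmap_fn[of "TT (TT X)" "TT X" "mu X"]
  by (simp add: set_cat_simps TT_def[symmetric] fn_comp fn_eq_iff)

text \<open>
  The Kleisli extension of \<open>f\<close>: it substitutes the terms \<open>f x\<close> for the variables of a term over \<open>X\<close>.
  Composition of Kleisli arrows is this substitution.
\<close>

definition bind :: "'u set \<Rightarrow> ('u \<Rightarrow> 'u) \<Rightarrow> 'u set \<Rightarrow> 'u \<Rightarrow> 'u" where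
  "bind X f Y t = mu Y (tmap X f (TT Y) t)"

lemma bind_in: "sm X \<Longrightarrow> sm Y \<Longrightarrow> f \<in> X \<rightarrow> TT Y \<Longrightarrow> t \<in> TT X \<Longrightarrow> bind X f Y t \<in> TT Y"
  by (simp add: bind_def tmap_in)

lemma bind_cong: "(\<And>x. x \<in> X \<Longrightarrow> f x = g x) \<Longrightarrow> bind X f Y t = bind X g Y t"
  using tmap_cong[of X f g "TT Y"] by (simp add: bind_def)

lemma bind_eta: "sm X \<Longrightarrow> sm Y \<Longrightarrow> f \<in> X \<rightarrow> TT Y \<Longrightarrow> x \<in> X \<Longrightarrow> bind X f Y (eta X x) = f x"
  by (simp add: bind_def tmap_eta mu_eta Pi_iff)

lemma bind_eta_right: "sm X \<Longrightarrow> t \<in> TT X \<Longrightarrow> bind X (eta X) X t = t"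
  by (simp add: bind_def mu_tmap_eta)

lemma tmap_eq_bind:
  assumes "sm X" "sm Y" "f \<in> X \<rightarrow> Y" "t \<in> TT X"
  shows "tmap X f Y t = bind X (\<lambda>x. eta Y (f x)) Y t"
proof -
  have "tmap X (\<lambda>x. eta Y (f x)) (TT Y) t = tmap Y (eta Y) (TT Y) (tmap X f Y t)"
    using assms eta_fn(2)[of Y] by (subst tmap_tmap) auto
  then show ?thesis
    using assms by (simp add: bind_def mu_tmap_eta tmap_in)
qed

lemma tmap_id: "sm X \<Longrightarrow> t \<in> TT X \<Longrightarrow> tmap X (\<lambda>x. x) X t = t"
  by (simp add: tmap_eq_bind bind_eta_right)

lemma mu_eq_bind: "sm X \<Longrightarrow> t \<in> TT (TT X) \<Longrightarrow> mu X t = bind (TT X) (\<lambda>s. s) X t"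
  by (simp add: bind_def tmap_id)

text \<open>
  Naturality of the multiplication moves the inner multiplication outwards, where the
  associativity law of the monad applies.
\<close>

lemma bind_bind:
  assumes "sm X" "sm Y" "sm Z" "f \<in> X \<rightarrow> TT Y" "g \<in> Y \<rightarrow> TT Z" "t \<in> TT X"
  shows "bind Y g Z (bind X f Y t) = bind X (\<lambda>x. bind Y g Z (f x)) Z t"
proof -
  let ?g = "tmap Y g (TT Z)"
  have g: "?g \<in> TT Y \<rightarrow> TT (TT Z)" using assms tmap_fn(2)[of Y "TT Z" g] by simp
  have gf: "(\<lambda>x. ?g (f x)) \<in> X \<rightarrow> TT (TT Z)" using g assms(4) by auto
  have "bind Y g Z (bind X f Y t) = mu Z (?g (mu Y (tmap X f (TT Y) t)))"
    by (simp add: bind_def)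
  also have "\<dots> = mu Z (mu (TT Z) (tmap (TT Y) ?g (TT (TT Z)) (tmap X f (TT Y) t)))"
    using assms by (simp add: tmap_mu tmap_in)
  also have "\<dots> = mu Z (mu (TT Z) (tmap X (\<lambda>x. ?g (f x)) (TT (TT Z)) t))"
    using assms g by (simp add: tmap_tmap)
  also have "\<dots> = mu Z (tmap (TT (TT Z)) (mu Z) (TT Z) (tmap X (\<lambda>x. ?g (f x)) (TT (TT Z)) t))"
    using assms gf by (simp add: mu_tmap_mu tmap_in)
  also have "\<dots> = mu Z (tmap X (\<lambda>x. mu Z (?g (f x))) (TT Z) t)"
    using assms gf mu_fn(2)[of Z] by (simp add: tmap_tmap)
  finally show ?thesis by (simp add: bind_def)
qed

section \<open>The Kleisli category\<close>

abbreviation K :: "('u set, ('u set, 'u set_arrow) arrow) cat" where "K \<equiv> kleisli_cat set_cat T"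

text \<open>
  Every Kleisli arrow has this form; equality and composition of such arrows are pointwise statements
  about the underlying functions (\<open>kar_eq_iff\<close>, \<open>kar_comp\<close>).
\<close>

definition kar :: "'u set \<Rightarrow> ('u \<Rightarrow> 'u) \<Rightarrow> 'u set \<Rightarrow> ('u set, 'u set_arrow) arrow" where
  "kar X f Y = Arrow X (fn X f (TT Y)) Y"

lemma K_simps: "Obj K = {X. sm X}" "Dom K = source" "Cod K = target"
  by (simp_all add: kleisli_cat_def set_cat_simps)

lemma Ident_K: "sm X \<Longrightarrow> Ident K X = kar X (eta X) X"
  by (simp add: kleisli_cat_def kar_def eta_fn)

lemma kar_in_hom: "kar X f Y \<in> hom K X Y \<longleftrightarrow> sm X \<and> sm Y \<and> f \<in> X \<rightarrow> TT Y"
  by (auto simp: hom_def[of K] K_simps kar_def) 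
    (auto simp: kleisli_cat_def set_cat_simps fn_in_hom_iff TT_def[symmetric])

lemma hom_KE:
  assumes "u \<in> hom K X Y"
  obtains f where "u = kar X f Y" "f \<in> X \<rightarrow> TT Y" "sm X" "sm Y"
proof -
  have "source u = X" "target u = Y" using homD(2,3)[OF assms] by (simp_all add: K_simps)
  then have "u = Arrow X (mapping u) Y" "mapping u \<in> hom set_cat X (TT Y)" "sm X" "sm Y"
    using homD(1)[OF assms] by (auto simp: kleisli_cat_def set_cat_simps TT_def)
  moreover from this have "mapping u = fn X (mapping (mapping u)) (TT Y)" "mapping (mapping u) \<in> X \<rightarrow> TT Y"
    using hom_set_catE by blast+
  ultimately show ?thesis using that[of "mapping (mapping u)"] by (simp add: kar_def)
qed

lemma kar_eq_iff: "kar X f Y = kar X g Y \<longleftrightarrow> (\<forall>x\<in>X. f x = g x)"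
  by (simp add: kar_def fn_eq_iff)

lemma kar_cong: "(\<And>x. x \<in> X \<Longrightarrow> f x = g x) \<Longrightarrow> kar X f Y = kar X g Y"
  by (simp add: kar_eq_iff)

lemma kar_comp:
  assumes "sm X" "sm Y" "sm Z" "f \<in> X \<rightarrow> TT Y" "g \<in> Y \<rightarrow> TT Z"
  shows "kar Y g Z \<cdot>\<^bsub>K\<^esub> kar X f Y = kar X (\<lambda>x. bind Y g Z (f x)) Z"
proof -
  have g: "tmap Y g (TT Z) \<in> TT Y \<rightarrow> TT (TT Z)"
    using assms by (intro tmap_fn) auto
  show ?thesis
    using assms g
    by (simp add: kleisli_cat_def kar_def tmap_fn mu_fn fn_comp bind_def)
qed

lemma category_K: "category K"
proof
  show "Dom K f \<in> Obj K" "Cod K f \<in> Obj K" if "f \<in> Arr K" for f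
    using that by (auto simp: kleisli_cat_def)
  show "Ident K X \<in> hom K X X" if "X \<in> Obj K" for X
    using that eta_fn(2)[of X] by (simp add: K_simps Ident_K kar_in_hom)
  show "g \<cdot>\<^bsub>K\<^esub> f \<in> hom K X Z" if "f \<in> hom K X Y" "g \<in> hom K Y Z" for f g X Y Z
    using that by (elim hom_KE) (simp add: kar_comp kar_in_hom, simp add: Pi_iff bind_in)
  show "Ident K Y \<cdot>\<^bsub>K\<^esub> f = f" "f \<cdot>\<^bsub>K\<^esub> Ident K X = f" if "f \<in> hom K X Y" for f X Y
    using that eta_fn(2)[of X] eta_fn(2)[of Y]
    by (auto elim!: hom_KE simp: Ident_K kar_comp bind_eta bind_eta_right Pi_iff intro!: kar_cong)
  show "(h \<cdot>\<^bsub>K\<^esub> g) \<cdot>\<^bsub>K\<^esub> f = h \<cdot>\<^bsub>K\<^esub> (g \<cdot>\<^bsub>K\<^esub> f)"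
    if fgh: "f \<in> hom K W X" "g \<in> hom K X Y" "h \<in> hom K Y Z" for f g h W X Y Z
  proof -
    obtain f0 where f: "f = kar W f0 X" "f0 \<in> W \<rightarrow> TT X" and [simp]: "sm W" "sm X"
      using fgh(1) by (rule hom_KE)
    obtain g0 where g: "g = kar X g0 Y" "g0 \<in> X \<rightarrow> TT Y" and [simp]: "sm Y"
      using fgh(2) by (rule hom_KE)
    obtain h0 where h: "h = kar Y h0 Z" "h0 \<in> Y \<rightarrow> TT Z" and [simp]: "sm Z"
      using fgh(3) by (rule hom_KE)
    have a: "(\<lambda>x. bind X g0 Y (f0 x)) \<in> W \<rightarrow> TT Y"
      by (rule Pi_I, rule bind_in) (use f(2) g(2) in auto)
    have b: "(\<lambda>x. bind Y h0 Z (g0 x)) \<in> X \<rightarrow> TT Z"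
      by (rule Pi_I, rule bind_in) (use g(2) h(2) in auto)
    have "bind Y h0 Z (bind X g0 Y (f0 x)) = bind X (\<lambda>x. bind Y h0 Z (g0 x)) Z (f0 x)" if "x \<in> W" for x
      by (rule bind_bind) (use f(2) g(2) h(2) that in auto)
    then show ?thesis
      using a b f(2) g(2) h(2) by (simp add: f(1) g(1) h(1) kar_comp kar_eq_iff)
  qed
qed

section \<open>Algebras\<close>

abbreviation car :: "'u set \<times> 'u set_arrow \<Rightarrow> 'u set" where "car \<equiv> fst"

definition str :: "'u set \<times> 'u set_arrow \<Rightarrow> 'u \<Rightarrow> 'u" where "str P = mapping (snd P)"

definition mkalg :: "'u set \<Rightarrow> ('u \<Rightarrow> 'u) \<Rightarrow> 'u set \<times> 'u set_arrow" where
  "mkalg A \<alpha> = (A, fn (TT A) \<alpha> A)"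

lemma car_mkalg [simp]: "car (mkalg A \<alpha>) = A"
  by (simp add: mkalg_def)

lemma str_mkalg: "t \<in> TT A \<Longrightarrow> str (mkalg A \<alpha>) t = \<alpha> t"
  by (simp add: mkalg_def str_def)

abbreviation is_alg :: "'u set \<times> 'u set_arrow \<Rightarrow> bool" where "is_alg P \<equiv> P \<in> Obj (Alg T)"

lemma is_alg_mkalg_iff: "is_alg (mkalg A \<alpha>) \<longleftrightarrow> sm A \<and> \<alpha> \<in> TT A \<rightarrow> A \<and> (\<forall>x\<in>A. \<alpha> (eta A x) = x) \<and>
    (\<forall>t\<in>TT (TT A). \<alpha> (tmap (TT A) \<alpha> A t) = \<alpha> (mu A t))"
proof (cases "sm A \<and> \<alpha> \<in> TT A \<rightarrow> A")
  case True
  then show ?thesis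
    using tmap_fn[of "TT A" A \<alpha>] eta_fn[of A] mu_fn[of A]
    by (auto simp: Alg_def algebra_cat_def is_algebra_def mkalg_def set_cat_simps TT_def[symmetric]
        fn_in_hom_iff fn_comp fn_eq_iff)
next
  case False
  then show ?thesis
    by (auto simp: Alg_def algebra_cat_def is_algebra_def mkalg_def set_cat_simps TT_def[symmetric]
        fn_in_hom_iff)
qed

lemma mkalg_car_str:
  assumes "is_alg P"
  shows "mkalg (car P) (str P) = P"
  using assms hom_set_catE(1)[of "snd P" "TT (car P)" "car P"]
  by (auto simp: Alg_def algebra_cat_def is_algebra_def mkalg_def str_def TT_def prod_eq_iff)

lemma is_algD:
  assumes "is_alg P"
  shows "sm (car P)" "str P \<in> TT (car P) \<rightarrow> car P" "\<And>x. x \<in> car P \<Longrightarrow> str P (eta (car P) x) = x"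
    "\<And>t. t \<in> TT (TT (car P)) \<Longrightarrow> str P (tmap (TT (car P)) (str P) (car P) t) = str P (mu (car P) t)"
  using assms is_alg_mkalg_iff[of "car P" "str P"] mkalg_car_str[OF assms] by auto

text \<open>
  The value in \<open>P\<close> of a term over \<open>X\<close> under the assignment \<open>f\<close> of elements of \<open>P\<close> to the variables.
\<close>

definition ev :: "'u set \<times> 'u set_arrow \<Rightarrow> 'u set \<Rightarrow> ('u \<Rightarrow> 'u) \<Rightarrow> 'u \<Rightarrow> 'u" where
  "ev P X f t = str P (tmap X f (car P) t)"

lemma ev_in: "is_alg P \<Longrightarrow> sm X \<Longrightarrow> f \<in> X \<rightarrow> car P \<Longrightarrow> t \<in> TT X \<Longrightarrow> ev P X f t \<in> car P"
  using is_algD(1,2)[of P] tmap_in[of X "car P" f t] by (auto simp: ev_def)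

lemma ev_cong: "(\<And>x. x \<in> X \<Longrightarrow> f x = g x) \<Longrightarrow> ev P X f t = ev P X g t"
  using tmap_cong[of X f g] by (simp add: ev_def)

lemma ev_eta: "is_alg P \<Longrightarrow> sm X \<Longrightarrow> f \<in> X \<rightarrow> car P \<Longrightarrow> x \<in> X \<Longrightarrow> ev P X f (eta X x) = f x"
  using is_algD(1,3)[of P] by (auto simp: ev_def tmap_eta)

lemma ev_id: "is_alg P \<Longrightarrow> t \<in> TT (car P) \<Longrightarrow> ev P (car P) (\<lambda>x. x) t = str P t"
  using is_algD(1)[of P] by (simp add: ev_def tmap_id)

lemma ev_tmap:
  "is_alg P \<Longrightarrow> sm X \<Longrightarrow> sm Y \<Longrightarrow> f \<in> X \<rightarrow> Y \<Longrightarrow> g \<in> Y \<rightarrow> car P \<Longrightarrow> t \<in> TT X \<Longrightarrow>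
    ev P Y g (tmap X f Y t) = ev P X (\<lambda>x. g (f x)) t"
  using is_algD(1)[of P] by (simp add: ev_def tmap_tmap)

lemma ev_mu:
  assumes P: "is_alg P" and [simp]: "sm Y" and f: "f \<in> Y \<rightarrow> car P" and t: "t \<in> TT (TT Y)"
  shows "ev P Y f (mu Y t) = ev P (TT Y) (ev P Y f) t"
proof -
  note [simp] = is_algD(1)[OF P]
  have *: "tmap Y f (car P) \<in> TT Y \<rightarrow> TT (car P)" using f by (intro tmap_fn) auto
  have "ev P Y f (mu Y t) = str P (mu (car P) (tmap (TT Y) (tmap Y f (car P)) (TT (car P)) t))"
    using f t by (simp add: ev_def tmap_mu)
  also have "\<dots> = str P (tmap (TT (car P)) (str P) (car P) (tmap (TT Y) (tmap Y f (car P)) (TT (car P)) t))"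
    using * t by (simp add: is_algD(4)[OF P] tmap_in)
  also have "\<dots> = str P (tmap (TT Y) (\<lambda>y. str P (tmap Y f (car P) y)) (car P) t)"
    using * t is_algD(2)[OF P] by (simp add: tmap_tmap)
  finally show ?thesis by (simp add: ev_def[abs_def])
qed

text \<open>
  The defining equation is stated with \<open>ev\<close>; homomorphisms then commute with the evaluation of terms
  under any assignment (\<open>is_alghom_ev\<close>).
\<close>

definition is_alghom :: "'u set \<times> 'u set_arrow \<Rightarrow> 'u set \<times> 'u set_arrow \<Rightarrow> ('u \<Rightarrow> 'u) \<Rightarrow> bool" where
  "is_alghom P Q f \<longleftrightarrow> is_alg P \<and> is_alg Q \<and> f \<in> car P \<rightarrow> car Q \<and>
     (\<forall>t\<in>TT (car P). f (str P t) = ev Q (car P) f t)"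

lemma is_alghom_ev:
  assumes "is_alghom P Q h" "sm X" "f \<in> X \<rightarrow> car P" "t \<in> TT X"
  shows "h (ev P X f t) = ev Q X (\<lambda>x. h (f x)) t"
proof -
  have h: "is_alg P" "is_alg Q" "h \<in> car P \<rightarrow> car Q" "\<And>t. t \<in> TT (car P) \<Longrightarrow> h (str P t) = ev Q (car P) h t"
    using assms(1) by (auto simp: is_alghom_def)
  have "h (ev P X f t) = ev Q (car P) h (tmap X f (car P) t)"
    using h(4)[of "tmap X f (car P) t"] tmap_in[of X "car P" f t] assms is_algD(1)[OF h(1)] by (simp add: ev_def)
  also have "\<dots> = ev Q X (\<lambda>x. h (f x)) t"
    using ev_tmap[OF h(2) assms(2) is_algD(1)[OF h(1)] assms(3) h(3) assms(4)] .
  finally show ?thesis .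
qed

definition aar :: "'u set \<times> 'u set_arrow \<Rightarrow> ('u \<Rightarrow> 'u) \<Rightarrow> 'u set \<times> 'u set_arrow \<Rightarrow>
    ('u set \<times> 'u set_arrow, 'u set_arrow) arrow" where
  "aar P f Q = Arrow P (fn (car P) f (car Q)) Q"

lemma aar_eq_iff: "aar P f Q = aar P g Q \<longleftrightarrow> (\<forall>x\<in>car P. f x = g x)"
  by (simp add: aar_def fn_eq_iff)

lemma aar_cong: "(\<And>x. x \<in> car P \<Longrightarrow> f x = g x) \<Longrightarrow> aar P f Q = aar P g Q"
  by (simp add: aar_eq_iff)

lemma Alg_simps: "Dom (Alg T) = source" "Cod (Alg T) = target"
  by (simp_all add: Alg_def algebra_cat_def)

lemma Ident_Alg: "Ident (Alg T) P = aar P (\<lambda>x. x) P"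
  by (cases P) (simp add: Alg_def algebra_cat_def aar_def set_cat_simps)

lemma aar_comp: "f \<in> car P \<rightarrow> car Q \<Longrightarrow> aar Q g R \<cdot>\<^bsub>Alg T\<^esub> aar P f Q = aar P (\<lambda>x. g (f x)) R"
  by (simp add: Alg_def algebra_cat_def aar_def fn_comp)

lemma hom_comm_iff:
  assumes P: "is_alg P" and Q: "is_alg Q" and f: "f \<in> car P \<rightarrow> car Q"
  shows "fn (car P) f (car Q) \<cdot>\<^bsub>set_cat\<^esub> snd P = snd Q \<cdot>\<^bsub>set_cat\<^esub> amap (Endo T) (fn (car P) f (car Q)) \<longleftrightarrow>
    (\<forall>t\<in>TT (car P). f (str P t) = ev Q (car P) f t)"
proof -
  have "snd P = fn (TT (car P)) (str P) (car P)" "snd Q = fn (TT (car Q)) (str Q) (car Q)"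
    using mkalg_car_str[OF P] mkalg_car_str[OF Q] unfolding mkalg_def by (metis snd_conv)+
  then show ?thesis
    using is_algD(1,2)[OF P] is_algD(1,2)[OF Q] tmap_fn[of "car P" "car Q" f] f
    by (simp add: fn_comp fn_eq_iff ev_def)
qed

lemma in_hom_iff: "f \<in> hom C X Y \<longleftrightarrow> f \<in> Arr C \<and> Dom C f = X \<and> Cod C f = Y"
  by (simp add: hom_def)

lemma Arrow_in_hom_Alg_iff: "Arrow P f Q \<in> hom (Alg T) P Q \<longleftrightarrow> is_alg P \<and> is_alg Q \<and>
    f \<in> hom set_cat (car P) (car Q) \<and>
    f \<cdot>\<^bsub>set_cat\<^esub> snd P = snd Q \<cdot>\<^bsub>set_cat\<^esub> amap (Endo T) f"
  by (cases P, cases Q, simp add: in_hom_iff[of _ "Alg T"], simp add: Alg_def algebra_cat_def)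

lemma aar_in_hom: "aar P f Q \<in> hom (Alg T) P Q \<longleftrightarrow> is_alghom P Q f"
proof (cases "is_alg P \<and> is_alg Q \<and> f \<in> car P \<rightarrow> car Q")
  case True
  then show ?thesis
    using hom_comm_iff[of P Q f] is_algD(1)[of P] is_algD(1)[of Q]
    by (auto simp: aar_def Arrow_in_hom_Alg_iff is_alghom_def fn_in_hom_iff)
next
  case False
  then show ?thesis
    by (auto simp: aar_def Arrow_in_hom_Alg_iff is_alghom_def fn_in_hom_iff)
qed

lemma hom_AlgE:
  assumes "u \<in> hom (Alg T) P Q"
  obtains f where "u = aar P f Q" "is_alghom P Q f"
proof -
  obtain g where u: "u = Arrow P g Q"
    using assms by (cases u) (auto simp: hom_def Alg_simps)
  then have g: "g \<in> hom set_cat (car P) (car Q)"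
    using assms by (simp add: Arrow_in_hom_Alg_iff)
  from u have "u = aar P (mapping g) Q" using hom_set_catE(1)[OF g] by (simp add: aar_def)
  then show ?thesis using that assms aar_in_hom by metis
qed

lemma is_alghomD:
  assumes "is_alghom P Q f"
  shows "is_alg P" "is_alg Q" "f \<in> car P \<rightarrow> car Q" "\<And>t. t \<in> TT (car P) \<Longrightarrow> f (str P t) = ev Q (car P) f t"
    "sm (car P)" "sm (car Q)"
  using assms is_algD(1) by (auto simp: is_alghom_def)

lemma is_alghom_comp:
  assumes f: "is_alghom P Q f" and g: "is_alghom Q R g"
  shows "is_alghom P R (\<lambda>x. g (f x))"
  unfolding is_alghom_def
proof (intro conjI ballI)
  note F = is_alghomD[OF f] and G = is_alghomD[OF g]
  show "is_alg P" "is_alg R" "(\<lambda>x. g (f x)) \<in> car P \<rightarrow> car R" using F G by auto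
  show "g (f (str P t)) = ev R (car P) (\<lambda>x. g (f x)) t" if "t \<in> TT (car P)" for t
    using F(4)[OF that] is_alghom_ev[OF g F(5) F(3) that] by simp
qed

lemma is_alghom_cong:
  assumes "is_alghom P Q f" "\<And>x. x \<in> car P \<Longrightarrow> f x = g x"
  shows "is_alghom P Q g"
  using assms aar_in_hom aar_cong by metis

lemma is_alghom_id: "is_alg P \<Longrightarrow> is_alghom P P (\<lambda>x. x)"
  by (simp add: is_alghom_def ev_id)

lemma category_Alg: "category (Alg T)"
proof
  show "Dom (Alg T) f \<in> Obj (Alg T)" "Cod (Alg T) f \<in> Obj (Alg T)" if "f \<in> Arr (Alg T)" for f
    using that by (auto simp: Alg_def algebra_cat_def)
  show "Ident (Alg T) P \<in> hom (Alg T) P P" if "P \<in> Obj (Alg T)" for P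
    using that by (simp add: Ident_Alg aar_in_hom is_alghom_id)
  show "g \<cdot>\<^bsub>Alg T\<^esub> f \<in> hom (Alg T) X Z" if fg: "f \<in> hom (Alg T) X Y" "g \<in> hom (Alg T) Y Z" for f g X Y Z
  proof -
    obtain f0 where f: "f = aar X f0 Y" "is_alghom X Y f0" using fg(1) by (rule hom_AlgE)
    obtain g0 where g: "g = aar Y g0 Z" "is_alghom Y Z g0" using fg(2) by (rule hom_AlgE)
    show ?thesis
      using is_alghom_comp[OF f(2) g(2)] by (simp add: f(1) g(1) aar_comp[OF is_alghomD(3)[OF f(2)]] aar_in_hom)
  qed
  show "Ident (Alg T) Y \<cdot>\<^bsub>Alg T\<^esub> f = f" "f \<cdot>\<^bsub>Alg T\<^esub> Ident (Alg T) X = f" if "f \<in> hom (Alg T) X Y" for f X Y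
    using that by (auto elim!: hom_AlgE simp: Ident_Alg aar_comp is_alghomD(3))
  show "(h \<cdot>\<^bsub>Alg T\<^esub> g) \<cdot>\<^bsub>Alg T\<^esub> f = h \<cdot>\<^bsub>Alg T\<^esub> (g \<cdot>\<^bsub>Alg T\<^esub> f)"
    if fgh: "f \<in> hom (Alg T) W X" "g \<in> hom (Alg T) X Y" "h \<in> hom (Alg T) Y Z" for f g h W X Y Z
  proof -
    obtain f0 where f: "f = aar W f0 X" "is_alghom W X f0" using fgh(1) by (rule hom_AlgE)
    obtain g0 where g: "g = aar X g0 Y" "is_alghom X Y g0" using fgh(2) by (rule hom_AlgE)
    obtain h0 where h: "h = aar Y h0 Z" using fgh(3) by (rule hom_AlgE)
    note [simp] = is_alghomD(3)[OF f(2)] is_alghomD(3)[OF g(2)] is_alghomD(3)[OF is_alghom_comp[OF f(2) g(2)]]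
    show ?thesis by (simp add: f(1) g(1) h aar_comp)
  qed
qed

section \<open>Free algebras\<close>

definition Fr :: "'u set \<Rightarrow> 'u set \<times> 'u set_arrow" where "Fr X = mkalg (TT X) (mu X)"

lemma car_Fr [simp]: "car (Fr X) = TT X"
  by (simp add: Fr_def)

lemma str_Fr: "t \<in> TT (TT X) \<Longrightarrow> str (Fr X) t = mu X t"
  by (simp add: Fr_def str_mkalg)

lemma is_alg_Fr: "sm X \<Longrightarrow> is_alg (Fr X)"
  using mu_fn(2)[of X] by (simp add: Fr_def is_alg_mkalg_iff mu_eta mu_tmap_mu)

lemma ev_Fr: "sm X \<Longrightarrow> sm Y \<Longrightarrow> f \<in> X \<rightarrow> TT Y \<Longrightarrow> t \<in> TT X \<Longrightarrow> ev (Fr Y) X f t = bind X f Y t"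
  by (simp add: ev_def bind_def str_Fr tmap_in)

text \<open>
  Evaluation of terms is the homomorphic extension of an assignment to the free algebra.
\<close>

lemma is_alghom_ev_Fr:
  assumes "is_alg P" "sm X" "f \<in> X \<rightarrow> car P"
  shows "is_alghom (Fr X) P (ev P X f)"
  unfolding is_alghom_def
  using assms by (auto simp: is_alg_Fr ev_in str_Fr ev_mu)

text \<open>
  A homomorphism out of a free algebra is determined by its values on the generators, because
  every term is the evaluation of itself at the generators.
\<close>

lemma alghom_Fr_eq_ev:
  assumes h: "is_alghom (Fr X) P h" and [simp]: "sm X" and t: "t \<in> TT X"
  shows "h t = ev P X (\<lambda>x. h (eta X x)) t"
proof -
  have e: "eta X \<in> X \<rightarrow> TT X" by (rule eta_fn) simp
  have "t = ev (Fr X) X (eta X) t" using e t by (simp add: ev_Fr bind_eta_right)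
  then have "h t = h (ev (Fr X) X (eta X) t)" by simp
  also have "\<dots> = ev P X (\<lambda>x. h (eta X x)) t"
    using is_alghom_ev[OF h] e t by simp
  finally show ?thesis .
qed

lemma alghom_bind:
  assumes h: "is_alghom (Fr Y) P h" and "sm X" "sm Y" "f \<in> X \<rightarrow> TT Y" "t \<in> TT X"
  shows "h (bind X f Y t) = ev P X (\<lambda>x. h (f x)) t"
  using is_alghom_ev[OF h, of X f t] assms by (simp add: ev_Fr)

lemma is_alghom_bind:
  assumes "sm X" "sm Y" "f \<in> X \<rightarrow> TT Y"
  shows "is_alghom (Fr X) (Fr Y) (bind X f Y)"
  using is_alghom_ev_Fr[of "Fr Y" X f] assms
  by (auto simp: is_alg_Fr ev_Fr intro: is_alghom_cong)

definition FrF :: "('u set, ('u set, 'u set_arrow) arrow, 'u set \<times> 'u set_arrow,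
    ('u set \<times> 'u set_arrow, 'u set_arrow) arrow) func" where
  "FrF = \<lparr>omap = Fr, amap = (\<lambda>u. aar (Fr (source u))
     (bind (source u) (mapping (mapping u)) (target u)) (Fr (target u)))\<rparr>"

lemma omap_FrF [simp]: "omap FrF = Fr"
  by (simp add: FrF_def)

lemma FrF_kar: "amap FrF (kar X f Y) = aar (Fr X) (bind X f Y) (Fr Y)"
  using bind_cong[of X "mapping (fn X f (TT Y))" f] by (simp add: FrF_def kar_def aar_eq_iff)

lemma is_functor_FrF: "is_functor K (Alg T) FrF"
proof (intro is_functor.intro is_functor_axioms.intro category_K category_Alg)
  show "omap FrF X \<in> Obj (Alg T)" if "X \<in> Obj K" for X
    using that by (simp add: K_simps is_alg_Fr)
  show "amap FrF (Ident K X) = Ident (Alg T) (omap FrF X)" if "X \<in> Obj K" for X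
    using that by (simp add: K_simps Ident_K FrF_kar Ident_Alg aar_eq_iff bind_eta_right)
  fix f X Y assume "f \<in> hom K X Y"
  then obtain f0 where f: "f = kar X f0 Y" "f0 \<in> X \<rightarrow> TT Y" and [simp]: "sm X" "sm Y"
    by (rule hom_KE)
  show "amap FrF f \<in> hom (Alg T) (omap FrF X) (omap FrF Y)"
    using f(2) by (simp add: f(1) FrF_kar aar_in_hom is_alghom_bind)
  fix g Z assume "g \<in> hom K Y Z"
  then obtain g0 where g: "g = kar Y g0 Z" "g0 \<in> Y \<rightarrow> TT Z" and [simp]: "sm Z"
    by (rule hom_KE)
  have "bind X f0 Y \<in> TT X \<rightarrow> TT Y"
    using is_alghomD(3)[OF is_alghom_bind[OF _ _ f(2)]] by simp
  then show "amap FrF (g \<cdot>\<^bsub>K\<^esub> f) = amap FrF g \<cdot>\<^bsub>Alg T\<^esub> amap FrF f"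
    using f(2) g(2) by (simp add: f(1) g(1) kar_comp FrF_kar aar_comp aar_eq_iff bind_bind)
qed

sublocale FF: is_functor K "Alg T" FrF by (rule is_functor_FrF)

text \<open>
  The coproduct inclusion of \<open>X i\<close> into the disjoint union, as a Kleisli arrow.
\<close>

definition incl :: "'u set \<Rightarrow> ('u \<Rightarrow> 'u set) \<Rightarrow> 'u \<Rightarrow> ('u set, 'u set_arrow) arrow" where
  "incl I X i = kar (X i) (\<lambda>x. eta (disjoint_union I X) (pair_code (i, x))) (disjoint_union I X)"

lemma pair_code_in: "i \<in> I \<Longrightarrow> x \<in> X i \<Longrightarrow> pair_code (i, x) \<in> disjoint_union I X"
  by (auto simp: disjoint_union_def)

lemma incl_in_hom:
  assumes "sm I" "\<And>i. i \<in> I \<Longrightarrow> sm (X i)" "i \<in> I"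
  shows "incl I X i \<in> hom K (X i) (disjoint_union I X)"
  using assms small_disjoint_union[of I X] by (auto simp: incl_def kar_in_hom pair_code_in)

text \<open>
  Homomorphisms out of a free algebra are functions on its generators, and a function on a
  disjoint union is a family of functions on the summands.
\<close>

lemma coproduct_free_algebras:
  assumes I: "sm I" and X: "\<And>i. i \<in> I \<Longrightarrow> sm (X i)"
  shows "is_product (op_cat (Alg T)) I (\<lambda>i. Fr (X i)) (Fr (disjoint_union I X)) (\<lambda>i. amap FrF (incl I X i))"
  unfolding is_product_op_cat
proof (intro conjI ballI allI impI)
  let ?S = "disjoint_union I X"
  have S: "sm ?S" by (rule small_disjoint_union[OF I X])
  show "is_alg (Fr (X i))" if "i \<in> I" for i using X that by (simp add: is_alg_Fr)
  show "is_alg (Fr ?S)" using S by (simp add: is_alg_Fr)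
  show "amap FrF (incl I X i) \<in> hom (Alg T) (Fr (X i)) (Fr ?S)" if "i \<in> I" for i
    using FF.amap_hom[OF incl_in_hom[of I X]] I X that by simp
  fix Q q assume Q: "is_alg Q \<and> (\<forall>i\<in>I. q i \<in> hom (Alg T) (Fr (X i)) Q)"
  then have "\<forall>i\<in>I. \<exists>k. q i = aar (Fr (X i)) k Q \<and> is_alghom (Fr (X i)) Q k"
    by (meson hom_AlgE)
  then obtain k where q: "\<And>i. i \<in> I \<Longrightarrow> q i = aar (Fr (X i)) (k i) Q"
    and k: "\<And>i. i \<in> I \<Longrightarrow> is_alghom (Fr (X i)) Q (k i)"
    by metis
  have "(\<lambda>x. k i (eta (X i) x)) \<in> X i \<rightarrow> car Q" if "i \<in> I" for i
    using is_alghomD(3)[OF k[OF that]] X[OF that] by auto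
  then obtain g where g: "g \<in> ?S \<rightarrow> car Q" "\<And>i x. g (pair_code (i, x)) = k i (eta (X i) x)"
    using disjoint_union_copair[of I "\<lambda>i x. k i (eta (X i) x)" X "car Q"] by blast
  have in_S: "(\<lambda>x. eta ?S (pair_code (i, x))) \<in> X i \<rightarrow> TT ?S" if "i \<in> I" for i
    using that S by (auto simp: pair_code_in)
  have comp: "aar (Fr ?S) h Q \<cdot>\<^bsub>Alg T\<^esub> amap FrF (incl I X i) = q i \<longleftrightarrow>
      (\<forall>x\<in>X i. h (eta ?S (pair_code (i, x))) = g (pair_code (i, x)))"
    if i: "i \<in> I" and h: "is_alghom (Fr ?S) Q h" for i h
  proof -
    have "aar (Fr ?S) h Q \<cdot>\<^bsub>Alg T\<^esub> amap FrF (incl I X i) = q i \<longleftrightarrow>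
      (\<forall>t\<in>TT (X i). ev Q (X i) (\<lambda>x. h (eta ?S (pair_code (i, x)))) t = ev Q (X i) (\<lambda>x. k i (eta (X i) x)) t)"
      using is_alghomD(3)[OF is_alghom_bind[OF X[OF i] S in_S[OF i]]] alghom_bind[OF h X[OF i] S in_S[OF i]]
        alghom_Fr_eq_ev[OF k[OF i] X[OF i]]
      by (simp add: q[OF i] incl_def FrF_kar aar_comp aar_eq_iff)
    also have "\<dots> \<longleftrightarrow> (\<forall>x\<in>X i. h (eta ?S (pair_code (i, x))) = k i (eta (X i) x))" (is "?l \<longleftrightarrow> ?r")
    proof
      assume ?r then show ?l using ev_cong[of "X i" "\<lambda>x. h (eta ?S (pair_code (i, x)))"] by simp
    next
      assume l: ?l
      have 1: "(\<lambda>x. h (eta ?S (pair_code (i, x)))) \<in> X i \<rightarrow> car Q"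
        using in_S[OF i] is_alghomD(3)[OF h] by (simp add: Pi_iff)
      have 2: "(\<lambda>x. k i (eta (X i) x)) \<in> X i \<rightarrow> car Q"
        using is_alghomD(3)[OF k[OF i]] X[OF i] by (simp add: Pi_iff)
      show ?r
      proof
        fix x assume x: "x \<in> X i"
        show "h (eta ?S (pair_code (i, x))) = k i (eta (X i) x)"
          using l[rule_format, of "eta (X i) x"] ev_eta[OF _ X[OF i] 1 x] ev_eta[OF _ X[OF i] 2 x] Q x X[OF i]
          by simp
      qed
    qed
    finally show ?thesis by (simp add: g(2))
  qed
  show "\<exists>!h. h \<in> hom (Alg T) (Fr ?S) Q \<and> (\<forall>i\<in>I. h \<cdot>\<^bsub>Alg T\<^esub> amap FrF (incl I X i) = q i)"
  proof (rule ex1I)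
    have hom: "is_alghom (Fr ?S) Q (ev Q ?S g)"
      using Q S g(1) by (simp add: is_alghom_ev_Fr)
    have "ev Q ?S g (eta ?S s) = g s" if "s \<in> ?S" for s
      using ev_eta[OF _ S g(1) that] Q by simp
    then show "aar (Fr ?S) (ev Q ?S g) Q \<in> hom (Alg T) (Fr ?S) Q \<and>
        (\<forall>i\<in>I. aar (Fr ?S) (ev Q ?S g) Q \<cdot>\<^bsub>Alg T\<^esub> amap FrF (incl I X i) = q i)"
      using hom comp[OF _ hom] by (simp add: aar_in_hom pair_code_in)
    fix h assume h: "h \<in> hom (Alg T) (Fr ?S) Q \<and> (\<forall>i\<in>I. h \<cdot>\<^bsub>Alg T\<^esub> amap FrF (incl I X i) = q i)"
    then obtain h0 where h0: "h = aar (Fr ?S) h0 Q" "is_alghom (Fr ?S) Q h0"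
      by (meson hom_AlgE)
    have "h0 (eta ?S s) = g s" if "s \<in> ?S" for s
      using that h comp[OF _ h0(2)] by (auto simp: disjoint_union_def h0(1))
    then show "h = aar (Fr ?S) (ev Q ?S g) Q"
      using alghom_Fr_eq_ev[OF h0(2) S] ev_cong[of ?S "\<lambda>x. h0 (eta ?S x)" g]
      by (simp add: h0(1) aar_eq_iff)
  qed
qed

text \<open>
  The universal property of a coproduct \<open>P\<close> in \<open>K\<close> speaks only of maps into free algebras. It suffices,
  however, to compare \<open>P\<close> with the disjoint union: this gives \<open>u : P \<rightarrow> S\<close> and \<open>v : S \<rightarrow> P\<close> with
  \<open>v u = 1\<close>, and the universal property of \<open>F S\<close> among all algebras carries over to \<open>F P\<close>.
\<close>

lemma FrF_preserves_coproducts: "preserves_products TYPE('u) (op_cat K) (op_cat (Alg T)) FrF"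
  unfolding preserves_products_def
proof (intro conjI allI impI)
  show "is_functor (op_cat K) (op_cat (Alg T)) FrF" using is_functor_FrF by simp
  fix I :: "'u set" and X P \<pi>
  assume "sm I \<and> is_product (op_cat K) I X P \<pi>"
  then have I: "sm I" and prod: "is_product (op_cat K) I X P \<pi>" by auto
  have X: "\<And>i. i \<in> I \<Longrightarrow> sm (X i)" and P: "sm P" and \<pi>: "\<And>i. i \<in> I \<Longrightarrow> \<pi> i \<in> hom K (X i) P"
    using prod by (auto simp: is_product_op_cat K_simps)
  have prodD: "\<exists>!h. h \<in> hom K P Q \<and> (\<forall>i\<in>I. h \<cdot>\<^bsub>K\<^esub> \<pi> i = q i)"
    if "sm Q" "\<And>i. i \<in> I \<Longrightarrow> q i \<in> hom K (X i) Q" for Q q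
    using prod that by (auto simp: is_product_op_cat K_simps)
  let ?S = "disjoint_union I X"
  have S: "sm ?S" by (rule small_disjoint_union[OF I X])
  have in_S: "(\<lambda>x. eta ?S (pair_code (i, x))) \<in> X i \<rightarrow> TT ?S" if "i \<in> I" for i
    using that S by (auto simp: pair_code_in)
  have incl: "incl I X i \<in> hom K (X i) ?S" if "i \<in> I" for i
    by (rule incl_in_hom[OF I X that])
  \<comment> \<open>The comparison with the disjoint union in one direction comes from \<open>P\<close>, in the other from \<open>?S\<close>.\<close>
  obtain u where u: "u \<in> hom K P ?S" "\<And>i. i \<in> I \<Longrightarrow> u \<cdot>\<^bsub>K\<^esub> \<pi> i = incl I X i"
    using prodD[of ?S "incl I X"] S incl by blast
  have "\<forall>i\<in>I. \<exists>p. \<pi> i = kar (X i) p P \<and> p \<in> X i \<rightarrow> TT P"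
  proof
    fix i assume "i \<in> I"
    from \<pi>[OF this] show "\<exists>p. \<pi> i = kar (X i) p P \<and> p \<in> X i \<rightarrow> TT P"
      by (rule hom_KE) blast
  qed
  then obtain p where p: "\<And>i. i \<in> I \<Longrightarrow> \<pi> i = kar (X i) (p i) P" "\<And>i. i \<in> I \<Longrightarrow> p i \<in> X i \<rightarrow> TT P"
    by metis
  obtain v0 where v0: "v0 \<in> ?S \<rightarrow> TT P" "\<And>i x. v0 (pair_code (i, x)) = p i x"
    using disjoint_union_copair[of I p X "TT P"] p(2) by blast
  define v where "v = kar ?S v0 P"
  have v: "v \<in> hom K ?S P" using v0 S P by (simp add: v_def kar_in_hom)
  have v_incl: "v \<cdot>\<^bsub>K\<^esub> incl I X i = \<pi> i" if i: "i \<in> I" for i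
  proof -
    have "bind ?S v0 P (eta ?S (pair_code (i, x))) = p i x" if "x \<in> X i" for x
      using bind_eta[OF S P v0(1) pair_code_in[where X = X, OF i that]] by (simp add: v0(2))
    then show ?thesis
      using X[OF i] S P in_S[OF i] v0(1) by (simp add: v_def incl_def kar_comp p(1)[OF i] kar_eq_iff)
  qed
  have vu: "v \<cdot>\<^bsub>K\<^esub> u = Ident K P"
  proof -
    have ex1: "\<exists>!h. h \<in> hom K P P \<and> (\<forall>i\<in>I. h \<cdot>\<^bsub>K\<^esub> \<pi> i = \<pi> i)"
      by (rule prodD[OF P \<pi>])
    obtain m where m: "\<And>h. h \<in> hom K P P \<Longrightarrow> \<forall>i\<in>I. h \<cdot>\<^bsub>K\<^esub> \<pi> i = \<pi> i \<Longrightarrow> h = m"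
      using ex1 by (elim ex1E) blast
    have "(v \<cdot>\<^bsub>K\<^esub> u) \<cdot>\<^bsub>K\<^esub> \<pi> i = \<pi> i" if "i \<in> I" for i
      using FF.A.Comp_assoc[OF \<pi>[OF that] u(1) v] by (simp add: u(2) v_incl that)
    then have "v \<cdot>\<^bsub>K\<^esub> u = m"
      by (intro m FF.A.Comp_hom[OF u(1) v] ballI)
    moreover have "Ident K P = m"
      using FF.A.Comp_Ident_left[OF \<pi>] FF.A.Ident_hom[of P] P by (intro m ballI) (simp_all add: K_simps)
    ultimately show ?thesis by simp
  qed
  note Fu = FF.amap_hom[OF u(1)] and Fv = FF.amap_hom[OF v]
  have FvFu: "amap FrF v \<cdot>\<^bsub>Alg T\<^esub> amap FrF u = Ident (Alg T) (Fr P)"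
    using FF.amap_Comp[OF u(1) v] FF.amap_Ident[of P] P by (simp add: vu K_simps)
  have cop: "is_product (op_cat (Alg T)) I (\<lambda>i. Fr (X i)) (Fr ?S) (\<lambda>i. amap FrF (incl I X i))"
    by (rule coproduct_free_algebras[OF I X])
  show "is_product (op_cat (Alg T)) I (\<lambda>i. omap FrF (X i)) (omap FrF P) (\<lambda>i. amap FrF (\<pi> i))"
    unfolding is_product_op_cat
  proof (intro conjI ballI allI impI)
    show "is_alg (omap FrF (X i))" if "i \<in> I" for i using X that by (simp add: is_alg_Fr)
    show "is_alg (omap FrF P)" using P by (simp add: is_alg_Fr)
    show "amap FrF (\<pi> i) \<in> hom (Alg T) (omap FrF (X i)) (omap FrF P)" if "i \<in> I" for i
      using FF.amap_hom[OF \<pi>[OF that]] .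
    fix Q q assume "is_alg Q \<and> (\<forall>i\<in>I. q i \<in> hom (Alg T) (omap FrF (X i)) Q)"
    then have ex1: "\<exists>!h. h \<in> hom (Alg T) (Fr ?S) Q \<and> (\<forall>i\<in>I. h \<cdot>\<^bsub>Alg T\<^esub> amap FrF (incl I X i) = q i)"
      using cop by (simp add: is_product_op_cat del: split_paired_All)
    then obtain h where h: "h \<in> hom (Alg T) (Fr ?S) Q" "\<And>i. i \<in> I \<Longrightarrow> h \<cdot>\<^bsub>Alg T\<^esub> amap FrF (incl I X i) = q i"
      by blast
    have uniq: "k = h" if "k \<in> hom (Alg T) (Fr ?S) Q" "\<And>i. i \<in> I \<Longrightarrow> k \<cdot>\<^bsub>Alg T\<^esub> amap FrF (incl I X i) = q i" for k
      using ex1 h that by (elim ex1E) metis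
    show "\<exists>!k. k \<in> hom (Alg T) (omap FrF P) Q \<and> (\<forall>i\<in>I. k \<cdot>\<^bsub>Alg T\<^esub> amap FrF (\<pi> i) = q i)"
    proof (rule ex1I[of _ "h \<cdot>\<^bsub>Alg T\<^esub> amap FrF u"])
      have "(h \<cdot>\<^bsub>Alg T\<^esub> amap FrF u) \<cdot>\<^bsub>Alg T\<^esub> amap FrF (\<pi> i) = q i" if i: "i \<in> I" for i
        using FF.B.Comp_assoc[OF FF.amap_hom[OF \<pi>[OF i]] Fu, of h Q] h(1) h(2)[OF i]
          FF.amap_Comp[OF \<pi>[OF i] u(1), symmetric]
        by (simp add: u(2)[OF i])
      then show "h \<cdot>\<^bsub>Alg T\<^esub> amap FrF u \<in> hom (Alg T) (omap FrF P) Q \<and>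
          (\<forall>i\<in>I. (h \<cdot>\<^bsub>Alg T\<^esub> amap FrF u) \<cdot>\<^bsub>Alg T\<^esub> amap FrF (\<pi> i) = q i)"
        using FF.B.Comp_hom[OF Fu, of h Q] h by simp
      fix k assume "k \<in> hom (Alg T) (omap FrF P) Q \<and> (\<forall>i\<in>I. k \<cdot>\<^bsub>Alg T\<^esub> amap FrF (\<pi> i) = q i)"
      then have k: "k \<in> hom (Alg T) (Fr P) Q" "\<And>i. i \<in> I \<Longrightarrow> k \<cdot>\<^bsub>Alg T\<^esub> amap FrF (\<pi> i) = q i"
        by auto
      have "(k \<cdot>\<^bsub>Alg T\<^esub> amap FrF v) \<cdot>\<^bsub>Alg T\<^esub> amap FrF (incl I X i) = q i" if i: "i \<in> I" for i
        using FF.B.Comp_assoc[OF FF.amap_hom[OF incl[OF i]] Fv, of k Q] k(1) k(2)[OF i]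
          FF.amap_Comp[OF incl[OF i] v, symmetric]
        by (simp add: v_incl[OF i])
      then have "k \<cdot>\<^bsub>Alg T\<^esub> amap FrF v = h"
        using uniq FF.B.Comp_hom[OF Fv, of k Q] k(1) by simp
      then show "k = h \<cdot>\<^bsub>Alg T\<^esub> amap FrF u"
        using FF.B.Comp_assoc[OF Fu Fv, of k Q] k(1) FF.B.Comp_Ident_right[OF k(1)] FvFu by simp
    qed
  qed
qed

section \<open>Every algebra is a coequalizer of free algebras\<close>

text \<open>
  The canonical presentation of an algebra \<open>P\<close> with carrier \<open>A\<close>. Of the two Kleisli arrows \<open>T A \<rightarrow> A\<close>,
  \<open>rel1\<close> evaluates a term in \<open>P\<close> and regards the result as a variable, while \<open>rel2\<close> leaves it as it is;
  in the quotient of \<open>F A\<close> a term becomes equal to its value.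
\<close>

definition rel1 :: "'u set \<times> 'u set_arrow \<Rightarrow> ('u set, 'u set_arrow) arrow" where
  "rel1 P = kar (TT (car P)) (\<lambda>t. eta (car P) (str P t)) (car P)"

definition rel2 :: "'u set \<times> 'u set_arrow \<Rightarrow> ('u set, 'u set_arrow) arrow" where
  "rel2 P = kar (TT (car P)) (\<lambda>t. t) (car P)"

definition quot :: "'u set \<times> 'u set_arrow \<Rightarrow> ('u set \<times> 'u set_arrow, 'u set_arrow) arrow" where
  "quot P = aar (Fr (car P)) (str P) P"

lemma rel_in_hom:
  assumes "is_alg P"
  shows "rel1 P \<in> hom K (TT (car P)) (car P)" "rel2 P \<in> hom K (TT (car P)) (car P)"
  using is_algD(1,2)[OF assms] eta_fn(2)[of "car P"]
  by (simp_all add: rel1_def rel2_def kar_in_hom Pi_iff)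

lemma is_alghom_str: "is_alg P \<Longrightarrow> is_alghom (Fr (car P)) P (str P)"
  using is_alghom_ev_Fr[of P "car P" "\<lambda>x. x"] is_algD(1)[of P]
  by (auto simp: ev_id intro: is_alghom_cong)

text \<open>
  If a homomorphism \<open>h\<close> on \<open>F A\<close> coequalizes the pair, then it takes the same value on a term and on
  the variable named by the value of the term. Its restriction to variables is therefore a
  homomorphism on \<open>P\<close>, and \<open>h\<close> factors through it.
\<close>

lemma coequalizer_presentation:
  assumes P: "is_alg P"
  shows "is_coequalizer (Alg T) (Fr (TT (car P))) (Fr (car P)) (amap FrF (rel1 P)) (amap FrF (rel2 P))
    P (quot P)"
proof -
  let ?A = "car P"
  note A [simp] = is_algD(1)[OF P]
  note str = is_alghom_str[OF P]
  have e: "eta ?A \<in> ?A \<rightarrow> TT ?A" by (rule eta_fn) simp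
  have f1: "(\<lambda>t. eta ?A (str P t)) \<in> TT ?A \<rightarrow> TT ?A" and f2: "(\<lambda>t. t) \<in> TT ?A \<rightarrow> TT ?A"
    using is_algD(2)[OF P] by (simp_all add: Pi_iff)
  have comp: "aar (Fr ?A) h Q \<cdot>\<^bsub>Alg T\<^esub> amap FrF (rel1 P) = aar (Fr (TT ?A)) (ev Q (TT ?A) (\<lambda>t. h (eta ?A (str P t)))) Q"
    "aar (Fr ?A) h Q \<cdot>\<^bsub>Alg T\<^esub> amap FrF (rel2 P) = aar (Fr (TT ?A)) (ev Q (TT ?A) h) Q"
    if h: "is_alghom (Fr ?A) Q h" for h Q
    using is_alghomD(3)[OF is_alghom_bind[OF _ _ f1]] is_alghomD(3)[OF is_alghom_bind[OF _ _ f2]]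
      alghom_bind[OF h _ _ f1] alghom_bind[OF h _ _ f2]
    by (simp_all add: rel1_def rel2_def FrF_kar aar_comp aar_eq_iff)
  \<comment> \<open>Apply both composites to the variable \<open>t\<close>.\<close>
  have key: "h t = h (eta ?A (str P t))" if h: "is_alghom (Fr ?A) Q h"
    and eq: "aar (Fr ?A) h Q \<cdot>\<^bsub>Alg T\<^esub> amap FrF (rel1 P) = aar (Fr ?A) h Q \<cdot>\<^bsub>Alg T\<^esub> amap FrF (rel2 P)"
    and t: "t \<in> TT ?A" for h Q t
  proof -
    have "h \<in> TT ?A \<rightarrow> car Q" "(\<lambda>t. h (eta ?A (str P t))) \<in> TT ?A \<rightarrow> car Q"
      using is_alghomD(3)[OF h] f1 by (simp_all add: Pi_iff)
    note ev = ev_eta[OF is_alghomD(2)[OF h] _ this(1) t] ev_eta[OF is_alghomD(2)[OF h] _ this(2) t]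
    have "ev Q (TT ?A) h (eta (TT ?A) t) = ev Q (TT ?A) (\<lambda>t. h (eta ?A (str P t))) (eta (TT ?A) t)"
      using eq t by (simp add: comp[OF h] aar_eq_iff)
    then show ?thesis using ev by simp
  qed
  have "str P (eta ?A (str P t)) = str P t" if "t \<in> TT ?A" for t
    using is_algD(2,3)[OF P] that by (simp add: Pi_iff)
  then have "quot P \<cdot>\<^bsub>Alg T\<^esub> amap FrF (rel1 P) = quot P \<cdot>\<^bsub>Alg T\<^esub> amap FrF (rel2 P)"
    using ev_cong[of "TT ?A" "\<lambda>t. str P (eta ?A (str P t))" "str P"]
    by (simp add: quot_def comp[OF str] aar_eq_iff)
  moreover have "\<exists>!h. h \<in> hom (Alg T) P Q \<and> h \<cdot>\<^bsub>Alg T\<^esub> quot P = k"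
    if k: "k \<in> hom (Alg T) (Fr ?A) Q"
      and eq: "k \<cdot>\<^bsub>Alg T\<^esub> amap FrF (rel1 P) = k \<cdot>\<^bsub>Alg T\<^esub> amap FrF (rel2 P)" for Q k
  proof -
    obtain k0 where k0: "k = aar (Fr ?A) k0 Q" "is_alghom (Fr ?A) Q k0" using k by (rule hom_AlgE)
    note key' = key[OF k0(2) eq[unfolded k0(1)]]
    let ?h = "\<lambda>x. k0 (eta ?A x)"
    have h: "?h \<in> ?A \<rightarrow> car Q" using is_alghomD(3)[OF k0(2)] by (simp add: Pi_iff)
    have hom: "is_alghom P Q ?h"
      unfolding is_alghom_def
      using P is_alghomD(2)[OF k0(2)] h key'[symmetric] alghom_Fr_eq_ev[OF k0(2)] by simp
    have comp_quot: "aar P h Q \<cdot>\<^bsub>Alg T\<^esub> quot P = k \<longleftrightarrow> (\<forall>t\<in>TT ?A. h (str P t) = k0 t)" for h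
      using is_alghomD(3)[OF str] by (simp add: quot_def k0(1) aar_comp aar_eq_iff)
    show ?thesis
    proof (rule ex1I[of _ "aar P ?h Q"])
      show "aar P ?h Q \<in> hom (Alg T) P Q \<and> aar P ?h Q \<cdot>\<^bsub>Alg T\<^esub> quot P = k"
        using hom key'[symmetric] by (simp add: aar_in_hom comp_quot)
      fix h assume h: "h \<in> hom (Alg T) P Q \<and> h \<cdot>\<^bsub>Alg T\<^esub> quot P = k"
      then obtain h0 where h0: "h = aar P h0 Q" by (meson hom_AlgE)
      have "h0 x = k0 (eta ?A x)" if "x \<in> ?A" for x
      proof -
        have "h0 (str P (eta ?A x)) = k0 (eta ?A x)"
          using h comp_quot[of h0] that by (simp add: h0)
        then show ?thesis using is_algD(3)[OF P that] by simp
      qed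
      then show "h = aar P ?h Q" by (simp add: h0 aar_eq_iff)
    qed
  qed
  ultimately show ?thesis
    using FF.amap_hom[OF rel_in_hom(1)[OF P]] FF.amap_hom[OF rel_in_hom(2)[OF P]] str
    by (simp add: is_coequalizer_def) (simp add: quot_def aar_in_hom)
qed

section \<open>Colimits of algebras\<close>

text \<open>
  Identifying two terms over the disjoint union \<open>S\<close> when all homomorphisms induced by cocones agree on
  them gives a congruence without generating one: a homomorphism commutes with evaluation, so terms
  that are built from identified terms are identified again.
\<close>

lemma cocomplete_Alg: "cocomplete TYPE('u) (Alg T)"
  unfolding cocomplete_def
proof (intro conjI allI impI category_Alg)
  fix J :: "('u, 'u) cat" and D
  assume "small_category TYPE('u) J \<and> is_functor J (Alg T) D"
  then have J: "sm (Obj J)" and "is_functor J (Alg T) D" by (auto simp: small_category_def)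
  interpret D: is_functor J "Alg T" D by fact
  let ?X = "\<lambda>j. car (omap D j)"
  define S where "S = disjoint_union (Obj J) ?X"
  have D_alg: "is_alg (omap D j)" if "j \<in> Obj J" for j using D.omap_Obj[OF that] .
  have X [simp]: "sm (?X j)" if "j \<in> Obj J" for j using is_algD(1)[OF D_alg[OF that]] .
  have S [simp]: "sm S" unfolding S_def using small_disjoint_union[OF J X] .
  have "\<forall>u\<in>Arr J. \<exists>d. amap D u = aar (omap D (Dom J u)) d (omap D (Cod J u)) \<and>
      is_alghom (omap D (Dom J u)) (omap D (Cod J u)) d"
  proof
    fix u assume "u \<in> Arr J"
    then have "amap D u \<in> hom (Alg T) (omap D (Dom J u)) (omap D (Cod J u))"
      by (intro D.amap_hom homI refl)
    then show "\<exists>d. amap D u = aar (omap D (Dom J u)) d (omap D (Cod J u)) \<and>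
      is_alghom (omap D (Dom J u)) (omap D (Cod J u)) d"
      by (meson hom_AlgE)
  qed
  then obtain d where Du: "\<And>u. u \<in> Arr J \<Longrightarrow> amap D u = aar (omap D (Dom J u)) (d u) (omap D (Cod J u))"
    and d: "\<And>u. u \<in> Arr J \<Longrightarrow> is_alghom (omap D (Dom J u)) (omap D (Cod J u)) (d u)"
    by metis
  define gen where "gen j x = eta S (pair_code (j, x))" for j x
  have gen: "gen j \<in> ?X j \<rightarrow> TT S" if "j \<in> Obj J" for j
    using pair_code_in[OF that, of _ ?X] by (simp add: gen_def flip: S_def)
  \<comment> \<open>The homomorphisms out of the free algebra on \<open>S\<close> that are induced by a cocone with vertex \<open>Q\<close>.\<close>
  define compat where "compat Q h \<longleftrightarrow> is_alghom (Fr S) Q h \<and>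
    (\<forall>j\<in>Obj J. is_alghom (omap D j) Q (\<lambda>x. h (gen j x))) \<and>
    (\<forall>u\<in>Arr J. \<forall>x\<in>?X (Dom J u). h (gen (Cod J u) (d u x)) = h (gen (Dom J u) x))" for Q h
  define rel where "rel s t \<longleftrightarrow> t \<in> TT S \<and> (\<forall>Q h. compat Q h \<longrightarrow> h s = h t)" for s t
  \<comment> \<open>On \<open>TT S\<close>, \<open>rel\<close> is an equivalence relation, and \<open>q\<close> chooses one representative of each class.\<close>
  define q where "q s = (SOME t. rel s t)" for s
  have rel_q: "rel s (q s)" if "s \<in> TT S" for s
    unfolding q_def by (rule someI[of _ s]) (simp add: rel_def that)
  have q_in: "q s \<in> TT S" if "s \<in> TT S" for s using rel_q[OF that] by (simp add: rel_def)
  have h_q: "h (q s) = h s" if "compat Q h" "s \<in> TT S" for Q h s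
    using rel_q[OF that(2)] that(1) unfolding rel_def by metis
  have q_eqI: "q s = q t" if "\<And>Q h. compat Q h \<Longrightarrow> h s = h t" for s t
  proof -
    have "rel s x = rel t x" for x unfolding rel_def using that by metis
    then have "rel s = rel t" by blast
    then show ?thesis by (simp add: q_def)
  qed
  have q_q: "q (q s) = q s" if "s \<in> TT S" for s
    using h_q that by (intro q_eqI)
  define A where "A = q ` TT S"
  have A_TT: "A \<subseteq> TT S" using q_in by (auto simp: A_def)
  have A [simp]: "sm A" unfolding A_def by (intro small_image small_TT S)
  have q_A: "q a = a" if "a \<in> A" for a using that q_q by (auto simp: A_def)
  have id_A: "(\<lambda>s. s) \<in> A \<rightarrow> TT S" using A_TT by auto
  define \<beta> where "\<beta> = bind A (\<lambda>s. s) S"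
  have \<beta>: "\<beta> \<in> TT A \<rightarrow> TT S" unfolding \<beta>_def using id_A by (auto intro: bind_in)
  define L where "L = mkalg A (\<lambda>t. q (\<beta> t))"
  have car_L [simp]: "car L = A" by (simp add: L_def)
  have h_bind: "h (bind Y f S t) = ev Q Y (\<lambda>y. h (f y)) t"
    if "compat Q h" "sm Y" "f \<in> Y \<rightarrow> TT S" "t \<in> TT Y" for Q h Y f t
    using that by (intro alghom_bind) (auto simp: compat_def)
  \<comment> \<open>Terms over \<open>L\<close> may be evaluated in the free algebra, taking a representative only at the end.\<close>
  have key: "ev L Y (\<lambda>y. q (f y)) t = q (bind Y f S t)"
    if Y: "sm Y" and f: "f \<in> Y \<rightarrow> TT S" and t: "t \<in> TT Y" for Y f t
  proof -
    have qf: "(\<lambda>y. q (f y)) \<in> Y \<rightarrow> A" using f by (auto simp: A_def)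
    have qf': "(\<lambda>y. q (f y)) \<in> Y \<rightarrow> TT S" using qf A_TT by blast
    have e: "(\<lambda>y. eta A (q (f y))) \<in> Y \<rightarrow> TT A" using qf by (simp add: Pi_iff)
    have "ev L Y (\<lambda>y. q (f y)) t = q (\<beta> (tmap Y (\<lambda>y. q (f y)) A t))"
      using tmap_in[OF Y A qf t] by (simp add: ev_def) (simp add: L_def str_mkalg)
    also have "\<beta> (tmap Y (\<lambda>y. q (f y)) A t) = bind Y (\<lambda>y. \<beta> (eta A (q (f y)))) S t"
      using Y t e id_A by (simp add: tmap_eq_bind[OF Y A qf t] \<beta>_def bind_bind)
    also have "\<dots> = bind Y (\<lambda>y. q (f y)) S t"
    proof (rule bind_cong)
      fix y assume "y \<in> Y"
      then have "q (f y) \<in> A" using qf by auto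
      then show "\<beta> (eta A (q (f y))) = q (f y)"
        unfolding \<beta>_def by (simp add: bind_eta[OF A S id_A])
    qed
    also have "q \<dots> = q (bind Y f S t)"
    proof (rule q_eqI)
      fix Q h assume h: "compat Q h"
      have "ev Q Y (\<lambda>y. h (q (f y))) t = ev Q Y (\<lambda>y. h (f y)) t"
        using f by (intro ev_cong) (simp add: h_q[OF h] Pi_iff)
      then show "h (bind Y (\<lambda>y. q (f y)) S t) = h (bind Y f S t)"
        by (simp add: h_bind[OF h Y qf' t] h_bind[OF h Y f t])
    qed
    finally show ?thesis .
  qed
  have L: "is_alg L"
    unfolding L_def is_alg_mkalg_iff
  proof (intro conjI ballI A)
    show qb: "(\<lambda>t. q (\<beta> t)) \<in> TT A \<rightarrow> A" using \<beta> by (auto simp: A_def)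
    show "q (\<beta> (eta A x)) = x" if "x \<in> A" for x
      using that by (simp add: \<beta>_def bind_eta[OF A S id_A] q_A)
    fix t assume t: "t \<in> TT (TT A)"
    have "q (\<beta> (tmap (TT A) (\<lambda>t. q (\<beta> t)) A t)) = ev L (TT A) (\<lambda>t. q (\<beta> t)) t"
      using tmap_in[OF _ A qb t] by (simp add: ev_def) (simp add: L_def str_mkalg)
    also have "\<dots> = q (bind (TT A) \<beta> S t)"
      using key[OF _ \<beta> t] by simp
    also have "bind (TT A) \<beta> S t = \<beta> (mu A t)"
      using t id_A unfolding \<beta>_def by (simp add: mu_eq_bind bind_bind)
    finally show "q (\<beta> (tmap (TT A) (\<lambda>t. q (\<beta> t)) A t)) = q (\<beta> (mu A t))" .
  qed
  have str_L: "str L t = q (\<beta> t)" if "t \<in> TT A" for t using that by (simp add: L_def str_mkalg)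
  have q_hom: "is_alghom (Fr S) L q"
    unfolding is_alghom_def
  proof (intro conjI ballI L is_alg_Fr S)
    show "q \<in> car (Fr S) \<rightarrow> car L" by (auto simp: A_def)
    show "q (str (Fr S) t) = ev L (car (Fr S)) q t" if "t \<in> TT (car (Fr S))" for t
      using that key[of "TT S" "\<lambda>s. s" t] by (simp add: str_Fr mu_eq_bind)
  qed
  have ex_compat: "compat L q"
    unfolding compat_def
  proof (intro conjI ballI q_hom)
    show "is_alghom (omap D j) L (\<lambda>x. q (gen j x))" if j: "j \<in> Obj J" for j
      unfolding is_alghom_def
    proof (intro conjI ballI L D_alg j)
      show "(\<lambda>x. q (gen j x)) \<in> ?X j \<rightarrow> car L" using gen[OF j] by (auto simp: A_def)
      fix t assume t: "t \<in> TT (?X j)"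
      have "q (gen j (str (omap D j) t)) = q (bind (?X j) (gen j) S t)"
      proof (rule q_eqI)
        fix Q h assume h: "compat Q h"
        then have "is_alghom (omap D j) Q (\<lambda>x. h (gen j x))" using j by (simp add: compat_def)
        from is_alghomD(4)[OF this t]
        show "h (gen j (str (omap D j) t)) = h (bind (?X j) (gen j) S t)"
          using h_bind[OF h X[OF j] gen[OF j] t] by simp
      qed
      then show "q (gen j (str (omap D j) t)) = ev L (?X j) (\<lambda>x. q (gen j x)) t"
        using key[OF X[OF j] gen[OF j] t] by simp
    qed
    show "q (gen (Cod J u) (d u x)) = q (gen (Dom J u) x)" if "u \<in> Arr J" "x \<in> ?X (Dom J u)" for u x
      using that by (intro q_eqI) (simp add: compat_def)
  qed
  define \<iota> where "\<iota> j = aar (omap D j) (\<lambda>x. q (gen j x)) L" for j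
  have \<iota>: "\<iota> j \<in> hom (Alg T) (omap D j) L" if "j \<in> Obj J" for j
    using ex_compat that by (simp add: \<iota>_def aar_in_hom compat_def)
  have comp_D: "aar (omap D (Cod J u)) f Q \<cdot>\<^bsub>Alg T\<^esub> amap D u = aar (omap D (Dom J u)) (\<lambda>x. f (d u x)) Q"
    if "u \<in> Arr J" for u f Q
    using is_alghomD(3)[OF d[OF that]] by (simp add: Du[OF that] aar_comp)
  have "is_cocone J (Alg T) D L \<iota>"
    unfolding is_cocone_def
  proof (intro conjI ballI D.is_functor_axioms L \<iota>)
    show "\<iota> (Cod J u) \<cdot>\<^bsub>Alg T\<^esub> amap D u = \<iota> (Dom J u)" if "u \<in> Arr J" for u
      using ex_compat that unfolding \<iota>_def comp_D[OF that] by (simp add: compat_def aar_eq_iff)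
  qed
  moreover have "\<exists>!m. m \<in> hom (Alg T) L Q \<and> (\<forall>j\<in>Obj J. m \<cdot>\<^bsub>Alg T\<^esub> \<iota> j = \<kappa> j)"
    if cc: "is_cocone J (Alg T) D Q \<kappa>" for Q \<kappa>
  proof -
    have Q: "is_alg Q" and "\<forall>j\<in>Obj J. \<exists>k. \<kappa> j = aar (omap D j) k Q \<and> is_alghom (omap D j) Q k"
      using cc unfolding is_cocone_def by (blast, meson hom_AlgE)
    then obtain k where \<kappa>: "\<And>j. j \<in> Obj J \<Longrightarrow> \<kappa> j = aar (omap D j) (k j) Q"
      and k: "\<And>j. j \<in> Obj J \<Longrightarrow> is_alghom (omap D j) Q (k j)"
      by metis
    have k_d: "k (Cod J u) (d u x) = k (Dom J u) x" if u: "u \<in> Arr J" and x: "x \<in> ?X (Dom J u)" for u x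
    proof -
      have "\<kappa> (Cod J u) \<cdot>\<^bsub>Alg T\<^esub> amap D u = \<kappa> (Dom J u)" using cc u by (simp add: is_cocone_def)
      then show ?thesis
        using x by (simp add: \<kappa> D.A.Cod_Obj D.A.Dom_Obj u comp_D aar_eq_iff)
    qed
    obtain g where g: "g \<in> S \<rightarrow> car Q" "\<And>j x. g (pair_code (j, x)) = k j x"
      unfolding S_def using disjoint_union_copair[of "Obj J" k ?X "car Q"] is_alghomD(3)[OF k] by blast
    define h where "h = ev Q S g"
    have h_hom: "is_alghom (Fr S) Q h" unfolding h_def using Q S g(1) by (rule is_alghom_ev_Fr)
    have h_gen: "h (gen j x) = k j x" if "j \<in> Obj J" "x \<in> ?X j" for j x
      using ev_eta[OF Q S g(1), of "pair_code (j, x)"] that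
      by (simp add: h_def gen_def g(2) S_def pair_code_in)
    have h: "compat Q h"
      unfolding compat_def
    proof (intro conjI ballI h_hom)
      show "is_alghom (omap D j) Q (\<lambda>x. h (gen j x))" if "j \<in> Obj J" for j
        using k[OF that] by (rule is_alghom_cong) (simp add: h_gen that)
      show "h (gen (Cod J u) (d u x)) = h (gen (Dom J u) x)" if u: "u \<in> Arr J" and x: "x \<in> ?X (Dom J u)" for u x
        using is_alghomD(3)[OF d[OF u]] x k_d[OF u x] u
        by (simp add: h_gen D.A.Cod_Obj D.A.Dom_Obj Pi_iff)
    qed
    have m_hom: "is_alghom L Q h"
      unfolding is_alghom_def
    proof (intro conjI ballI L Q)
      show "h \<in> car L \<rightarrow> car Q" using is_alghomD(3)[OF h_hom] A_TT by auto
      fix t assume "t \<in> TT (car L)"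
      then have t: "t \<in> TT A" by simp
      have "h (str L t) = h (\<beta> t)" using h_q[OF h, of "\<beta> t"] \<beta> t by (auto simp: str_L)
      also have "\<dots> = ev Q A h t" unfolding \<beta>_def by (rule h_bind[OF h A id_A t])
      finally show "h (str L t) = ev Q (car L) h t" by simp
    qed
    have comp_\<iota>: "aar L m Q \<cdot>\<^bsub>Alg T\<^esub> \<iota> j = \<kappa> j \<longleftrightarrow> (\<forall>x\<in>?X j. m (q (gen j x)) = k j x)"
      if j: "j \<in> Obj J" for j m
      using gen[OF j] by (subst \<iota>_def, subst aar_comp) (auto simp: A_def \<kappa>[OF j] aar_eq_iff)
    show ?thesis
    proof (rule ex1I[of _ "aar L h Q"])
      have "h (q (gen j x)) = k j x" if "j \<in> Obj J" "x \<in> ?X j" for j x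
        using h_q[OF h, of "gen j x"] h_gen[OF that] gen[OF that(1)] that(2) by auto
      then show "aar L h Q \<in> hom (Alg T) L Q \<and> (\<forall>j\<in>Obj J. aar L h Q \<cdot>\<^bsub>Alg T\<^esub> \<iota> j = \<kappa> j)"
        using m_hom by (simp add: aar_in_hom comp_\<iota>)
      fix m assume m: "m \<in> hom (Alg T) L Q \<and> (\<forall>j\<in>Obj J. m \<cdot>\<^bsub>Alg T\<^esub> \<iota> j = \<kappa> j)"
      then obtain m0 where m0: "m = aar L m0 Q" "is_alghom L Q m0" by (meson hom_AlgE)
      have mq: "is_alghom (Fr S) Q (\<lambda>s. m0 (q s))" by (rule is_alghom_comp[OF q_hom m0(2)])
      have "m0 (q (eta S s)) = g s" if "s \<in> S" for s
      proof -
        obtain j x where s: "s = pair_code (j, x)" "j \<in> Obj J" "x \<in> ?X j"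
          using \<open>s \<in> S\<close> by (auto simp: S_def disjoint_union_def)
        then show ?thesis using m comp_\<iota>[of j m0] by (simp add: m0(1) g(2) gen_def)
      qed
      then have "m0 (q t) = h t" if "t \<in> TT S" for t
        using alghom_Fr_eq_ev[OF mq S that] ev_cong[of S "\<lambda>s. m0 (q (eta S s))" g] by (simp add: h_def)
      then have "m0 a = h a" if "a \<in> A" for a
        using q_A[OF that] A_TT that by (metis subsetD)
      then show "m = aar L h Q" by (simp add: m0(1) aar_eq_iff)
    qed
  qed
  ultimately show "\<exists>X \<iota>. is_colimit J (Alg T) D X \<iota>"
    unfolding is_colimit_def by blast
qed

end

section \<open>The functor of a coalgebra\<close>

locale coalgebra = monad_on_sets T + W: is_functor "kleisli_cat set_cat T" C W
  for T :: "'u::universe set_monad" and C :: "('o, 'a) cat" and W +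
  assumes loc_small: "locally_small TYPE('u) C"
    and cocompl: "cocomplete TYPE('u) C"
    and W_coproducts: "preserves_products TYPE('u) (op_cat (kleisli_cat set_cat T)) (op_cat C) W"
begin

text \<open>
  The only property of the element of \<open>pt\<close> is that it is the only one.
\<close>

definition pt :: "'u set" where "pt = {undefined}"

text \<open>
  A term \<open>t\<close> over \<open>X\<close>, as a Kleisli arrow from the point to \<open>X\<close>.
\<close>

definition elt :: "'u \<Rightarrow> 'u set \<Rightarrow> ('u set, 'u set_arrow) arrow" where
  "elt t X = kar pt (\<lambda>_. t) X"

lemma small_pt: "sm pt"
  by (simp add: pt_def small_finite)

lemma elt_in_hom: "sm X \<Longrightarrow> t \<in> TT X \<Longrightarrow> elt t X \<in> hom K pt X"
  by (simp add: elt_def kar_in_hom small_pt)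

lemma kar_elt:
  "sm X \<Longrightarrow> sm Y \<Longrightarrow> f \<in> X \<rightarrow> TT Y \<Longrightarrow> t \<in> TT X \<Longrightarrow> kar X f Y \<cdot>\<^bsub>K\<^esub> elt t X = elt (bind X f Y t) Y"
  by (simp add: elt_def kar_comp small_pt)

lemma W_kar: "sm X \<Longrightarrow> sm Y \<Longrightarrow> f \<in> X \<rightarrow> TT Y \<Longrightarrow> amap W (kar X f Y) \<in> hom C (omap W X) (omap W Y)"
  by (intro W.amap_hom) (simp add: kar_in_hom)

lemma W_elt: "sm X \<Longrightarrow> t \<in> TT X \<Longrightarrow> amap W (elt t X) \<in> hom C (omap W pt) (omap W X)"
  by (intro W.amap_hom elt_in_hom)

lemma comp_kar_elt:
  assumes "sm X" "sm Y" "f \<in> X \<rightarrow> TT Y" "t \<in> TT X" "g \<in> hom C (omap W Y) Z"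
  shows "(g \<cdot>\<^bsub>C\<^esub> amap W (kar X f Y)) \<cdot>\<^bsub>C\<^esub> amap W (elt t X) = g \<cdot>\<^bsub>C\<^esub> amap W (elt (bind X f Y t) Y)"
proof -
  have k: "kar X f Y \<in> hom K X Y" and e: "elt t X \<in> hom K pt X"
    using assms by (simp_all add: kar_in_hom elt_in_hom)
  show ?thesis
    using W.B.Comp_assoc[OF W.amap_hom[OF e] W.amap_hom[OF k] assms(5)] W.amap_Comp[OF e k] assms
    by (simp add: kar_elt)
qed

text \<open>
  A function on \<open>X\<close> is the family of its values.
\<close>

lemma coproduct_of_points:
  assumes X: "sm X"
  shows "is_product (op_cat K) X (\<lambda>_. pt) X (\<lambda>x. elt (eta X x) X)"
  unfolding is_product_op_cat
proof (intro conjI ballI allI impI)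
  show "pt \<in> Obj K" "X \<in> Obj K" using X by (simp_all add: K_simps small_pt)
  show "elt (eta X x) X \<in> hom K pt X" if "x \<in> X" for x
    using X that by (simp add: elt_in_hom)
  fix Y q assume "Y \<in> Obj K \<and> (\<forall>x\<in>X. q x \<in> hom K pt Y)"
  then have Y: "sm Y" and q: "\<And>x. x \<in> X \<Longrightarrow> q x \<in> hom K pt Y" by (auto simp: K_simps)
  have "\<forall>x\<in>X. \<exists>t. t \<in> TT Y \<and> q x = elt t Y"
  proof
    fix x assume "x \<in> X"
    from q[OF this] obtain f where f: "q x = kar pt f Y" "f \<in> pt \<rightarrow> TT Y" by (rule hom_KE)
    then have "f undefined \<in> TT Y" "q x = elt (f undefined) Y"
      by (auto simp: elt_def kar_eq_iff pt_def)
    then show "\<exists>t. t \<in> TT Y \<and> q x = elt t Y" by blast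
  qed
  then obtain f where f: "\<And>x. x \<in> X \<Longrightarrow> f x \<in> TT Y" "\<And>x. x \<in> X \<Longrightarrow> q x = elt (f x) Y"
    by metis
  have elt_eq: "elt s Y = elt t Y \<longleftrightarrow> s = t" for s t by (simp add: elt_def kar_eq_iff pt_def)
  have comp: "kar X g Y \<cdot>\<^bsub>K\<^esub> elt (eta X x) X = elt (g x) Y" if "g \<in> X \<rightarrow> TT Y" "x \<in> X" for g x
    using kar_elt[OF X Y that(1), of "eta X x"] bind_eta[OF X Y that] X that(2) by simp
  show "\<exists>!h. h \<in> hom K X Y \<and> (\<forall>x\<in>X. h \<cdot>\<^bsub>K\<^esub> elt (eta X x) X = q x)"
  proof (rule ex1I[of _ "kar X f Y"])
    have fX: "f \<in> X \<rightarrow> TT Y" using f(1) by auto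
    then show "kar X f Y \<in> hom K X Y \<and> (\<forall>x\<in>X. kar X f Y \<cdot>\<^bsub>K\<^esub> elt (eta X x) X = q x)"
      using X Y comp[OF fX] f(2) by (simp add: kar_in_hom)
    fix h assume h: "h \<in> hom K X Y \<and> (\<forall>x\<in>X. h \<cdot>\<^bsub>K\<^esub> elt (eta X x) X = q x)"
    from h obtain g where g: "h = kar X g Y" "g \<in> X \<rightarrow> TT Y" by (elim conjE hom_KE)
    then show "h = kar X f Y"
      using h comp[OF g(2)] f(2) by (simp add: kar_eq_iff elt_eq)
  qed
qed

lemma coproduct_of_W_points:
  assumes X: "sm X"
  shows "is_product (op_cat C) X (\<lambda>_. omap W pt) (omap W X) (\<lambda>x. amap W (elt (eta X x) X))"
  using W_coproducts X coproduct_of_points[OF X] unfolding preserves_products_def by blast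

subsection \<open>The algebra of maps from the value at a point\<close>

text \<open>
  By local smallness, the arrows from the value of \<open>W\<close> at the point to \<open>Z\<close> can be named by elements of
  the universe; \<open>Hpt Z\<close> is the small set of these names.
\<close>

definition enc :: "'o \<Rightarrow> 'a \<Rightarrow> 'u" where
  "enc Z = (SOME e. inj_on e (hom C (omap W pt) Z))"

definition Hpt :: "'o \<Rightarrow> 'u set" where
  "Hpt Z = enc Z ` hom C (omap W pt) Z"

text \<open>
  The transpose of \<open>g : W X \<rightarrow> Z\<close>: the function \<open>X \<rightarrow> Hpt Z\<close> of its components, \<open>W X\<close> being a coproduct of
  copies of the value of \<open>W\<close> at the point. It is a bijection by \<open>trans_inj\<close> and \<open>trans_surj\<close>.
\<close>

definition trans :: "'u set \<Rightarrow> 'o \<Rightarrow> 'a \<Rightarrow> 'u \<Rightarrow> 'u" where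
  "trans X Z g x = enc Z (g \<cdot>\<^bsub>C\<^esub> amap W (elt (eta X x) X))"

lemma W_pt_Obj: "omap W pt \<in> Obj C"
  using W.omap_Obj[of pt] small_pt by (simp add: K_simps)

lemma enc_inj:
  assumes "Z \<in> Obj C"
  shows "inj_on (enc Z) (hom C (omap W pt) Z)"
proof -
  have "small TYPE('u) (hom C (omap W pt) Z)"
    using loc_small W_pt_Obj assms by (simp add: locally_small_def)
  then have "hom C (omap W pt) Z \<lesssim> (UNIV :: 'u set)"
    by (simp add: small_def lesspoll_def)
  then have "\<exists>e :: 'a \<Rightarrow> 'u. inj_on e (hom C (omap W pt) Z)"
    by (auto simp: lepoll_def)
  then show ?thesis unfolding enc_def by (rule someI_ex)
qed

lemma small_Hpt: "Z \<in> Obj C \<Longrightarrow> sm (Hpt Z)"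
  unfolding Hpt_def using loc_small W_pt_Obj by (intro small_image) (simp add: locally_small_def)

lemma enc_in: "f \<in> hom C (omap W pt) Z \<Longrightarrow> enc Z f \<in> Hpt Z"
  by (simp add: Hpt_def)

lemma comp_elt: "sm X \<Longrightarrow> g \<in> hom C (omap W X) Z \<Longrightarrow> t \<in> TT X \<Longrightarrow>
    g \<cdot>\<^bsub>C\<^esub> amap W (elt t X) \<in> hom C (omap W pt) Z"
  by (rule W.B.Comp_hom[OF W_elt])

lemma trans_in: "sm X \<Longrightarrow> g \<in> hom C (omap W X) Z \<Longrightarrow> trans X Z g \<in> X \<rightarrow> Hpt Z"
  by (auto simp: trans_def intro!: enc_in comp_elt)

lemma trans_inj:
  assumes X: "sm X" and g: "g \<in> hom C (omap W X) Z" "g' \<in> hom C (omap W X) Z"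
    and eq: "\<And>x. x \<in> X \<Longrightarrow> trans X Z g x = trans X Z g' x"
  shows "g = g'"
proof -
  have Z: "Z \<in> Obj C" using W.B.hom_ObjD[OF g(1)] by simp
  let ?q = "\<lambda>x. g \<cdot>\<^bsub>C\<^esub> amap W (elt (eta X x) X)"
  have q: "?q x \<in> hom C (omap W pt) Z" if "x \<in> X" for x using comp_elt[OF X g(1)] X that by simp
  have eq': "g' \<cdot>\<^bsub>C\<^esub> amap W (elt (eta X x) X) = ?q x" if "x \<in> X" for x
    using inj_onD[OF enc_inj[OF Z] eq[OF that, unfolded trans_def]] comp_elt[OF X g(1)] comp_elt[OF X g(2)] X that
    by simp
  have "\<exists>!h. h \<in> hom C (omap W X) Z \<and> (\<forall>x\<in>X. h \<cdot>\<^bsub>C\<^esub> amap W (elt (eta X x) X) = ?q x)"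
    using coproduct_of_W_points[OF X] Z q by (simp add: is_product_op_cat)
  then obtain m where m: "\<And>h. h \<in> hom C (omap W X) Z \<Longrightarrow>
      \<forall>x\<in>X. h \<cdot>\<^bsub>C\<^esub> amap W (elt (eta X x) X) = ?q x \<Longrightarrow> h = m"
    by (elim ex1E) blast
  have "g = m" using g(1) by (intro m) simp_all
  moreover have "g' = m" using g(2) eq' by (intro m) simp_all
  ultimately show ?thesis by simp
qed

lemma trans_surj:
  assumes X: "sm X" and Z: "Z \<in> Obj C" and \<phi>: "\<phi> \<in> X \<rightarrow> Hpt Z"
  obtains g where "g \<in> hom C (omap W X) Z" "\<And>x. x \<in> X \<Longrightarrow> trans X Z g x = \<phi> x"
proof -
  have "\<forall>x\<in>X. \<exists>f. f \<in> hom C (omap W pt) Z \<and> enc Z f = \<phi> x"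
    using \<phi> by (auto simp: Hpt_def Pi_iff image_iff) metis
  then obtain q where q: "\<And>x. x \<in> X \<Longrightarrow> q x \<in> hom C (omap W pt) Z" "\<And>x. x \<in> X \<Longrightarrow> enc Z (q x) = \<phi> x"
    by metis
  have "\<exists>!h. h \<in> hom C (omap W X) Z \<and> (\<forall>x\<in>X. h \<cdot>\<^bsub>C\<^esub> amap W (elt (eta X x) X) = q x)"
    using coproduct_of_W_points[OF X] Z q by (simp add: is_product_op_cat)
  then obtain h where "h \<in> hom C (omap W X) Z" "\<forall>x\<in>X. h \<cdot>\<^bsub>C\<^esub> amap W (elt (eta X x) X) = q x"
    by (elim ex1E) blast
  then show ?thesis using that[of h] q(2) by (simp add: trans_def)
qed

text \<open>
  The arrow whose transpose is the identity of \<open>Hpt Z\<close>, that is, the universal arrow from a copower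
  of \<open>W pt\<close> to \<open>Z\<close>. A term \<open>t\<close> over \<open>Hpt Z\<close> is then evaluated as the composite of \<open>univ Z\<close> with \<open>W\<close> of \<open>t\<close>.
\<close>

definition univ :: "'o \<Rightarrow> 'a" where
  "univ Z = (SOME g. g \<in> hom C (omap W (Hpt Z)) Z \<and> (\<forall>z\<in>Hpt Z. trans (Hpt Z) Z g z = z))"

definition op_str :: "'o \<Rightarrow> 'u \<Rightarrow> 'u" where
  "op_str Z t = enc Z (univ Z \<cdot>\<^bsub>C\<^esub> amap W (elt t (Hpt Z)))"

definition Halg :: "'o \<Rightarrow> 'u set \<times> 'u set_arrow" where
  "Halg Z = mkalg (Hpt Z) (op_str Z)"

lemma univ:
  assumes "Z \<in> Obj C"
  shows "univ Z \<in> hom C (omap W (Hpt Z)) Z" "z \<in> Hpt Z \<Longrightarrow> trans (Hpt Z) Z (univ Z) z = z"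
proof -
  have "\<exists>g. g \<in> hom C (omap W (Hpt Z)) Z \<and> (\<forall>z\<in>Hpt Z. trans (Hpt Z) Z g z = z)"
    by (rule trans_surj[OF small_Hpt[OF assms] assms, of "\<lambda>z. z"]) auto
  from someI_ex[OF this] show "univ Z \<in> hom C (omap W (Hpt Z)) Z" "z \<in> Hpt Z \<Longrightarrow> trans (Hpt Z) Z (univ Z) z = z"
    by (simp_all add: univ_def)
qed

lemma trans_comp_kar:
  assumes "sm X" "sm Y" "f \<in> X \<rightarrow> TT Y" "g \<in> hom C (omap W Y) Z" "x \<in> X"
  shows "trans X Z (g \<cdot>\<^bsub>C\<^esub> amap W (kar X f Y)) x = enc Z (g \<cdot>\<^bsub>C\<^esub> amap W (elt (f x) Y))"
  using assms comp_kar_elt[of X Y f "eta X x" g Z] by (simp add: trans_def bind_eta)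

lemma comp_kar_hom:
  "sm X \<Longrightarrow> sm Y \<Longrightarrow> f \<in> X \<rightarrow> TT Y \<Longrightarrow> g \<in> hom C (omap W Y) Z \<Longrightarrow>
    g \<cdot>\<^bsub>C\<^esub> amap W (kar X f Y) \<in> hom C (omap W X) Z"
  by (rule W.B.Comp_hom[OF W_kar])

text \<open>
  The arrow \<open>g\<close> is the composite of \<open>univ Z\<close> with \<open>W\<close> of the function \<open>trans Y Z g\<close>, so that \<open>t\<close> may be
  pushed forward to a term over \<open>Hpt Z\<close> before it is evaluated.
\<close>

lemma enc_comp_elt:
  assumes Y: "sm Y" and g: "g \<in> hom C (omap W Y) Z" and t: "t \<in> TT Y"
  shows "enc Z (g \<cdot>\<^bsub>C\<^esub> amap W (elt t Y)) = op_str Z (tmap Y (trans Y Z g) (Hpt Z) t)"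
proof -
  have Z: "Z \<in> Obj C" using W.B.hom_ObjD[OF g] by simp
  note N = small_Hpt[OF Z] and u = univ[OF Z] and tr = trans_in[OF Y g]
  let ?f = "\<lambda>y. eta (Hpt Z) (trans Y Z g y)"
  have f: "?f \<in> Y \<rightarrow> TT (Hpt Z)" using tr N by (simp add: Pi_iff)
  have "g = univ Z \<cdot>\<^bsub>C\<^esub> amap W (kar Y ?f (Hpt Z))"
  proof (rule trans_inj[OF Y g comp_kar_hom[OF Y N f u(1)]])
    fix y assume y: "y \<in> Y"
    then have "trans Y Z g y \<in> Hpt Z" using tr by auto
    then show "trans Y Z g y = trans Y Z (univ Z \<cdot>\<^bsub>C\<^esub> amap W (kar Y ?f (Hpt Z))) y"
      using u(2) trans_comp_kar[OF Y N f u(1) y] by (simp add: trans_def)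
  qed
  then have "g \<cdot>\<^bsub>C\<^esub> amap W (elt t Y) = univ Z \<cdot>\<^bsub>C\<^esub> amap W (elt (bind Y ?f (Hpt Z) t) (Hpt Z))"
    using comp_kar_elt[OF Y N f t u(1)] by simp
  then show ?thesis
    by (simp add: op_str_def tmap_eq_bind[OF Y N tr t])
qed

text \<open>
  For the associativity law, the composite \<open>g\<close> of \<open>univ Z\<close> with \<open>W\<close> of the identity Kleisli arrow
  \<open>TT (Hpt Z) \<rightarrow> Hpt Z\<close> has transpose \<open>op_str Z\<close>. Evaluating a nested term along \<open>g\<close> with \<open>enc_comp_elt\<close>
  applies \<open>op_str Z\<close> twice; composing in \<open>K\<close> first flattens the term.
\<close>

lemma is_alg_Halg:
  assumes Z: "Z \<in> Obj C"
  shows "is_alg (Halg Z)"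
  unfolding Halg_def is_alg_mkalg_iff
proof (intro conjI ballI)
  let ?N = "Hpt Z"
  note u = univ[OF Z]
  show N: "sm ?N" by (rule small_Hpt[OF Z])
  show str: "op_str Z \<in> TT ?N \<rightarrow> ?N"
    using comp_elt[OF N u(1)] by (auto simp: op_str_def intro!: enc_in)
  show "op_str Z (eta ?N z) = z" if "z \<in> ?N" for z
    using u(2)[OF that] by (simp add: op_str_def trans_def)
  fix s assume s: "s \<in> TT (TT ?N)"
  have id: "(\<lambda>t. t) \<in> TT ?N \<rightarrow> TT ?N" by simp
  let ?g = "univ Z \<cdot>\<^bsub>C\<^esub> amap W (kar (TT ?N) (\<lambda>t. t) ?N)"
  have g: "?g \<in> hom C (omap W (TT ?N)) Z" by (rule comp_kar_hom[OF small_TT[OF N] N id u(1)])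
  have "trans (TT ?N) Z ?g t = op_str Z t" if "t \<in> TT ?N" for t
    using trans_comp_kar[OF small_TT[OF N] N id u(1) that] by (simp add: op_str_def)
  then have "tmap (TT ?N) (trans (TT ?N) Z ?g) ?N = tmap (TT ?N) (op_str Z) ?N"
    by (rule tmap_cong)
  then have "op_str Z (tmap (TT ?N) (op_str Z) ?N s) = enc Z (?g \<cdot>\<^bsub>C\<^esub> amap W (elt s (TT ?N)))"
    using enc_comp_elt[OF small_TT[OF N] g s] by simp
  also have "\<dots> = op_str Z (mu ?N s)"
    using comp_kar_elt[OF small_TT[OF N] N id s u(1)] by (simp add: op_str_def mu_eq_bind[OF N s])
  finally show "op_str Z (tmap (TT ?N) (op_str Z) ?N s) = op_str Z (mu ?N s)" .
qed

lemma ev_Halg: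
  assumes "Z \<in> Obj C" "sm X" "f \<in> X \<rightarrow> Hpt Z" "t \<in> TT X"
  shows "ev (Halg Z) X f t = op_str Z (tmap X f (Hpt Z) t)"
  using tmap_in[OF assms(2) small_Hpt[OF assms(1)] assms(3,4)]
  by (simp add: ev_def Halg_def str_mkalg)

text \<open>
  Transposing the two composites \<open>W (T A) \<rightarrow> Z\<close> gives the two sides of the equation that defines a
  homomorphism: the function after the structure map of \<open>P\<close>, and term evaluation along the function.
\<close>

lemma balanced_iff_alghom:
  assumes P: "is_alg P" and g: "g \<in> hom C (omap W (car P)) Z"
  shows "g \<cdot>\<^bsub>C\<^esub> amap W (rel1 P) = g \<cdot>\<^bsub>C\<^esub> amap W (rel2 P) \<longleftrightarrow> is_alghom P (Halg Z) (trans (car P) Z g)"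
proof -
  let ?A = "car P"
  note A = is_algD(1)[OF P]
  have Z: "Z \<in> Obj C" using W.B.hom_ObjD[OF g] by simp
  have f1: "(\<lambda>t. eta ?A (str P t)) \<in> TT ?A \<rightarrow> TT ?A" and f2: "(\<lambda>t. t) \<in> TT ?A \<rightarrow> TT ?A"
    using is_algD(1,2)[OF P] by (simp_all add: Pi_iff)
  note h1 = comp_kar_hom[OF small_TT[OF A] A f1 g] and h2 = comp_kar_hom[OF small_TT[OF A] A f2 g]
  have 1: "trans (TT ?A) Z (g \<cdot>\<^bsub>C\<^esub> amap W (rel1 P)) t = trans ?A Z g (str P t)" if "t \<in> TT ?A" for t
    using trans_comp_kar[OF small_TT[OF A] A f1 g that] by (simp add: rel1_def trans_def)
  have 2: "trans (TT ?A) Z (g \<cdot>\<^bsub>C\<^esub> amap W (rel2 P)) t = ev (Halg Z) ?A (trans ?A Z g) t" if "t \<in> TT ?A" for t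
    using trans_comp_kar[OF small_TT[OF A] A f2 g that] enc_comp_elt[OF A g that]
      ev_Halg[OF Z A trans_in[OF A g] that]
    by (simp add: rel2_def)
  have "g \<cdot>\<^bsub>C\<^esub> amap W (rel1 P) = g \<cdot>\<^bsub>C\<^esub> amap W (rel2 P) \<longleftrightarrow>
    (\<forall>t\<in>TT ?A. trans (TT ?A) Z (g \<cdot>\<^bsub>C\<^esub> amap W (rel1 P)) t = trans (TT ?A) Z (g \<cdot>\<^bsub>C\<^esub> amap W (rel2 P)) t)"
    using trans_inj[OF small_TT[OF A] h1 h2] by (auto simp: rel1_def rel2_def)
  also have "\<dots> \<longleftrightarrow> is_alghom P (Halg Z) (trans ?A Z g)"
    using P is_alg_Halg[OF Z] trans_in[OF A g] by (simp add: 1 2 is_alghom_def Halg_def)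
  finally show ?thesis .
qed

subsection \<open>Extension to all algebras\<close>

lemma ex_coequalizer:
  assumes P: "is_alg P"
  shows "\<exists>Qp. is_coequalizer C (omap W (TT (car P))) (omap W (car P)) (amap W (rel1 P)) (amap W (rel2 P)) (fst Qp) (snd Qp)"
  using cocomplete_coequalizer[OF cocompl W.amap_hom[OF rel_in_hom(1)[OF P]] W.amap_hom[OF rel_in_hom(2)[OF P]]]
  by auto

text \<open>
  A chosen coequalizer of the images under \<open>W\<close> of the canonical presentation: the object \<open>V P\<close> with its
  projection \<open>p P\<close>.
\<close>

definition Coeq :: "'u set \<times> 'u set_arrow \<Rightarrow> 'o \<times> 'a" where
  "Coeq P = (SOME Qp. is_coequalizer C (omap W (TT (car P))) (omap W (car P))
     (amap W (rel1 P)) (amap W (rel2 P)) (fst Qp) (snd Qp))"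

abbreviation V :: "'u set \<times> 'u set_arrow \<Rightarrow> 'o" where "V P \<equiv> fst (Coeq P)"
abbreviation p :: "'u set \<times> 'u set_arrow \<Rightarrow> 'a" where "p P \<equiv> snd (Coeq P)"

lemma coeq_p:
  "is_alg P \<Longrightarrow> is_coequalizer C (omap W (TT (car P))) (omap W (car P)) (amap W (rel1 P)) (amap W (rel2 P)) (V P) (p P)"
  unfolding Coeq_def by (rule someI_ex[OF ex_coequalizer])

lemma p_hom: "is_alg P \<Longrightarrow> p P \<in> hom C (omap W (car P)) (V P)"
  using coeq_p is_coequalizerD(3) by metis

text \<open>
  The Kleisli arrow between the carriers that underlies an algebra homomorphism.
\<close>

definition base :: "('u set \<times> 'u set_arrow, 'u set_arrow) arrow \<Rightarrow> ('u set, 'u set_arrow) arrow" where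
  "base u = kar (car (source u)) (\<lambda>x. eta (car (target u)) (mapping (mapping u) x)) (car (target u))"

lemma base_aar: "base (aar P f R) = kar (car P) (\<lambda>x. eta (car R) (f x)) (car R)"
  by (simp add: base_def aar_def kar_eq_iff)

lemma eta_comp_in: "sm Y \<Longrightarrow> f \<in> X \<rightarrow> Y \<Longrightarrow> (\<lambda>x. eta Y (f x)) \<in> X \<rightarrow> TT Y"
  by (simp add: Pi_iff)

lemma base_in_hom:
  assumes "u \<in> hom (Alg T) P R"
  shows "base u \<in> hom K (car P) (car R)"
proof -
  obtain f where f: "u = aar P f R" "is_alghom P R f" using assms by (rule hom_AlgE)
  show ?thesis
    using is_alghomD[OF f(2)] by (simp add: f(1) base_aar kar_in_hom eta_comp_in)
qed

lemma base_comp: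
  assumes "u \<in> hom (Alg T) P R" "v \<in> hom (Alg T) R S"
  shows "base (v \<cdot>\<^bsub>Alg T\<^esub> u) = base v \<cdot>\<^bsub>K\<^esub> base u"
proof -
  obtain f where f: "u = aar P f R" "is_alghom P R f" using assms(1) by (rule hom_AlgE)
  obtain g where g: "v = aar R g S" "is_alghom R S g" using assms(2) by (rule hom_AlgE)
  note F = is_alghomD[OF f(2)] and G = is_alghomD[OF g(2)]
  have "bind (car R) (\<lambda>x. eta (car S) (g x)) (car S) (eta (car R) (f x)) = eta (car S) (g (f x))"
    if "x \<in> car P" for x
    using bind_eta[OF G(5,6) eta_comp_in[OF G(6,3)], of "f x"] F(3) that by auto
  then show ?thesis
    using eta_comp_in[OF F(6,3)] eta_comp_in[OF G(6,3)] F(5,6) G(6)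
    by (simp add: f(1) g(1) aar_comp[OF F(3)] base_aar kar_comp kar_eq_iff)
qed

text \<open>
  The presentation is natural: with \<open>t\<close> the Kleisli arrow underlying \<open>T f\<close>, both squares formed by \<open>base u\<close>,
  \<open>t\<close> and one of the two relations commute in \<open>K\<close>.
\<close>

lemma base_balanced:
  assumes u: "u \<in> hom (Alg T) P R"
  shows "(p R \<cdot>\<^bsub>C\<^esub> amap W (base u)) \<cdot>\<^bsub>C\<^esub> amap W (rel1 P) = (p R \<cdot>\<^bsub>C\<^esub> amap W (base u)) \<cdot>\<^bsub>C\<^esub> amap W (rel2 P)"
proof -
  obtain f where f: "u = aar P f R" "is_alghom P R f" using u by (rule hom_AlgE)
  note F = is_alghomD[OF f(2)]
  let ?A = "car P" and ?B = "car R"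
  note A = F(5) and B = F(6)
  let ?t = "kar (TT ?A) (\<lambda>t. eta (TT ?B) (tmap ?A f ?B t)) (TT ?B)"
  have tf: "tmap ?A f ?B \<in> TT ?A \<rightarrow> TT ?B" by (rule tmap_fn(2)[OF A B F(3)])
  have t: "?t \<in> hom K (TT ?A) (TT ?B)" using A B eta_comp_in[OF small_TT[OF B] tf] by (simp add: kar_in_hom)
  note r = rel_in_hom[OF F(1)] and r' = rel_in_hom[OF F(2)] and b = base_in_hom[OF u]
  note eB = eta_comp_in[OF B F(3)] and et = eta_comp_in[OF small_TT[OF B] tf]
    and sA = eta_comp_in[OF A is_algD(2)[OF F(1)]] and sB = eta_comp_in[OF B is_algD(2)[OF F(2)]]
  have "bind ?A (\<lambda>x. eta ?B (f x)) ?B (eta ?A (str P t)) = bind (TT ?B) (\<lambda>t. eta ?B (str R t)) ?B (eta (TT ?B) (tmap ?A f ?B t))"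
    if t: "t \<in> TT ?A" for t
  proof -
    have "str P t \<in> ?A" "tmap ?A f ?B t \<in> TT ?B" using is_algD(2)[OF F(1)] tf t by auto
    then show ?thesis
      using F(4)[OF t] by (simp add: bind_eta[OF A B eB] bind_eta[OF small_TT[OF B] B sB] ev_def)
  qed
  then have 1: "base u \<cdot>\<^bsub>K\<^esub> rel1 P = rel1 R \<cdot>\<^bsub>K\<^esub> ?t"
    using A B eB et sA sB by (simp add: f(1) base_aar rel1_def kar_comp kar_eq_iff)
  have "bind ?A (\<lambda>x. eta ?B (f x)) ?B t = bind (TT ?B) (\<lambda>t. t) ?B (eta (TT ?B) (tmap ?A f ?B t))"
    if t: "t \<in> TT ?A" for t
  proof -
    have "tmap ?A f ?B t \<in> TT ?B" using tf t by auto
    then show ?thesis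
      using tmap_eq_bind[OF A B F(3) t] by (simp add: bind_eta[OF small_TT[OF B] B])
  qed
  then have 2: "base u \<cdot>\<^bsub>K\<^esub> rel2 P = rel2 R \<cdot>\<^bsub>K\<^esub> ?t"
    using A B eB et by (simp add: f(1) base_aar rel2_def kar_comp kar_eq_iff)
  note pR = is_coequalizerD[OF coeq_p[OF F(2)]]
  have *: "(p R \<cdot>\<^bsub>C\<^esub> amap W (base u)) \<cdot>\<^bsub>C\<^esub> amap W r0 = (p R \<cdot>\<^bsub>C\<^esub> amap W r0') \<cdot>\<^bsub>C\<^esub> amap W ?t"
    if r0: "r0 \<in> hom K (TT ?A) ?A" and r0': "r0' \<in> hom K (TT ?B) ?B" and eq: "base u \<cdot>\<^bsub>K\<^esub> r0 = r0' \<cdot>\<^bsub>K\<^esub> ?t" for r0 r0'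
    using W.B.Comp_assoc[OF W.amap_hom[OF r0] W.amap_hom[OF b] pR(3)]
      W.B.Comp_assoc[OF W.amap_hom[OF t] W.amap_hom[OF r0'] pR(3)] W.amap_Comp[OF r0 b] W.amap_Comp[OF t r0'] eq
    by simp
  show ?thesis
    using *[OF r(1) r'(1) 1] *[OF r(2) r'(2) 2] pR(4) by simp
qed

definition Vmap :: "('u set \<times> 'u set_arrow, 'u set_arrow) arrow \<Rightarrow> 'a" where
  "Vmap u = (SOME h. h \<in> hom C (V (source u)) (V (target u)) \<and>
     h \<cdot>\<^bsub>C\<^esub> p (source u) = p (target u) \<cdot>\<^bsub>C\<^esub> amap W (base u))"

lemma p_base_hom: "u \<in> hom (Alg T) P R \<Longrightarrow> p R \<cdot>\<^bsub>C\<^esub> amap W (base u) \<in> hom C (omap W (car P)) (V R)"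
  using W.B.Comp_hom[OF W.amap_hom[OF base_in_hom] p_hom] FF.B.hom_ObjD(2) by blast

lemma Vmap:
  assumes u: "u \<in> hom (Alg T) P R"
  shows "Vmap u \<in> hom C (V P) (V R)" "Vmap u \<cdot>\<^bsub>C\<^esub> p P = p R \<cdot>\<^bsub>C\<^esub> amap W (base u)"
proof -
  have PR: "source u = P" "target u = R" using homD[OF u] by (simp_all add: Alg_simps)
  have P: "is_alg P" using FF.B.hom_ObjD[OF u] by simp
  have "\<exists>h. h \<in> hom C (V P) (V R) \<and> h \<cdot>\<^bsub>C\<^esub> p P = p R \<cdot>\<^bsub>C\<^esub> amap W (base u)"
    using is_coequalizerD(5)[OF coeq_p[OF P] p_base_hom[OF u] base_balanced[OF u]] .
  from someI_ex[OF this] show "Vmap u \<in> hom C (V P) (V R)" "Vmap u \<cdot>\<^bsub>C\<^esub> p P = p R \<cdot>\<^bsub>C\<^esub> amap W (base u)"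
    by (simp_all add: Vmap_def PR)
qed

lemma Vmap_eqI:
  assumes u: "u \<in> hom (Alg T) P R" and h: "h \<in> hom C (V P) (V R)" "h \<cdot>\<^bsub>C\<^esub> p P = p R \<cdot>\<^bsub>C\<^esub> amap W (base u)"
  shows "Vmap u = h"
  using W.B.coequalizer_epi[OF coeq_p Vmap(1)[OF u] h(1)] Vmap(2)[OF u] h(2) FF.B.hom_ObjD(1)[OF u] by simp

text \<open>
  The extension of \<open>W\<close> to all algebras.
\<close>

definition VF :: "('u set \<times> 'u set_arrow, ('u set \<times> 'u set_arrow, 'u set_arrow) arrow, 'o, 'a) func" where
  "VF = \<lparr>omap = (\<lambda>P\<in>Obj (Alg T). V P), amap = (\<lambda>u\<in>Arr (Alg T). Vmap u)\<rparr>"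

lemma VF_simps: "is_alg P \<Longrightarrow> omap VF P = V P" "u \<in> hom (Alg T) P R \<Longrightarrow> amap VF u = Vmap u"
  by (simp_all add: VF_def hom_def)

lemma is_functor_VF: "is_functor (Alg T) C VF"
proof (intro is_functor.intro is_functor_axioms.intro category_Alg W.B.category_axioms)
  show "omap VF P \<in> Obj C" if "is_alg P" for P
    using W.B.hom_ObjD(2)[OF p_hom[OF that]] by (simp add: VF_simps that)
  show "amap VF u \<in> hom C (omap VF P) (omap VF R)" if "u \<in> hom (Alg T) P R" for u P R
    using Vmap(1)[OF that] FF.B.hom_ObjD[OF that] by (simp add: VF_simps(1) VF_simps(2)[OF that])
  show "amap VF (Ident (Alg T) P) = Ident C (omap VF P)" if P: "is_alg P" for P
  proof -
    have I: "Ident (Alg T) P \<in> hom (Alg T) P P" using P by (rule FF.B.Ident_hom)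
    have "base (Ident (Alg T) P) = Ident K (car P)"
      using is_algD(1)[OF P] by (simp add: Ident_Alg base_aar Ident_K)
    then have "Vmap (Ident (Alg T) P) = Ident C (V P)"
      using W.B.Comp_Ident_left[OF p_hom[OF P]] W.B.Comp_Ident_right[OF p_hom[OF P]] W.amap_Ident[of "car P"]
        is_algD(1)[OF P] W.B.Ident_hom[OF W.B.hom_ObjD(2)[OF p_hom[OF P]]]
      by (intro Vmap_eqI[OF I]) (simp_all add: K_simps)
    then show ?thesis using P by (simp add: VF_simps VF_simps(2)[OF I])
  qed
  show "amap VF (v \<cdot>\<^bsub>Alg T\<^esub> u) = amap VF v \<cdot>\<^bsub>C\<^esub> amap VF u"
    if u: "u \<in> hom (Alg T) P R" and v: "v \<in> hom (Alg T) R S" for u v P R S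
  proof -
    have P: "is_alg P" and R: "is_alg R" and S: "is_alg S" using FF.B.hom_ObjD u v by blast+
    note vu = FF.B.Comp_hom[OF u v]
    have "(Vmap v \<cdot>\<^bsub>C\<^esub> Vmap u) \<cdot>\<^bsub>C\<^esub> p P = Vmap v \<cdot>\<^bsub>C\<^esub> (p R \<cdot>\<^bsub>C\<^esub> amap W (base u))"
      using W.B.Comp_assoc[OF p_hom[OF P] Vmap(1)[OF u] Vmap(1)[OF v]] by (simp add: Vmap(2)[OF u])
    also have "\<dots> = (p S \<cdot>\<^bsub>C\<^esub> amap W (base v)) \<cdot>\<^bsub>C\<^esub> amap W (base u)"
      using W.B.Comp_assoc[OF W.amap_hom[OF base_in_hom[OF u]] p_hom[OF R] Vmap(1)[OF v]]
      by (simp add: Vmap(2)[OF v])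
    also have "\<dots> = p S \<cdot>\<^bsub>C\<^esub> amap W (base (v \<cdot>\<^bsub>Alg T\<^esub> u))"
      using W.B.Comp_assoc[OF W.amap_hom[OF base_in_hom[OF u]] W.amap_hom[OF base_in_hom[OF v]] p_hom[OF S]]
        W.amap_Comp[OF base_in_hom[OF u] base_in_hom[OF v]]
      by (simp add: base_comp[OF u v])
    finally have "Vmap (v \<cdot>\<^bsub>Alg T\<^esub> u) = Vmap v \<cdot>\<^bsub>C\<^esub> Vmap u"
      by (rule Vmap_eqI[OF vu W.B.Comp_hom[OF Vmap(1)[OF u] Vmap(1)[OF v]]])
    then show ?thesis by (simp add: VF_simps(2)[OF u] VF_simps(2)[OF v] VF_simps(2)[OF vu])
  qed
qed

text \<open>
  Arrows \<open>V P \<rightarrow> Z\<close> are arrows \<open>W A \<rightarrow> Z\<close> that coequalize the presentation, which are the homomorphisms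
  from \<open>P\<close> to \<open>Halg Z\<close>. So \<open>V\<close> is a left adjoint.
\<close>

lemma cocontinuous_VF: "cocontinuous TYPE('u) (Alg T) C VF"
proof (rule left_adjoint_cocontinuous[OF is_functor_VF])
  fix Z assume Z: "Z \<in> Obj C"
  let ?\<psi> = "\<lambda>P h. aar P (trans (car P) Z (h \<cdot>\<^bsub>C\<^esub> p P)) (Halg Z)"
  have bij: "bij_betw (?\<psi> P) (hom C (omap VF P) Z) (hom (Alg T) P (Halg Z))" if P: "is_alg P" for P
  proof -
    note A = is_algD(1)[OF P] and pD = is_coequalizerD[OF coeq_p[OF P]]
    have hp: "h \<cdot>\<^bsub>C\<^esub> p P \<in> hom C (omap W (car P)) Z" if "h \<in> hom C (V P) Z" for h
      using W.B.Comp_hom[OF p_hom[OF P] that] .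
    have "bij_betw (?\<psi> P) (hom C (V P) Z) (hom (Alg T) P (Halg Z))"
      unfolding bij_betw_def
    proof (intro conjI equalityI subsetI inj_onI)
      fix h h' assume h: "h \<in> hom C (V P) Z" "h' \<in> hom C (V P) Z" and "?\<psi> P h = ?\<psi> P h'"
      then have "h \<cdot>\<^bsub>C\<^esub> p P = h' \<cdot>\<^bsub>C\<^esub> p P"
        by (intro trans_inj[OF A hp hp]) (simp_all add: aar_eq_iff)
      then show "h = h'" by (rule W.B.coequalizer_epi[OF coeq_p[OF P] h])
    next
      fix u assume "u \<in> ?\<psi> P ` hom C (V P) Z"
      then obtain h where h: "h \<in> hom C (V P) Z" "u = ?\<psi> P h" by blast
      have "(h \<cdot>\<^bsub>C\<^esub> p P) \<cdot>\<^bsub>C\<^esub> amap W (rel1 P) = (h \<cdot>\<^bsub>C\<^esub> p P) \<cdot>\<^bsub>C\<^esub> amap W (rel2 P)"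
        using W.B.Comp_assoc[OF pD(1,3) h(1)] W.B.Comp_assoc[OF pD(2,3) h(1)] pD(4) by simp
      then show "u \<in> hom (Alg T) P (Halg Z)"
        using balanced_iff_alghom[OF P hp[OF h(1)]] by (simp add: h(2) aar_in_hom)
    next
      fix u assume "u \<in> hom (Alg T) P (Halg Z)"
      then obtain f where f: "u = aar P f (Halg Z)" "is_alghom P (Halg Z) f" by (rule hom_AlgE)
      have "f \<in> car P \<rightarrow> Hpt Z" using is_alghomD(3)[OF f(2)] by (simp add: Halg_def)
      from trans_surj[OF A Z this] obtain g where g: "g \<in> hom C (omap W (car P)) Z"
        "\<And>x. x \<in> car P \<Longrightarrow> trans (car P) Z g x = f x" by blast
      have "is_alghom P (Halg Z) (trans (car P) Z g)"
        using f(2) by (rule is_alghom_cong) (simp add: g(2))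
      then obtain h where h: "h \<in> hom C (V P) Z" "h \<cdot>\<^bsub>C\<^esub> p P = g"
        using pD(5)[OF g(1)] balanced_iff_alghom[OF P g(1)] by blast
      then have "u = ?\<psi> P h" by (simp add: f(1) aar_eq_iff g(2))
      then show "u \<in> ?\<psi> P ` hom C (V P) Z" using h(1) by blast
    qed
    then show ?thesis by (simp add: VF_simps P)
  qed
  have nat: "?\<psi> P (h \<cdot>\<^bsub>C\<^esub> amap VF u) = ?\<psi> R h \<cdot>\<^bsub>Alg T\<^esub> u"
    if u: "u \<in> hom (Alg T) P R" and h: "h \<in> hom C (omap VF R) Z" for u P R h
  proof -
    have P: "is_alg P" and R: "is_alg R" using FF.B.hom_ObjD u by blast+
    have h': "h \<in> hom C (V R) Z" using h by (simp add: VF_simps R)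
    obtain f where f: "u = aar P f R" "is_alghom P R f" using u by (rule hom_AlgE)
    note F = is_alghomD[OF f(2)]
    note hp = W.B.Comp_hom[OF p_hom[OF R] h']
    have "(h \<cdot>\<^bsub>C\<^esub> Vmap u) \<cdot>\<^bsub>C\<^esub> p P = (h \<cdot>\<^bsub>C\<^esub> p R) \<cdot>\<^bsub>C\<^esub> amap W (base u)"
      using W.B.Comp_assoc[OF p_hom[OF P] Vmap(1)[OF u] h'] Vmap(2)[OF u]
        W.B.Comp_assoc[OF W.amap_hom[OF base_in_hom[OF u]] p_hom[OF R] h']
      by simp
    then have "trans (car P) Z ((h \<cdot>\<^bsub>C\<^esub> Vmap u) \<cdot>\<^bsub>C\<^esub> p P) x = trans (car R) Z (h \<cdot>\<^bsub>C\<^esub> p R) (f x)"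
      if "x \<in> car P" for x
      using trans_comp_kar[OF F(5,6) eta_comp_in[OF F(6,3)] hp that]
      by (simp add: f(1) base_aar) (simp add: trans_def)
    then show ?thesis
      by (simp add: VF_simps(2)[OF u]) (simp add: f(1) aar_comp[OF F(3)] aar_eq_iff)
  qed
  show "\<exists>N\<in>Obj (Alg T). \<exists>\<psi>. (\<forall>P\<in>Obj (Alg T). bij_betw (\<psi> P) (hom C (omap VF P) Z) (hom (Alg T) P N)) \<and>
      (\<forall>P R u h. u \<in> hom (Alg T) P R \<longrightarrow> h \<in> hom C (omap VF R) Z \<longrightarrow>
        \<psi> P (h \<cdot>\<^bsub>C\<^esub> amap VF u) = \<psi> R h \<cdot>\<^bsub>Alg T\<^esub> u)"
    using is_alg_Halg[OF Z] bij nat by (intro bexI[of _ "Halg Z"] exI[of _ ?\<psi>]) blast+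
qed

definition cnt :: "'u set \<Rightarrow> ('u set, 'u set_arrow) arrow" where
  "cnt X = kar (TT X) (\<lambda>t. t) X"

lemma cnt_hom: "sm X \<Longrightarrow> cnt X \<in> hom K (TT X) X"
  by (simp add: cnt_def kar_in_hom)

text \<open>
  The presentation of a free algebra splits in \<open>K\<close>: \<open>?s\<close> regards a variable as a term with one
  variable, and \<open>?t\<close> does so with the variables inside a term. Functors preserve split coequalizers.
\<close>

lemma W_free_coequalizer:
  assumes X: "sm X"
  shows "is_coequalizer C (omap W (TT (TT X))) (omap W (TT X)) (amap W (rel1 (Fr X))) (amap W (rel2 (Fr X)))
    (omap W X) (amap W (cnt X))"
proof -
  note TX = small_TT[OF X] and TTX = small_TT[OF small_TT[OF X]]
  let ?s = "kar X (\<lambda>x. eta (TT X) (eta X x)) (TT X)"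
  let ?t = "kar (TT X) (\<lambda>t. eta (TT (TT X)) (tmap X (eta X) (TT X) t)) (TT (TT X))"
  have r1: "rel1 (Fr X) = kar (TT (TT X)) (\<lambda>t. eta (TT X) (mu X t)) (TT X)"
    by (simp add: rel1_def kar_eq_iff str_Fr)
  have r2: "rel2 (Fr X) = kar (TT (TT X)) (\<lambda>t. t) (TT X)"
    by (simp add: rel2_def)
  note r = rel_in_hom[OF is_alg_Fr[OF X], unfolded car_Fr]
  note e = eta_fn(2)[OF X]
  have t0: "tmap X (eta X) (TT X) \<in> TT X \<rightarrow> TT (TT X)" by (rule tmap_fn(2)[OF X TX e])
  have f: "(\<lambda>x. eta (TT X) (eta X x)) \<in> X \<rightarrow> TT (TT X)"
    "(\<lambda>t. eta (TT (TT X)) (tmap X (eta X) (TT X) t)) \<in> TT X \<rightarrow> TT (TT (TT X))"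
    "(\<lambda>t. eta (TT X) (mu X t)) \<in> TT (TT X) \<rightarrow> TT (TT X)"
    using e t0 X by (simp_all add: Pi_iff)
  have id: "(\<lambda>t. t) \<in> TT X \<rightarrow> TT X" "(\<lambda>t. t) \<in> TT (TT X) \<rightarrow> TT (TT X)" by auto
  have s: "?s \<in> hom K X (TT X)" and t: "?t \<in> hom K (TT X) (TT (TT X))"
    using f X by (simp_all add: kar_in_hom)
  have ef: "cnt X \<cdot>\<^bsub>K\<^esub> rel1 (Fr X) = cnt X \<cdot>\<^bsub>K\<^esub> rel2 (Fr X)"
    using X f id by (simp add: r1 r2 cnt_def kar_comp kar_eq_iff mu_eq_bind[symmetric] mu_eta)
  have es: "cnt X \<cdot>\<^bsub>K\<^esub> ?s = Ident K X"
    using X f id by (simp add: cnt_def kar_comp kar_eq_iff bind_eta Ident_K)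
  have ft: "rel1 (Fr X) \<cdot>\<^bsub>K\<^esub> ?t = Ident K (TT X)"
    using X f tmap_in[OF X TX e] by (simp add: r1 kar_comp kar_eq_iff bind_eta Ident_K mu_tmap_eta)
  have gt: "rel2 (Fr X) \<cdot>\<^bsub>K\<^esub> ?t = ?s \<cdot>\<^bsub>K\<^esub> cnt X"
    using X f id tmap_in[OF X TX e] tmap_eq_bind[OF X TX e]
    by (simp add: r2 cnt_def kar_comp kar_eq_iff bind_eta)
  note c = cnt_hom[OF X]
  show ?thesis
  proof (rule W.B.split_coequalizer)
    show "amap W (cnt X) \<cdot>\<^bsub>C\<^esub> amap W (rel1 (Fr X)) = amap W (cnt X) \<cdot>\<^bsub>C\<^esub> amap W (rel2 (Fr X))"
      using W.amap_Comp[OF r(1) c] W.amap_Comp[OF r(2) c] ef by simp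
    show "amap W (cnt X) \<cdot>\<^bsub>C\<^esub> amap W ?s = Ident C (omap W X)"
      using W.amap_Comp[OF s c] es W.amap_Ident[of X] X by (simp add: K_simps)
    show "amap W (rel1 (Fr X)) \<cdot>\<^bsub>C\<^esub> amap W ?t = Ident C (omap W (TT X))"
      using W.amap_Comp[OF t r(1)] ft W.amap_Ident[of "TT X"] X by (simp add: K_simps)
    show "amap W (rel2 (Fr X)) \<cdot>\<^bsub>C\<^esub> amap W ?t = amap W ?s \<cdot>\<^bsub>C\<^esub> amap W (cnt X)"
      using W.amap_Comp[OF t r(2)] W.amap_Comp[OF c s] gt by simp
  qed (intro W.amap_hom r c s t)+
qed

text \<open>
  Both sides are coequalizers of the same pair; naturality may be checked after the epimorphism \<open>p\<close>.
\<close>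

lemma VF_free_iso:
  obtains \<zeta> \<zeta>' where
    "\<And>X. sm X \<Longrightarrow> \<zeta> X \<in> hom C (omap VF (Fr X)) (omap W X)"
    "\<And>X. sm X \<Longrightarrow> \<zeta>' X \<in> hom C (omap W X) (omap VF (Fr X))"
    "\<And>X. sm X \<Longrightarrow> \<zeta>' X \<cdot>\<^bsub>C\<^esub> \<zeta> X = Ident C (omap VF (Fr X))"
    "\<And>X. sm X \<Longrightarrow> \<zeta> X \<cdot>\<^bsub>C\<^esub> \<zeta>' X = Ident C (omap W X)"
    "\<And>X Y k. k \<in> hom K X Y \<Longrightarrow> \<zeta> Y \<cdot>\<^bsub>C\<^esub> amap VF (amap FrF k) = amap W k \<cdot>\<^bsub>C\<^esub> \<zeta> X"
proof -
  have "\<exists>h h'. h \<in> hom C (V (Fr X)) (omap W X) \<and> h \<cdot>\<^bsub>C\<^esub> p (Fr X) = amap W (cnt X) \<and>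
      h' \<in> hom C (omap W X) (V (Fr X)) \<and> h' \<cdot>\<^bsub>C\<^esub> h = Ident C (V (Fr X)) \<and> h \<cdot>\<^bsub>C\<^esub> h' = Ident C (omap W X)"
    if X: "sm X" for X
    using W.B.coequalizer_iso[OF coeq_p[OF is_alg_Fr[OF X], unfolded car_Fr] W_free_coequalizer[OF X]] by metis
  then obtain \<zeta> \<zeta>' where
    \<zeta>: "\<And>X. sm X \<Longrightarrow> \<zeta> X \<in> hom C (V (Fr X)) (omap W X)" and
    \<zeta>p: "\<And>X. sm X \<Longrightarrow> \<zeta> X \<cdot>\<^bsub>C\<^esub> p (Fr X) = amap W (cnt X)" and
    \<zeta>': "\<And>X. sm X \<Longrightarrow> \<zeta>' X \<in> hom C (omap W X) (V (Fr X))"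
    "\<And>X. sm X \<Longrightarrow> \<zeta>' X \<cdot>\<^bsub>C\<^esub> \<zeta> X = Ident C (V (Fr X))"
    "\<And>X. sm X \<Longrightarrow> \<zeta> X \<cdot>\<^bsub>C\<^esub> \<zeta>' X = Ident C (omap W X)"
    by metis
  have nat: "\<zeta> Y \<cdot>\<^bsub>C\<^esub> amap VF (amap FrF k) = amap W k \<cdot>\<^bsub>C\<^esub> \<zeta> X" if k: "k \<in> hom K X Y" for X Y k
  proof -
    obtain f where f: "k = kar X f Y" "f \<in> X \<rightarrow> TT Y" and X: "sm X" and Y: "sm Y" using k by (rule hom_KE)
    have Fk: "amap FrF k \<in> hom (Alg T) (Fr X) (Fr Y)" using FF.amap_hom[OF k] by simp
    note v = Vmap[OF Fk] and pX = p_hom[OF is_alg_Fr[OF X], unfolded car_Fr] and pY = p_hom[OF is_alg_Fr[OF Y], unfolded car_Fr]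
    note b = base_in_hom[OF Fk, unfolded car_Fr]
    have bf: "bind X f Y \<in> TT X \<rightarrow> TT Y" using bind_in[OF X Y f(2)] by auto
    have "cnt Y \<cdot>\<^bsub>K\<^esub> base (amap FrF k) = k \<cdot>\<^bsub>K\<^esub> cnt X"
      using X Y f(2) eta_comp_in[OF small_TT[OF Y] bf]
      by (simp add: f(1) FrF_kar base_aar cnt_def kar_comp kar_eq_iff bind_eta bind_in)
    then have eq: "amap W (cnt Y) \<cdot>\<^bsub>C\<^esub> amap W (base (amap FrF k)) = amap W k \<cdot>\<^bsub>C\<^esub> amap W (cnt X)"
      using W.amap_Comp[OF b cnt_hom[OF Y]] W.amap_Comp[OF cnt_hom[OF X] k] by simp
    have "(\<zeta> Y \<cdot>\<^bsub>C\<^esub> Vmap (amap FrF k)) \<cdot>\<^bsub>C\<^esub> p (Fr X) = \<zeta> Y \<cdot>\<^bsub>C\<^esub> (p (Fr Y) \<cdot>\<^bsub>C\<^esub> amap W (base (amap FrF k)))"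
      using W.B.Comp_assoc[OF pX v(1) \<zeta>[OF Y]] by (simp add: v(2))
    also have "\<dots> = amap W k \<cdot>\<^bsub>C\<^esub> amap W (cnt X)"
      using W.B.Comp_assoc[OF W.amap_hom[OF b] pY \<zeta>[OF Y]] by (simp add: \<zeta>p[OF Y] eq)
    also have "\<dots> = (amap W k \<cdot>\<^bsub>C\<^esub> \<zeta> X) \<cdot>\<^bsub>C\<^esub> p (Fr X)"
      using W.B.Comp_assoc[OF pX \<zeta>[OF X] W.amap_hom[OF k]] by (simp add: \<zeta>p[OF X])
    finally have "\<zeta> Y \<cdot>\<^bsub>C\<^esub> Vmap (amap FrF k) = amap W k \<cdot>\<^bsub>C\<^esub> \<zeta> X"
      by (rule W.B.coequalizer_epi[OF coeq_p[OF is_alg_Fr[OF X]] W.B.Comp_hom[OF v(1) \<zeta>[OF Y]]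
            W.B.Comp_hom[OF \<zeta>[OF X] W.amap_hom[OF k]]])
    then show ?thesis by (simp add: VF_simps(2)[OF Fk])
  qed
  show ?thesis
    by (rule that[of \<zeta> \<zeta>']) (simp_all add: VF_simps is_alg_Fr \<zeta> \<zeta>' nat)
qed

end

section \<open>Restriction of functors to free algebras\<close>

context monad_on_sets
begin

lemma Obj_CoAlg:
  "W \<in> Obj (CoAlg C T) \<longleftrightarrow> is_functor K C W \<and> omap W \<in> extensional (Obj K) \<and>
     amap W \<in> extensional (Arr K) \<and> preserves_products TYPE('u) (op_cat K) (op_cat C) W"
  by (auto simp: CoAlg_def Alg_in_def functor_cat_simps)

lemma hom_CoAlg:
  "hom (CoAlg C T) V W = {Arrow W \<tau> V | \<tau>. V \<in> Obj (CoAlg C T) \<and> W \<in> Obj (CoAlg C T) \<and>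
     nat_trans K C V W \<tau> \<and> \<tau> \<in> extensional (Obj K)}"
  by (auto simp: CoAlg_def Alg_in_def hom_full_subcat hom_functor_cat)

lemma CoAlg_simps:
  "Ident (CoAlg C T) W = Arrow W (\<lambda>X\<in>Obj K. Ident C (omap W X)) W"
  "\<tau> \<cdot>\<^bsub>CoAlg C T\<^esub> \<sigma> = Arrow (source \<tau>) (\<lambda>X\<in>Obj K. mapping \<tau> X \<cdot>\<^bsub>C\<^esub> mapping \<sigma> X) (target \<sigma>)"
  by (simp_all add: CoAlg_def Alg_in_def functor_cat_simps)

lemma category_CoAlg: "category C \<Longrightarrow> category (CoAlg C T)"
  by (simp add: CoAlg_def Alg_in_def category_full_subcat category_functor_cat category_K)

definition restr :: "('u set \<times> 'u set_arrow, ('u set \<times> 'u set_arrow, 'u set_arrow) arrow, 'o, 'a) func \<Rightarrow>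
    ('u, 'o, 'a) alg_in" where
  "restr G = restrict_func K (comp_func G FrF)"

lemma restr_simps:
  "sm X \<Longrightarrow> omap (restr G) X = omap G (Fr X)"
  "u \<in> hom K X Y \<Longrightarrow> amap (restr G) u = amap G (amap FrF u)"
  by (simp_all add: restr_def K_simps) (simp_all add: comp_func_def)

lemma restr_Obj:
  assumes "G \<in> Obj (Hom_c TYPE('u) (Alg T) C)"
  shows "restr G \<in> Obj (CoAlg C T)"
proof -
  have G: "is_functor (Alg T) C G" "cocontinuous TYPE('u) (Alg T) C G" using assms by (auto simp: Obj_Hom_c)
  have "preserves_products TYPE('u) (op_cat K) (op_cat C) (restrict_func (op_cat K) (comp_func G FrF))"
    by (intro preserves_products_restrict_func preserves_products_comp_func[OF FrF_preserves_coproducts]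
        cocontinuous_preserves_coproducts G)
  moreover have "is_functor K C (restr G)"
    unfolding restr_def by (intro is_functor_restrict_func is_functor_comp_func[OF is_functor_FrF] G)
  ultimately show ?thesis
    by (simp add: Obj_CoAlg restr_def) (simp add: restrict_func_def)
qed

lemma nat_trans_restr:
  assumes \<tau>: "nat_trans (Alg T) C G H \<tau>"
  shows "nat_trans K C (restr G) (restr H) (\<lambda>X\<in>Obj K. \<tau> (Fr X))"
proof -
  interpret nat_trans "Alg T" C G H \<tau> by fact
  show ?thesis
  proof (intro nat_trans.intro nat_trans_axioms.intro)
    show "is_functor K C (restr G)" "is_functor K C (restr H)"
      unfolding restr_def
      by (intro is_functor_restrict_func is_functor_comp_func[OF is_functor_FrF] F.is_functor_axioms G.is_functor_axioms)+
    show "(\<lambda>X\<in>Obj K. \<tau> (Fr X)) X \<in> hom C (omap (restr G) X) (omap (restr H) X)" if "X \<in> Obj K" for X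
      using that component_hom[OF is_alg_Fr, of X] by (simp add: K_simps restr_simps)
    show "(\<lambda>X\<in>Obj K. \<tau> (Fr X)) Y \<cdot>\<^bsub>C\<^esub> amap (restr G) f = amap (restr H) f \<cdot>\<^bsub>C\<^esub> (\<lambda>X\<in>Obj K. \<tau> (Fr X)) X"
      if f: "f \<in> hom K X Y" for f X Y
      using FF.A.hom_ObjD[OF f] naturality[OF FF.amap_hom[OF f]] by (simp add: restr_simps(2)[OF f])
  qed
qed

text \<open>
  An arrow from \<open>G\<close> to \<open>H\<close> in \<open>CoAlg C T\<close> is stored as a transformation between functors into \<open>op_cat C\<close>, so
  that source and target change places.
\<close>

definition Restr :: "(('u set \<times> 'u set_arrow, ('u set \<times> 'u set_arrow, 'u set_arrow) arrow, 'o, 'a) func,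
    (('u set \<times> 'u set_arrow, ('u set \<times> 'u set_arrow, 'u set_arrow) arrow, 'o, 'a) func,
      'u set \<times> 'u set_arrow \<Rightarrow> 'a) arrow,
    ('u, 'o, 'a) alg_in, (('u, 'o, 'a) alg_in, 'u set \<Rightarrow> 'a) arrow) func" where
  "Restr = \<lparr>omap = restr, amap = (\<lambda>t. Arrow (restr (target t)) (\<lambda>X\<in>Obj K. mapping t (Fr X)) (restr (source t)))\<rparr>"

lemma is_functor_Restr:
  assumes C: "category C"
  shows "is_functor (Hom_c TYPE('u) (Alg T) C) (CoAlg C T) Restr"
proof (intro is_functor.intro is_functor_axioms.intro category_Hom_c category_CoAlg category_Alg C)
  let ?H = "Hom_c TYPE('u) (Alg T) C"
  show "omap Restr G \<in> Obj (CoAlg C T)" if "G \<in> Obj ?H" for G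
    using restr_Obj[OF that] by (simp add: Restr_def)
  show "amap Restr (Ident ?H G) = Ident (CoAlg C T) (omap Restr G)" if "G \<in> Obj ?H" for G
    by (auto simp: Restr_def Hom_c_simps CoAlg_simps restrict_def K_simps is_alg_Fr restr_simps fun_eq_iff)
  fix s G H assume s: "s \<in> hom ?H G H"
  then show "amap Restr s \<in> hom (CoAlg C T) (omap Restr G) (omap Restr H)"
    by (auto simp: hom_Hom_c hom_CoAlg Restr_def restr_Obj nat_trans_restr)
  fix t L assume "t \<in> hom ?H H L"
  with s show "amap Restr (t \<cdot>\<^bsub>?H\<^esub> s) = amap Restr t \<cdot>\<^bsub>CoAlg C T\<^esub> amap Restr s"
    by (auto simp: hom_Hom_c Hom_c_simps CoAlg_simps Restr_def restrict_def K_simps is_alg_Fr fun_eq_iff)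
qed

lemma quot_hom: "is_alg P \<Longrightarrow> quot P \<in> hom (Alg T) (Fr (car P)) P"
  using coequalizer_presentation is_coequalizerD(3) by metis

text \<open>
  The component at \<open>P\<close> is determined by its composite with the epimorphism \<open>amap G (quot P)\<close>, which by
  naturality involves only the component at a free algebra.
\<close>

lemma Restr_faithful:
  assumes s: "s \<in> hom (Hom_c TYPE('u) (Alg T) C) G H" and t: "t \<in> hom (Hom_c TYPE('u) (Alg T) C) G H"
    and eq: "amap Restr s = amap Restr t"
  shows "s = t"
proof -
  obtain \<sigma> where \<sigma>: "s = Arrow G \<sigma> H" "nat_trans (Alg T) C G H \<sigma>" "\<sigma> \<in> extensional (Obj (Alg T))"
    using s by (auto simp: hom_Hom_c)
  obtain \<tau> where \<tau>: "t = Arrow G \<tau> H" "nat_trans (Alg T) C G H \<tau>" "\<tau> \<in> extensional (Obj (Alg T))"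
    using t by (auto simp: hom_Hom_c)
  have G: "cocontinuous TYPE('u) (Alg T) C G" using s by (auto simp: hom_Hom_c Obj_Hom_c)
  interpret S: nat_trans "Alg T" C G H \<sigma> by fact
  interpret T: nat_trans "Alg T" C G H \<tau> by fact
  have free: "\<sigma> (Fr X) = \<tau> (Fr X)" if "sm X" for X
  proof -
    have "(\<lambda>X\<in>Obj K. \<sigma> (Fr X)) = (\<lambda>X\<in>Obj K. \<tau> (Fr X))" using eq by (simp add: Restr_def \<sigma>(1) \<tau>(1))
    from fun_cong[OF this, of X] show ?thesis using that by (simp add: K_simps)
  qed
  have "\<sigma> P = \<tau> P" if P: "is_alg P" for P
  proof -
    note q = quot_hom[OF P]
    show ?thesis
      using S.F.B.coequalizer_epi[OF cocontinuous_coequalizer[OF G coequalizer_presentation[OF P]]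
          S.component_hom[OF P] T.component_hom[OF P]]
        S.naturality[OF q] T.naturality[OF q] free[OF is_algD(1)[OF P]]
      by simp
  qed
  then have "\<sigma> = \<tau>" using \<sigma>(3) \<tau>(3) by (rule extensionalityI[rotated 2])
  then show ?thesis by (simp add: \<sigma>(1) \<tau>(1))
qed

text \<open>
  The component at \<open>P\<close> is induced on the coequalizer \<open>G P\<close> by \<open>\<tau> (car P)\<close>. Naturality, and agreement with
  \<open>\<tau>\<close> at free algebras, are checked after composition with the epimorphism \<open>amap G (quot P)\<close>.
\<close>

lemma Restr_full:
  assumes G: "G \<in> Obj (Hom_c TYPE('u) (Alg T) C)" and H: "H \<in> Obj (Hom_c TYPE('u) (Alg T) C)"
    and t: "t \<in> hom (CoAlg C T) (restr G) (restr H)"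
  shows "\<exists>s \<in> hom (Hom_c TYPE('u) (Alg T) C) G H. amap Restr s = t"
proof -
  obtain \<tau> where \<tau>: "t = Arrow (restr H) \<tau> (restr G)" "nat_trans K C (restr G) (restr H) \<tau>" "\<tau> \<in> extensional (Obj K)"
    using t by (auto simp: hom_CoAlg)
  interpret t: nat_trans K C "restr G" "restr H" \<tau> by fact
  interpret G: is_functor "Alg T" C G using G by (simp add: Obj_Hom_c)
  interpret H: is_functor "Alg T" C H using H by (simp add: Obj_Hom_c)
  have Gc: "cocontinuous TYPE('u) (Alg T) C G" using G by (simp add: Obj_Hom_c)
  have \<tau>_hom: "\<tau> X \<in> hom C (omap G (Fr X)) (omap H (Fr X))" if "sm X" for X
    using t.component_hom[of X] that by (simp add: K_simps restr_simps)
  have \<tau>_nat: "\<tau> Y \<cdot>\<^bsub>C\<^esub> amap G (amap FrF f) = amap H (amap FrF f) \<cdot>\<^bsub>C\<^esub> \<tau> X" if f: "f \<in> hom K X Y" for f X Y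
    using t.naturality[OF f] by (simp add: restr_simps(2)[OF f])
  note coeq = cocontinuous_coequalizer[OF Gc coequalizer_presentation]
  have "\<exists>h. h \<in> hom C (omap G P) (omap H P) \<and> h \<cdot>\<^bsub>C\<^esub> amap G (quot P) = amap H (quot P) \<cdot>\<^bsub>C\<^esub> \<tau> (car P)"
    if P: "is_alg P" for P
  proof (rule is_coequalizerD(5)[OF coeq[OF P]])
    note A = is_algD(1)[OF P] and q = quot_hom[OF P] and r = rel_in_hom[OF P]
    note Hq = H.amap_hom[OF q]
    show "amap H (quot P) \<cdot>\<^bsub>C\<^esub> \<tau> (car P) \<in> hom C (omap G (Fr (car P))) (omap H P)"
      by (rule t.F.B.Comp_hom[OF \<tau>_hom[OF A] Hq])
    have "(amap H (quot P) \<cdot>\<^bsub>C\<^esub> \<tau> (car P)) \<cdot>\<^bsub>C\<^esub> amap G (amap FrF r0) =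
        amap H (quot P \<cdot>\<^bsub>Alg T\<^esub> amap FrF r0) \<cdot>\<^bsub>C\<^esub> \<tau> (TT (car P))" if r0: "r0 \<in> hom K (TT (car P)) (car P)" for r0
    proof -
      have F: "amap FrF r0 \<in> hom (Alg T) (Fr (TT (car P))) (Fr (car P))" using FF.amap_hom[OF r0] by simp
      show ?thesis
        using t.F.B.Comp_assoc[OF G.amap_hom[OF F] \<tau>_hom[OF A] Hq] \<tau>_nat[OF r0]
          t.F.B.Comp_assoc[OF \<tau>_hom[OF small_TT[OF A]] H.amap_hom[OF F] Hq] H.amap_Comp[OF F q]
        by simp
    qed
    then show "(amap H (quot P) \<cdot>\<^bsub>C\<^esub> \<tau> (car P)) \<cdot>\<^bsub>C\<^esub> amap G (amap FrF (rel1 P)) =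
        (amap H (quot P) \<cdot>\<^bsub>C\<^esub> \<tau> (car P)) \<cdot>\<^bsub>C\<^esub> amap G (amap FrF (rel2 P))"
      using r is_coequalizerD(4)[OF coequalizer_presentation[OF P]] by simp
  qed
  then obtain \<sigma>0 where \<sigma>0: "\<And>P. is_alg P \<Longrightarrow> \<sigma>0 P \<in> hom C (omap G P) (omap H P)"
    "\<And>P. is_alg P \<Longrightarrow> \<sigma>0 P \<cdot>\<^bsub>C\<^esub> amap G (quot P) = amap H (quot P) \<cdot>\<^bsub>C\<^esub> \<tau> (car P)"
    by metis
  define \<sigma> where "\<sigma> = restrict \<sigma>0 (Obj (Alg T))"
  have \<sigma>: "\<sigma> P \<in> hom C (omap G P) (omap H P)"
    "\<sigma> P \<cdot>\<^bsub>C\<^esub> amap G (quot P) = amap H (quot P) \<cdot>\<^bsub>C\<^esub> \<tau> (car P)" if "is_alg P" for P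
    using \<sigma>0[OF that] that by (simp_all add: \<sigma>_def)
  \<comment> \<open>Naturality holds at every homomorphism that lifts along the presentations to some Kleisli arrow.\<close>
  have lift: "\<sigma> R \<cdot>\<^bsub>C\<^esub> amap G u = amap H u \<cdot>\<^bsub>C\<^esub> \<sigma> P"
    if u: "u \<in> hom (Alg T) P R" and k: "k \<in> hom K (car P) (car R)"
      and uk: "u \<cdot>\<^bsub>Alg T\<^esub> quot P = quot R \<cdot>\<^bsub>Alg T\<^esub> amap FrF k" for u P R k
  proof -
    have P: "is_alg P" and R: "is_alg R" using FF.B.hom_ObjD[OF u] by auto
    note qP = quot_hom[OF P] and qR = quot_hom[OF R]
    have Fk: "amap FrF k \<in> hom (Alg T) (Fr (car P)) (Fr (car R))" using FF.amap_hom[OF k] by simp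
    note Gu = G.amap_hom[OF u] and Hu = H.amap_hom[OF u] and GqP = G.amap_hom[OF qP] and GqR = G.amap_hom[OF qR]
      and GFk = G.amap_hom[OF Fk] and HFk = H.amap_hom[OF Fk] and HqP = H.amap_hom[OF qP] and HqR = H.amap_hom[OF qR]
      and tP = \<tau>_hom[OF is_algD(1)[OF P]] and tR = \<tau>_hom[OF is_algD(1)[OF R]]
    have "(\<sigma> R \<cdot>\<^bsub>C\<^esub> amap G u) \<cdot>\<^bsub>C\<^esub> amap G (quot P) = (\<sigma> R \<cdot>\<^bsub>C\<^esub> amap G (quot R)) \<cdot>\<^bsub>C\<^esub> amap G (amap FrF k)"
      using t.F.B.Comp_assoc[OF GqP Gu \<sigma>(1)[OF R]] t.F.B.Comp_assoc[OF GFk GqR \<sigma>(1)[OF R]]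
        G.amap_Comp[OF qP u] G.amap_Comp[OF Fk qR] uk by simp
    also have "\<dots> = amap H (quot R) \<cdot>\<^bsub>C\<^esub> (amap H (amap FrF k) \<cdot>\<^bsub>C\<^esub> \<tau> (car P))"
      using t.F.B.Comp_assoc[OF GFk tR HqR] by (simp add: \<sigma>(2)[OF R] \<tau>_nat[OF k])
    also have "\<dots> = (amap H u \<cdot>\<^bsub>C\<^esub> amap H (quot P)) \<cdot>\<^bsub>C\<^esub> \<tau> (car P)"
      using t.F.B.Comp_assoc[OF tP HFk HqR] H.amap_Comp[OF qP u] H.amap_Comp[OF Fk qR] uk by simp
    also have "\<dots> = (amap H u \<cdot>\<^bsub>C\<^esub> \<sigma> P) \<cdot>\<^bsub>C\<^esub> amap G (quot P)"
      using t.F.B.Comp_assoc[OF tP HqP Hu] t.F.B.Comp_assoc[OF GqP \<sigma>(1)[OF P] Hu] by (simp add: \<sigma>(2)[OF P])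
    finally show ?thesis
      by (rule t.F.B.coequalizer_epi[OF coeq[OF P] t.F.B.Comp_hom[OF Gu \<sigma>(1)[OF R]] t.F.B.Comp_hom[OF \<sigma>(1)[OF P] Hu]])
  qed
  have nat: "\<sigma> R \<cdot>\<^bsub>C\<^esub> amap G u = amap H u \<cdot>\<^bsub>C\<^esub> \<sigma> P" if u: "u \<in> hom (Alg T) P R" for u P R
  proof -
    obtain f where f: "u = aar P f R" "is_alghom P R f" using u by (rule hom_AlgE)
    note F = is_alghomD[OF f(2)]
    let ?f = "\<lambda>x. eta (car R) (f x)"
    have f': "?f \<in> car P \<rightarrow> TT (car R)" using F by (simp add: Pi_iff)
    have "f (str P t) = str R (bind (car P) ?f (car R) t)" if "t \<in> TT (car P)" for t
      using F(4)[OF that] tmap_eq_bind[OF F(5,6,3) that] by (simp add: ev_def)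
    then have "u \<cdot>\<^bsub>Alg T\<^esub> quot P = quot R \<cdot>\<^bsub>Alg T\<^esub> amap FrF (kar (car P) ?f (car R))"
      using is_alghomD(3)[OF is_alghom_str[OF F(1)]] is_alghomD(3)[OF is_alghom_bind[OF F(5,6) f']]
      by (simp add: f(1) quot_def FrF_kar aar_comp aar_eq_iff)
    then show ?thesis
      using lift[OF u, of "kar (car P) ?f (car R)"] F(5,6) f' by (simp add: kar_in_hom)
  qed
  have free: "\<sigma> (Fr X) = \<tau> X" if X: "sm X" for X
  proof -
    let ?k = "kar (TT X) (\<lambda>t. t) X"
    have k: "?k \<in> hom K (TT X) X" using X by (simp add: kar_in_hom)
    have q: "quot (Fr X) = amap FrF ?k"
      using X by (simp add: quot_def FrF_kar aar_eq_iff str_Fr mu_eq_bind)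
    note Fr = is_alg_Fr[OF X]
    have "\<sigma> (Fr X) \<cdot>\<^bsub>C\<^esub> amap G (quot (Fr X)) = \<tau> X \<cdot>\<^bsub>C\<^esub> amap G (quot (Fr X))"
      using \<sigma>(2)[OF Fr] \<tau>_nat[OF k] by (simp add: q)
    then show ?thesis
      by (rule t.F.B.coequalizer_epi[OF coeq[OF Fr] \<sigma>(1)[OF Fr] \<tau>_hom[OF X]])
  qed
  have "nat_trans (Alg T) C G H \<sigma>"
    by (intro nat_trans.intro nat_trans_axioms.intro G.is_functor_axioms H.is_functor_axioms \<sigma> nat)
  then have "Arrow G \<sigma> H \<in> hom (Hom_c TYPE('u) (Alg T) C) G H"
    using G H by (simp add: hom_Hom_c \<sigma>_def)
  moreover have "(\<lambda>X\<in>Obj K. \<sigma> (Fr X)) = \<tau>"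
    using \<tau>(3) by (auto simp: restrict_def fun_eq_iff extensional_def K_simps free)
  then have "amap Restr (Arrow G \<sigma> H) = t" by (simp add: Restr_def \<tau>(1))
  ultimately show ?thesis by blast
qed

text \<open>
  A coalgebra \<open>W\<close> is isomorphic to the restriction of its extension \<open>VF\<close>.
\<close>

lemma Restr_essentially_surjective:
  assumes C: "locally_small TYPE('u) C" "cocomplete TYPE('u) C" and W: "W \<in> Obj (CoAlg C T)"
  shows "\<exists>G\<in>Obj (Hom_c TYPE('u) (Alg T) C). \<exists>e\<in>hom (CoAlg C T) (restr G) W. is_iso (CoAlg C T) e"
proof -
  have WF: "is_functor K C W" using W by (simp add: Obj_CoAlg)
  interpret coalgebra T C W
    using W C by (intro coalgebra.intro coalgebra_axioms.intro monad_on_sets_axioms) (simp_all add: Obj_CoAlg)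
  obtain \<zeta>0 \<zeta>0' where
    \<zeta>0: "\<And>X. sm X \<Longrightarrow> \<zeta>0 X \<in> hom C (omap VF (Fr X)) (omap W X)" and
    \<zeta>0': "\<And>X. sm X \<Longrightarrow> \<zeta>0' X \<in> hom C (omap W X) (omap VF (Fr X))" and
    inv1: "\<And>X. sm X \<Longrightarrow> \<zeta>0' X \<cdot>\<^bsub>C\<^esub> \<zeta>0 X = Ident C (omap VF (Fr X))" and
    inv2: "\<And>X. sm X \<Longrightarrow> \<zeta>0 X \<cdot>\<^bsub>C\<^esub> \<zeta>0' X = Ident C (omap W X)" and
    nat: "\<And>X Y k. k \<in> hom K X Y \<Longrightarrow> \<zeta>0 Y \<cdot>\<^bsub>C\<^esub> amap VF (amap FrF k) = amap W k \<cdot>\<^bsub>C\<^esub> \<zeta>0 X"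
    by (rule VF_free_iso) blast
  define \<zeta> where "\<zeta> = restrict \<zeta>0 (Obj K)"
  define \<zeta>' where "\<zeta>' = restrict \<zeta>0' (Obj K)"
  have V: "VF \<in> Obj (Hom_c TYPE('u) (Alg T) C)"
    using is_functor_VF cocontinuous_VF by (simp add: Obj_Hom_c) (simp add: VF_def)
  then have RV: "restr VF \<in> Obj (CoAlg C T)" by (rule restr_Obj)
  have n: "nat_trans K C (restr VF) W \<zeta>"
  proof (intro nat_trans.intro nat_trans_axioms.intro WF)
    show "is_functor K C (restr VF)" using RV by (simp add: Obj_CoAlg)
    show "\<zeta> X \<in> hom C (omap (restr VF) X) (omap W X)" if "X \<in> Obj K" for X
      using that \<zeta>0 by (simp add: \<zeta>_def K_simps restr_simps)
    show "\<zeta> Y \<cdot>\<^bsub>C\<^esub> amap (restr VF) f = amap W f \<cdot>\<^bsub>C\<^esub> \<zeta> X" if f: "f \<in> hom K X Y" for f X Y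
      using nat[OF f] FF.A.hom_ObjD[OF f] by (simp add: \<zeta>_def restr_simps(2)[OF f])
  qed
  have n': "nat_trans K C W (restr VF) \<zeta>'"
    by (rule nat_trans_inverse[OF n])
      (simp_all add: \<zeta>_def \<zeta>'_def K_simps restr_simps \<zeta>0' inv1 inv2)
  let ?e = "Arrow W \<zeta> (restr VF)" and ?e' = "Arrow (restr VF) \<zeta>' W"
  have e: "?e \<in> hom (CoAlg C T) (restr VF) W"
    using n RV W by (simp add: hom_CoAlg \<zeta>_def)
  have e': "?e' \<in> hom (CoAlg C T) W (restr VF)"
    using n' RV W by (simp add: hom_CoAlg \<zeta>'_def)
  have "?e' \<cdot>\<^bsub>CoAlg C T\<^esub> ?e = Ident (CoAlg C T) (restr VF)" "?e \<cdot>\<^bsub>CoAlg C T\<^esub> ?e' = Ident (CoAlg C T) W"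
    by (auto simp: CoAlg_simps \<zeta>_def \<zeta>'_def restrict_def fun_eq_iff K_simps restr_simps inv1 inv2)
  then have "is_iso (CoAlg C T) ?e" using is_isoI[OF e e'] by simp
  then show ?thesis using V e by blast
qed

end

section \<open>The equivalence\<close>

theorem theorem5p17:
  fixes T :: "'u::universe set_monad"
  assumes "monad set_cat T"
  shows "cocomplete TYPE('u) (Alg T) \<and>
    (\<forall>C :: ('o, 'a) cat. category C \<and> locally_small TYPE('u) C \<and> cocomplete TYPE('u) C \<longrightarrow>
       equivalent_cats (Hom_c TYPE('u) (Alg T) C) (CoAlg C T))"
proof -
  interpret monad_on_sets T using assms by (rule monad_on_sets.intro)
  have "equivalent_cats (Hom_c TYPE('u) (Alg T) C) (CoAlg C T)"
    if C: "category C" "locally_small TYPE('u) C" "cocomplete TYPE('u) C" for C :: "('o, 'a) cat"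
  proof (rule equivalent_catsI[OF is_functor_Restr[OF C(1)]])
    show "s = t" if "s \<in> hom (Hom_c TYPE('u) (Alg T) C) G H" "t \<in> hom (Hom_c TYPE('u) (Alg T) C) G H"
      "amap Restr s = amap Restr t" for s t G H
      using Restr_faithful that .
    show "\<exists>f\<in>hom (Hom_c TYPE('u) (Alg T) C) G H. amap Restr f = k"
      if "G \<in> Obj (Hom_c TYPE('u) (Alg T) C)" "H \<in> Obj (Hom_c TYPE('u) (Alg T) C)"
        "k \<in> hom (CoAlg C T) (omap Restr G) (omap Restr H)" for G H k
      using Restr_full[of G C H k] that by (simp add: Restr_def)
    show "\<exists>G\<in>Obj (Hom_c TYPE('u) (Alg T) C). \<exists>e\<in>hom (CoAlg C T) (omap Restr G) W. is_iso (CoAlg C T) e"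
      if "W \<in> Obj (CoAlg C T)" for W
      using Restr_essentially_surjective[OF C(2,3) that] by (simp add: Restr_def)
  qed
  then show ?thesis using cocomplete_Alg by blast
qed

end
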